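(* Let $\alpha \in \omega_1$ be such that $L_\alpha$ is the minimum model of $\mathsf{M}+\Pi_1\textsf{-Collection}$. There is no $\mathcal{L}$-structure $\mathcal{N}= \langle N, \in^{\mathcal{N}} \rangle$ such that $\langle L_\alpha, \in \rangle \prec_{e, 2} \mathcal{N}$, $L_\alpha \neq N$ and $\mathcal{N} \models \Delta_0\textsf{-Collection}$.
   Context: $\mathcal{L}$ is the first-order language with equality and one binary relation symbol $\in$. $\Delta_0=\Sigma_0=\Pi_0$, $\Sigma_k$, $\Pi_k$ are the L\'evy classes of $\mathcal{L}$-formulae. For a class $\Gamma$ of $\mathcal{L}$-formulae, $\Gamma\textsf{-Collection}$ is the scheme $\forall \vec z\,\forall w\,((\forall x\in w)\exists y\,\phi(x,y,\vec z)\Rightarrow \exists c(\forall x\in w)(\exists y\in c)\phi(x,y,\vec z))$ for $\phi\in\Gamma$. $\mathsf{M}^-$ is the $\mathcal{L}$-theory with axioms: Extensionality, Pair, Union, Emptyset, Infinity (there is a set containing $\emptyset$ and closed under $y\mapsto y\cup\{y\}$), $\mathsf{TCo}$ (every set is a subset of a transitive set), Set-Foundation (every nonempty set has an $\in$-minimal element), and $\Delta_0\textsf{-Separation}$. $\mathsf{M}$ is $\mathsf{M}^-$ plus the Powerset axiom. $L_\alpha$ is the $\alpha$-th level of G\"odel's constructible hierarchy. A transitive set $K$ is the minimum model of a theory $T$ if $\langle K,\in\rangle\models T$ and $K\subseteq K'$ for every transitive $K'$ with $\langle K',\in\rangle\models T$. For structures $\mathcal{M}=\langle M,\in^{\mathcal{M}}\rangle$,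 $\mathcal{N}=\langle N,\in^{\mathcal{N}}\rangle$ (not necessarily well-founded), $\mathcal{M}\prec_{e,k}\mathcal{N}$ means: $\mathcal{M}$ is a substructure of $\mathcal{N}$; $\mathcal{N}$ is an end extension of $\mathcal{M}$ (if $y\in M$, $x\in N$ and $\mathcal{N}\models x\in y$ then $x\in M$); and for every $\Sigma_k$-formula $\phi$ and all $\vec a\in M$, $\mathcal{M}\models\phi(\vec a)$ iff $\mathcal{N}\models\phi(\vec a)$. *)

theory Defs
  imports Main "HOL-Library.Countable_Set" "HOL-Library.FuncSet" "HOL-Library.Infinite_Typeclass"
begin

section \<open>First-order formulae in the language of set theory\<close>

datatype fm =
    Mem nat nat
  | Eq nat nat
  | Neg fm
  | Conj fm fm
  | Disj fm fm
  | Imp fm fm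
  | All nat fm
  | Ex nat fm

instance fm :: countable
  by countable_datatype

primrec fv :: "fm \<Rightarrow> nat set" where
  "fv (Mem x y) = {x, y}"
| "fv (Eq x y) = {x, y}"
| "fv (Neg p) = fv p"
| "fv (Conj p q) = fv p \<union> fv q"
| "fv (Disj p q) = fv p \<union> fv q"
| "fv (Imp p q) = fv p \<union> fv q"
| "fv (All x p) = fv p - {x}"
| "fv (Ex x p) = fv p - {x}"

primrec sat :: "'m set \<Rightarrow> ('m \<Rightarrow> 'm \<Rightarrow> bool) \<Rightarrow> (nat \<Rightarrow> 'm) \<Rightarrow> fm \<Rightarrow> bool" where
  "sat M E s (Mem x y) \<longleftrightarrow> E (s x) (s y)"
| "sat M E s (Eq x y) \<longleftrightarrow> s x = s y"
| "sat M E s (Neg p) \<longleftrightarrow> \<not> sat M E s p"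
| "sat M E s (Conj p q) \<longleftrightarrow> sat M E s p \<and> sat M E s q"
| "sat M E s (Disj p q) \<longleftrightarrow> sat M E s p \<or> sat M E s q"
| "sat M E s (Imp p q) \<longleftrightarrow> (sat M E s p \<longrightarrow> sat M E s q)"
| "sat M E s (All x p) \<longleftrightarrow> (\<forall>a\<in>M. sat M E (s(x := a)) p)"
| "sat M E s (Ex x p) \<longleftrightarrow> (\<exists>a\<in>M. sat M E (s(x := a)) p)"

text \<open>A formula with free variables is read as its universal closure. Carriers of structures are
  nonempty; without this conjunct every theory would hold in the empty structure.\<close>

definition models :: "'m set \<Rightarrow> ('m \<Rightarrow> 'm \<Rightarrow> bool) \<Rightarrow> fm set \<Rightarrow> bool" where
  "models M E T \<longleftrightarrow> M \<noteq> {} \<and> (\<forall>p\<in>T. \<forall>s. range s \<subseteq> M \<longrightarrow> sat M E s p)"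

abbreviation Iff :: "fm \<Rightarrow> fm \<Rightarrow> fm" where
  "Iff p q \<equiv> Conj (Imp p q) (Imp q p)"

abbreviation BAll :: "nat \<Rightarrow> nat \<Rightarrow> fm \<Rightarrow> fm" where
  "BAll x y p \<equiv> All x (Imp (Mem x y) p)"

abbreviation BEx :: "nat \<Rightarrow> nat \<Rightarrow> fm \<Rightarrow> fm" where
  "BEx x y p \<equiv> Ex x (Conj (Mem x y) p)"


section \<open>The Levy hierarchy\<close>

inductive_set Delta0 :: "fm set" where
  "Mem x y \<in> Delta0"
| "Eq x y \<in> Delta0"
| "p \<in> Delta0 \<Longrightarrow> Neg p \<in> Delta0"
| "p \<in> Delta0 \<Longrightarrow> q \<in> Delta0 \<Longrightarrow> Conj p q \<in> Delta0"
| "p \<in> Delta0 \<Longrightarrow> q \<in> Delta0 \<Longrightarrow> Disj p q \<in> Delta0"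
| "p \<in> Delta0 \<Longrightarrow> q \<in> Delta0 \<Longrightarrow> Imp p q \<in> Delta0"
| "p \<in> Delta0 \<Longrightarrow> x \<noteq> y \<Longrightarrow> BAll x y p \<in> Delta0"
| "p \<in> Delta0 \<Longrightarrow> x \<noteq> y \<Longrightarrow> BEx x y p \<in> Delta0"

text \<open>Quantifier blocks have arbitrary finite length, possibly zero, so the classes are cumulative.\<close>

fun levy_Sigma :: "nat \<Rightarrow> fm set" and levy_Pi :: "nat \<Rightarrow> fm set" where
  "levy_Sigma 0 = Delta0"
| "levy_Sigma (Suc k) = {foldr Ex xs p | xs p. p \<in> levy_Pi k}"
| "levy_Pi 0 = Delta0"
| "levy_Pi (Suc k) = {foldr All xs p | xs p. p \<in> levy_Sigma k}"


section \<open>The theories\<close>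

definition ax_Extensionality :: fm where
  "ax_Extensionality = All 0 (All 1 (Imp (All 2 (Iff (Mem 2 0) (Mem 2 1))) (Eq 0 1)))"

definition ax_Pair :: fm where
  "ax_Pair = All 0 (All 1 (Ex 2 (All 3 (Iff (Mem 3 2) (Disj (Eq 3 0) (Eq 3 1))))))"

definition ax_Union :: fm where
  "ax_Union = All 0 (Ex 1 (All 2 (Iff (Mem 2 1) (BEx 3 0 (Mem 2 3)))))"

definition ax_Emptyset :: fm where
  "ax_Emptyset = Ex 0 (All 1 (Neg (Mem 1 0)))"

definition ax_Infinity :: fm where
  "ax_Infinity = Ex 0 (Conj
     (BEx 1 0 (All 2 (Neg (Mem 2 1))))
     (BAll 1 0 (BEx 2 0 (All 3 (Iff (Mem 3 2) (Disj (Mem 3 1) (Eq 3 1)))))))"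

definition ax_TCo :: fm where
  "ax_TCo = All 0 (Ex 1 (Conj (BAll 2 1 (BAll 3 2 (Mem 3 1))) (BAll 2 0 (Mem 2 1))))"

definition ax_Set_Foundation :: fm where
  "ax_Set_Foundation =
     All 0 (Imp (Ex 1 (Mem 1 0)) (BEx 1 0 (Neg (BEx 2 0 (Mem 2 1)))))"

definition ax_Powerset :: fm where
  "ax_Powerset = All 0 (Ex 1 (All 2 (Iff (Mem 2 1) (BAll 3 2 (Mem 3 0)))))"

text \<open>In both schemes the free variables of the formula other than the ones named in the instance
  are the parameters, which \<open>models\<close> quantifies universally.\<close>

definition Separation :: "fm set \<Rightarrow> fm set" where
  "Separation \<Gamma> =
     {All w (Ex y (All x (Iff (Mem x y) (Conj (Mem x w) p)))) | p x y w.
        p \<in> \<Gamma> \<and> distinct [x, y, w] \<and> y \<notin> fv p \<and> w \<notin> fv p}"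

definition Collection :: "fm set \<Rightarrow> fm set" where
  "Collection \<Gamma> =
     {All w (Imp (BAll x w (Ex y p)) (Ex c (BAll x w (BEx y c p)))) | p x y w c.
        p \<in> \<Gamma> \<and> distinct [x, y, w, c] \<and> w \<notin> fv p \<and> c \<notin> fv p}"

definition M_minus :: "fm set" where
  "M_minus = {ax_Extensionality, ax_Pair, ax_Union, ax_Emptyset, ax_Infinity, ax_TCo,
     ax_Set_Foundation} \<union> Separation Delta0"

definition M_theory :: "fm set" where
  "M_theory = M_minus \<union> {ax_Powerset}"


section \<open>Elementary end extensions\<close>

definition end_ext ::
  "nat \<Rightarrow> 'm set \<Rightarrow> ('m \<Rightarrow> 'm \<Rightarrow> bool) \<Rightarrow> 'm set \<Rightarrow> ('m \<Rightarrow> 'm \<Rightarrow> bool) \<Rightarrow> bool" where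
  "end_ext k M E N F \<longleftrightarrow>
     M \<noteq> {} \<and> M \<subseteq> N \<and> (\<forall>x\<in>M. \<forall>y\<in>M. E x y \<longleftrightarrow> F x y) \<and>
     (\<forall>y\<in>M. \<forall>x\<in>N. F x y \<longrightarrow> x \<in> M) \<and>
     (\<forall>p\<in>levy_Sigma k. \<forall>s. range s \<subseteq> M \<longrightarrow> (sat M E s p \<longleftrightarrow> sat N F s p))"


section \<open>A universe of sets\<close>

text \<open>For an infinite type \<open>'a\<close>, the type \<open>'a V\<close> consists of the sets that are hereditarily of
  cardinality at most that of \<open>'a\<close>: well-founded trees whose nodes have their children indexed by
  a subset of \<open>'a\<close>, modulo extensional equality. Every set of ZFC occurs in \<open>'a V\<close> once \<open>'a\<close> is
  large enough, so a statement for all infinite \<open>'a\<close> is one about all sets.\<close>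

datatype 'a tree = Node "'a \<Rightarrow> 'a tree option"

primrec children :: "'a tree \<Rightarrow> 'a tree set" where
  "children (Node f) = {t. Some t \<in> range f}"

inductive tree_eq :: "'a tree \<Rightarrow> 'a tree \<Rightarrow> bool" where
  "(\<And>u. u \<in> children t \<Longrightarrow> \<exists>u'\<in>children t'. tree_eq u u') \<Longrightarrow>
   (\<And>u'. u' \<in> children t' \<Longrightarrow> \<exists>u\<in>children t. tree_eq u u') \<Longrightarrow> tree_eq t t'"

lemma tree_eq_iff:
  "tree_eq t t' \<longleftrightarrow>
     (\<forall>u\<in>children t. \<exists>u'\<in>children t'. tree_eq u u') \<and>
     (\<forall>u'\<in>children t'. \<exists>u\<in>children t. tree_eq u u')"
  by (subst tree_eq.simps) blast

lemma tree_children_induct [case_names children]: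
  assumes "\<And>t. (\<And>u. u \<in> children t \<Longrightarrow> P u) \<Longrightarrow> P t"
  shows "P t"
proof (induction t)
  case (Node f)
  show ?case
  proof (rule assms)
    fix u assume "u \<in> children (Node f)"
    then show "P u" using Node.IH by (metis children.simps mem_Collect_eq option.set_intros)
  qed
qed

lemma tree_eq_refl: "tree_eq t t"
  by (induction t rule: tree_children_induct) (subst tree_eq_iff, blast)

lemma tree_eq_sym: "tree_eq t u \<Longrightarrow> tree_eq u t"
proof (induction t arbitrary: u rule: tree_children_induct)
  case (children t)
  show ?case
    using children.prems children.IH by (subst tree_eq_iff, subst (asm) tree_eq_iff) meson
qed

lemma tree_eq_trans: "tree_eq t u \<Longrightarrow> tree_eq u v \<Longrightarrow> tree_eq t v"
proof (induction t arbitrary: u v rule: tree_children_induct)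
  case (children t)
  have "\<exists>z\<in>children v. tree_eq x z" if "x \<in> children t" for x
    using that children.prems children.IH by (meson tree_eq_iff)
  moreover have "\<exists>x\<in>children t. tree_eq x z" if "z \<in> children v" for z
    using that children.prems children.IH by (meson tree_eq_iff)
  ultimately show ?case by (subst tree_eq_iff) blast
qed

quotient_type 'a V = "'a tree" / tree_eq
proof (rule equivpI)
  show "reflp tree_eq" by (simp add: reflpI tree_eq_refl)
  show "symp tree_eq" by (blast intro: sympI tree_eq_sym)
  show "transp tree_eq" by (blast intro: transpI tree_eq_trans)
qed

lift_definition elts :: "'a V \<Rightarrow> 'a V set" is children
  unfolding rel_set_def by (subst (asm) tree_eq_iff) blast

definition vmem :: "'a V \<Rightarrow> 'a V \<Rightarrow> bool" where
  "vmem x y \<longleftrightarrow> x \<in> elts y"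

definition small :: "'a V set \<Rightarrow> bool" where
  "small A \<longleftrightarrow> (\<exists>f :: 'a \<Rightarrow> 'a V. A \<subseteq> range f)"

definition vset :: "'a V set \<Rightarrow> 'a V" where
  "vset A = (THE x. elts x = A)"

lemma elts_abs_V: "elts (abs_V t) = abs_V ` children t"
  by (simp add: elts.abs_eq)

lemma abs_rep_V [simp]: "abs_V (rep_V x) = x"
  by (rule Quotient_abs_rep[OF Quotient_V])

lemma V_ext:
  assumes "elts x = elts y" shows "x = y"
proof -
  have "abs_V ` children (rep_V x) = abs_V ` children (rep_V y)"
    using assms by (simp flip: elts_abs_V)
  then have "tree_eq (rep_V x) (rep_V y)"
    by (subst tree_eq_iff) (metis (no_types, lifting) V.abs_eq_iff image_iff)
  then show ?thesis by (metis V.abs_eq_iff abs_rep_V)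
qed

lemma small_subset: "small B \<Longrightarrow> A \<subseteq> B \<Longrightarrow> small A"
  unfolding small_def by blast

lemma small_elts: "small (elts x)"
proof -
  obtain f where f: "rep_V x = Node f" by (cases "rep_V x")
  have "elts x = abs_V ` {t. Some t \<in> range f}"
    by (metis abs_rep_V elts_abs_V f children.simps)
  also have "\<dots> \<subseteq> range (\<lambda>a. abs_V (the (f a)))"
  proof
    fix y assume "y \<in> abs_V ` {t. Some t \<in> range f}"
    then obtain t where "Some t \<in> range f" "y = abs_V t" by blast
    then obtain a where "f a = Some t" by (metis rangeE)
    with \<open>y = abs_V t\<close> have "y = abs_V (the (f a))" by simp
    then show "y \<in> range (\<lambda>a. abs_V (the (f a)))" by blast
  qed
  finally show ?thesis unfolding small_def by blast
qed

lemma elts_vset: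
  assumes "small A" shows "elts (vset A) = A"
proof -
  obtain f :: "'a \<Rightarrow> 'a V" where f: "A \<subseteq> range f" using assms unfolding small_def by blast
  let ?t = "Node (\<lambda>a. if f a \<in> A then Some (rep_V (f a)) else None)"
  have "children ?t = rep_V ` A"
  proof
    show "children ?t \<subseteq> rep_V ` A" by (auto split: if_splits)
    show "rep_V ` A \<subseteq> children ?t"
    proof
      fix t assume "t \<in> rep_V ` A"
      then obtain x where x: "x \<in> A" "t = rep_V x" by blast
      then obtain a where "x = f a" using f by blast
      with x have "Some t = (if f a \<in> A then Some (rep_V (f a)) else None)" by simp
      then show "t \<in> children ?t" by (simp only: children.simps) blast
    qed
  qed
  then have "elts (abs_V ?t) = A"
    by (simp only: elts_abs_V image_image abs_rep_V image_ident)
  then show ?thesis unfolding vset_def by (rule theI) (simp add: V_ext \<open>elts (abs_V ?t) = A\<close>)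
qed

lemma wf_vmem: "wf {(x, y). vmem x y}"
proof (rule wfUNIVI)
  fix P :: "'a V \<Rightarrow> bool" and x
  assume step: "\<forall>x. (\<forall>y. (y, x) \<in> {(x, y). vmem x y} \<longrightarrow> P y) \<longrightarrow> P x"
  have "P (abs_V t)" for t
  proof (induction t rule: tree_children_induct)
    case (children t)
    then show ?case using step[rule_format, of "abs_V t"] by (auto simp: vmem_def elts_abs_V)
  qed
  then show "P x" by (metis abs_rep_V)
qed

definition transitive :: "'a V \<Rightarrow> bool" where
  "transitive x \<longleftrightarrow> (\<forall>y\<in>elts x. elts y \<subseteq> elts x)"

definition ordinal :: "'a V \<Rightarrow> bool" where
  "ordinal x \<longleftrightarrow> transitive x \<and> (\<forall>y\<in>elts x. transitive y)"

definition minimum_model :: "fm set \<Rightarrow> 'a V \<Rightarrow> bool" where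
  "minimum_model T K \<longleftrightarrow>
     transitive K \<and> models (elts K) vmem T \<and>
     (\<forall>K'. transitive K' \<and> models (elts K') vmem T \<longrightarrow> elts K \<subseteq> elts K')"


section \<open>The constructible hierarchy\<close>

text \<open>The parameters are the values of \<open>s\<close> at the free variables other than \<open>0\<close>; only these are
  required to lie in \<open>X\<close>, so that \<open>Def\<close> of the empty set contains the empty set.\<close>

definition Def :: "'a V \<Rightarrow> 'a V set" where
  "Def X = {y. \<exists>p s. (\<forall>i\<in>fv p - {0}. s i \<in> elts X) \<and>
     elts y = {x \<in> elts X. sat (elts X) vmem (s(0 := x)) p}}"

text \<open>This single clause gives the usual successor and limit clauses: the levels are increasing,
  and every level is contained in \<open>Def\<close> of itself.\<close>

function Lset :: "'a V \<Rightarrow> 'a V" where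
  "Lset \<alpha> = vset (\<Union>\<beta>\<in>elts \<alpha>. Def (Lset \<beta>))"
  by auto
termination
  by (relation "{(x, y). vmem x y}") (use wf_vmem in \<open>auto simp: vmem_def\<close>)

declare Lset.simps [simp del]

text \<open>The levels are genuine sets, so \<open>vset\<close> is never applied outside its domain here.\<close>

unbundle cardinal_syntax

lemma small_iff: "small A \<longleftrightarrow> |A| \<le>o |UNIV :: 'a set|" for A :: "'a V set"
proof
  assume "small A"
  then show "|A| \<le>o |UNIV :: 'a set|" unfolding small_def by (metis surj_imp_ordLeq)
next
  assume le: "|A| \<le>o |UNIV :: 'a set|"
  show "small A"
  proof (cases "A = {}")
    case False
    with le obtain g :: "'a \<Rightarrow> 'a V" where "range g = A" using card_of_ordLeq2 by metis
    then show ?thesis unfolding small_def by blast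
  qed (simp add: small_def)
qed

lemma sat_cong: "(\<And>i. i \<in> fv p \<Longrightarrow> s i = s' i) \<Longrightarrow> sat M E s p \<longleftrightarrow> sat M E s' p"
proof (induction p arbitrary: s s')
  case (All x p)
  have "sat M E (s(x := a)) p \<longleftrightarrow> sat M E (s'(x := a)) p" for a
    by (rule All.IH) (use All.prems in auto)
  then show ?case by simp
next
  case (Ex x p)
  have "sat M E (s(x := a)) p \<longleftrightarrow> sat M E (s'(x := a)) p" for a
    by (rule Ex.IH) (use Ex.prems in auto)
  then show ?case by simp
next
  case (Neg p)
  have "sat M E s p \<longleftrightarrow> sat M E s' p" by (rule Neg.IH) (use Neg.prems in auto)
  then show ?case by simp
next
  case (Conj p q)
  have "sat M E s p \<longleftrightarrow> sat M E s' p" by (rule Conj.IH) (use Conj.prems in auto)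
  moreover have "sat M E s q \<longleftrightarrow> sat M E s' q" by (rule Conj.IH) (use Conj.prems in auto)
  ultimately show ?case by simp
next
  case (Disj p q)
  have "sat M E s p \<longleftrightarrow> sat M E s' p" by (rule Disj.IH) (use Disj.prems in auto)
  moreover have "sat M E s q \<longleftrightarrow> sat M E s' q" by (rule Disj.IH) (use Disj.prems in auto)
  ultimately show ?case by simp
next
  case (Imp p q)
  have "sat M E s p \<longleftrightarrow> sat M E s' p" by (rule Imp.IH) (use Imp.prems in auto)
  moreover have "sat M E s q \<longleftrightarrow> sat M E s' q" by (rule Imp.IH) (use Imp.prems in auto)
  ultimately show ?case by simp
qed simp_all

lemma finite_fv: "finite (fv p)"
  by (induction p) auto

lemma card_singleton_ordLeq: "|{z}| \<le>o |UNIV :: 'a set|"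
  by (rule surj_imp_ordLeq[of _ "\<lambda>_. z"]) simp

lemma card_fm_ordLeq: "|UNIV :: fm set| \<le>o |UNIV :: 'a::infinite set|"
proof -
  obtain h :: "nat \<Rightarrow> 'a" where "inj h"
    using infinite_countable_subset[OF infinite_UNIV] by blast
  then have "inj (h \<circ> to_nat :: fm \<Rightarrow> 'a)" by (simp add: inj_compose)
  then show ?thesis by (meson card_of_ordLeq top_greatest)
qed

lemma card_PiE_ordLeq:
  fixes B :: "'b set"
  assumes "finite D" "|B| \<le>o |UNIV :: 'a::infinite set|"
  shows "|PiE D (\<lambda>_. B)| \<le>o |UNIV :: 'a set|"
  using assms(1)
proof induction
  case empty
  then show ?case by (simp add: card_singleton_ordLeq)
next
  case (insert i D)
  have "PiE (insert i D) (\<lambda>_. B) = (\<Union>y\<in>B. \<Union>g\<in>PiE D (\<lambda>_. B). {g(i := y)})"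
    by (auto simp: PiE_insert_eq)
  moreover have "|\<Union>y\<in>B. \<Union>g\<in>PiE D (\<lambda>_. B). {g(i := y)}| \<le>o |UNIV :: 'a set|"
    by (intro card_of_UNION_ordLeq_infinite ballI infinite_UNIV assms(2) insert.IH
      card_singleton_ordLeq)
  ultimately show ?case by simp
qed

lemma small_Def: "small (Def X)" for X :: "'a::infinite V"
proof -
  let ?D = "\<lambda>p s. {x \<in> elts X. sat (elts X) vmem (s(0 := x)) p}"
  let ?F = "\<lambda>p. PiE (fv p - {0}) (\<lambda>_. elts X)"
  have sub: "Def X \<subseteq> (\<Union>p. \<Union>s\<in>?F p. {vset (?D p s)})"
  proof
    fix y assume "y \<in> Def X"
    then obtain p s where s: "\<forall>i\<in>fv p - {0}. s i \<in> elts X" and y: "elts y = ?D p s"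
      unfolding Def_def by blast
    let ?s = "restrict s (fv p - {0})"
    have "?D p s = ?D p ?s"
      by (intro Collect_cong conj_cong refl sat_cong) auto
    then have "y = vset (?D p ?s)"
      by (metis y V_ext elts_vset small_elts)
    moreover have "?s \<in> ?F p" using s by auto
    ultimately show "y \<in> (\<Union>p. \<Union>s\<in>?F p. {vset (?D p s)})" by blast
  qed
  have "|?F p| \<le>o |UNIV :: 'a set|" for p
    by (intro card_PiE_ordLeq finite_Diff finite_fv small_elts[unfolded small_iff])
  then have "|\<Union>p. \<Union>s\<in>?F p. {vset (?D p s)}| \<le>o |UNIV :: 'a set|"
    by (intro card_of_UNION_ordLeq_infinite ballI infinite_UNIV card_fm_ordLeq
      card_singleton_ordLeq)
  then show ?thesis using sub small_iff small_subset by blast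
qed

lemma elts_Lset: "elts (Lset \<alpha>) = (\<Union>\<beta>\<in>elts \<alpha>. Def (Lset \<beta>))" for \<alpha> :: "'a::infinite V"
proof -
  have "|\<Union>\<beta>\<in>elts \<alpha>. Def (Lset \<beta>)| \<le>o |UNIV :: 'a set|"
    by (intro card_of_UNION_ordLeq_infinite ballI infinite_UNIV small_elts[unfolded small_iff]
      small_Def[unfolded small_iff])
  then have "small (\<Union>\<beta>\<in>elts \<alpha>. Def (Lset \<beta>))" by (simp only: small_iff)
  then show ?thesis by (subst Lset.simps) (rule elts_vset)
qed

unbundle no cardinal_syntax

end

theory Submission
  imports Defs
begin

text \<open>
  Let \<open>K\<close> be the minimum model, \<open>T\<close> its theory \<open>M + \<Pi>\<^sub>1-Collection\<close>, and suppose that \<open>N\<close> is a proper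
  \<open>\<Sigma>\<^sub>2\<close>-elementary end extension of \<open>K\<close> with \<open>\<Delta>\<^sub>0\<close>-Collection. Elements of \<open>K\<close> are called standard.
  Minimality is used through two contradictions.

  First, no \<open>u\<close> in \<open>N\<close> has exactly the elements of \<open>K\<close> as its members (\<open>not_internal\<close>). From such a \<open>u\<close>
  the structure \<open>N\<close> could form the set of codes of sentences true in \<open>u\<close>. It is a subset of the
  standard set of all codes, and powersets of standard sets do not grow in \<open>N\<close>, so it is standard
  (\<open>subset_std\<close>). That some transitive set has precisely this theory is a \<open>\<Sigma>\<^sub>1\<close> statement, hence true
  in \<open>K\<close>, and yields a transitive model of \<open>T\<close> that is an element of \<open>K\<close>.

  Second, no nonempty transitive \<open>U\<close> in \<open>K\<close> contains a witness for every statement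
  \<open>\<exists>y. \<forall>z. \<delta>(y, z, s)\<close> with \<open>\<delta>\<close> in \<open>\<Delta>\<^sub>0\<close> and parameters in \<open>U\<close> that is true in \<open>K\<close> (\<open>no_closed\<close>): such a \<open>U\<close>
  is itself a model of \<open>T\<close> (\<open>closed_models\<close>). The only case that needs thought is \<open>\<Pi>\<^sub>1\<close>-Collection. The
  set \<open>U\<close> itself bounds the required witnesses in \<open>K\<close>, and the existence of a bound is a statement
  of the above form when the universal quantifiers are restricted to one universally quantified set.

  It remains to construct \<open>U\<close>. The levels of the constructible hierarchy are described by \<open>\<Delta>\<^sub>0\<close>
  formulae that speak about a set of levels together with a bag of satisfaction relations (\<open>Hi\<close>). In
  \<open>K\<close> every set lies in a level and levels are linearly ordered by membership; these statements are
  \<open>\<Pi>\<^sub>2\<close> and pass to \<open>N\<close>. Fix a level \<open>A\<close> of \<open>N\<close> that is not standard. It contains all standard sets.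
  Some nonstandard level \<open>\<eta>\<close> in \<open>A\<close> is reflecting: whatever holds at some level of \<open>N\<close> of parameters
  from \<open>\<eta>\<close> already holds at a level in \<open>A\<close> (\<open>reflecting_level\<close>). Standard levels have this property because
  \<open>K\<close> is \<open>\<Sigma>\<^sub>1\<close>-elementary in \<open>N\<close>; if all nonstandard levels failed, then from each of them one could
  canonically define a smaller one, and the resulting descending sequence would be an element of \<open>N\<close>
  without minimal member.

  For parameters in \<open>\<eta>\<close>, holding at some level of \<open>N\<close> is thus a bounded property, with bound \<open>A\<close>. So for a
  standard level \<open>t\<close> the set of pairs of a formula and parameters from \<open>t\<close> for which some \<open>y\<close> makes
  the formula fail at every level is a set of \<open>N\<close>, and it is standard by \<open>subset_std\<close>. Now
  \<open>\<Pi>\<^sub>1\<close>-Collection in \<open>K\<close> bounds such \<open>y\<close> by a standard level (\<open>step_std\<close>). The least such level is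
  \<open>\<Delta>\<^sub>0\<close>-definable from \<open>t\<close> and \<open>A\<close>, so the iteration of this step is a sequence in \<open>N\<close> by
  \<open>\<Delta>\<^sub>0\<close>-Collection (\<open>omega_rec\<close>). Let \<open>U\<close> be its union. If every standard set is a member of \<open>U\<close>, the first
  contradiction applies. Otherwise \<open>U\<close> is included in a standard level, so it is standard, and the second
  contradiction applies (\<open>reflecting_top_False\<close>).
\<close>

section \<open>Structures and renaming of variables\<close>

type_synonym 'm str = "'m set \<times> ('m \<Rightarrow> 'm \<Rightarrow> bool)"

abbreviation Sat :: "'m str \<Rightarrow> (nat \<Rightarrow> 'm) \<Rightarrow> fm \<Rightarrow> bool" where
  "Sat m s p \<equiv> sat (fst m) (snd m) s p"

definition ext :: "'m str \<Rightarrow> 'm \<Rightarrow> 'm set" where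
  "ext m y = {x \<in> fst m. snd m x y}"

lemma ext_car: "x \<in> ext m y \<Longrightarrow> x \<in> fst m"
  by (simp add: ext_def)

definition fresh :: "nat set \<Rightarrow> nat" where
  "fresh A = Suc (Max (insert 0 A))"

lemma fresh_gt: "finite A \<Longrightarrow> i \<in> A \<Longrightarrow> i < fresh A"
  unfolding fresh_def by (simp add: less_Suc_eq_le)

text \<open>Bound variables are chosen afresh, so that renaming never captures and keeps every Levy class.\<close>

primrec ren :: "fm \<Rightarrow> (nat \<Rightarrow> nat) \<Rightarrow> fm" where
  "ren (Mem x y) r = Mem (r x) (r y)"
| "ren (Eq x y) r = Eq (r x) (r y)"
| "ren (Neg p) r = Neg (ren p r)"
| "ren (Conj p q) r = Conj (ren p r) (ren q r)"
| "ren (Disj p q) r = Disj (ren p r) (ren q r)"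
| "ren (Imp p q) r = Imp (ren p r) (ren q r)"
| "ren (All x p) r = (let z = fresh (r ` (fv p - {x})) in All z (ren p (r(x := z))))"
| "ren (Ex x p) r = (let z = fresh (r ` (fv p - {x})) in Ex z (ren p (r(x := z))))"

lemma fresh_ren: "i \<in> fv p \<Longrightarrow> i \<noteq> x \<Longrightarrow> r i \<noteq> fresh (r ` (fv p - {x}))"
  using fresh_gt[of "r ` (fv p - {x})" "r i"] finite_fv[of p] by auto

lemma sat_ren: "sat M E s (ren p r) \<longleftrightarrow> sat M E (\<lambda>i. s (r i)) p"
proof (induction p arbitrary: s r)
  case (All x p)
  let ?z = "fresh (r ` (fv p - {x}))"
  have "sat M E (\<lambda>i. (s(?z := a)) ((r(x := ?z)) i)) p \<longleftrightarrow> sat M E ((\<lambda>i. s (r i))(x := a)) p" for a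
    by (rule sat_cong) (use fresh_ren[of _ p x r] in auto)
  then show ?case by (simp add: Let_def All)
next
  case (Ex x p)
  let ?z = "fresh (r ` (fv p - {x}))"
  have "sat M E (\<lambda>i. (s(?z := a)) ((r(x := ?z)) i)) p \<longleftrightarrow> sat M E ((\<lambda>i. s (r i))(x := a)) p" for a
    by (rule sat_cong) (use fresh_ren[of _ p x r] in auto)
  then show ?case by (simp add: Let_def Ex)
qed auto

lemma ren_Delta0: "p \<in> Delta0 \<Longrightarrow> ren p r \<in> Delta0"
proof (induction p arbitrary: r rule: Delta0.induct)
  case (7 p x y)
  let ?z = "fresh (r ` (fv (Imp (Mem x y) p) - {x}))"
  have "r y \<noteq> ?z" using fresh_ren[of y "Imp (Mem x y) p" x r] 7 by auto
  then have "BAll ?z (r y) (ren p (r(x := ?z))) \<in> Delta0"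
    using 7 by (intro Delta0.intros) auto
  then show ?case using 7 by (auto simp: Let_def)
next
  case (8 p x y)
  let ?z = "fresh (r ` (fv (Imp (Mem x y) p) - {x}))"
  have "r y \<noteq> ?z" using fresh_ren[of y "Imp (Mem x y) p" x r] 8 by auto
  then have "BEx ?z (r y) (ren p (r(x := ?z))) \<in> Delta0"
    using 8 by (intro Delta0.intros) auto
  then show ?case using 8 by (auto simp: Let_def)
qed (auto intro: Delta0.intros)

lemma ren_foldr_Ex: "\<exists>ys r'. ren (foldr Ex xs p) r = foldr Ex ys (ren p r')"
proof (induction xs arbitrary: r)
  case Nil
  show ?case by (rule exI[of _ "[]"]) auto
next
  case (Cons x xs)
  obtain z where z: "ren (foldr Ex (x # xs) p) r = Ex z (ren (foldr Ex xs p) (r(x := z)))"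
    by (simp add: Let_def)
  obtain ys r' where "ren (foldr Ex xs p) (r(x := z)) = foldr Ex ys (ren p r')"
    using Cons by blast
  then show ?case using z by (intro exI[of _ "z # ys"]) auto
qed

lemma ren_foldr_All: "\<exists>ys r'. ren (foldr All xs p) r = foldr All ys (ren p r')"
proof (induction xs arbitrary: r)
  case Nil
  show ?case by (rule exI[of _ "[]"]) auto
next
  case (Cons x xs)
  obtain z where z: "ren (foldr All (x # xs) p) r = All z (ren (foldr All xs p) (r(x := z)))"
    by (simp add: Let_def)
  obtain ys r' where "ren (foldr All xs p) (r(x := z)) = foldr All ys (ren p r')"
    using Cons by blast
  then show ?case using z by (intro exI[of _ "z # ys"]) auto
qed

lemma ren_levy: 
  "p \<in> levy_Sigma k \<Longrightarrow> ren p r \<in> levy_Sigma k"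
  "p \<in> levy_Pi k \<Longrightarrow> ren p r \<in> levy_Pi k"
proof (induction k arbitrary: p r)
  case 0
  { case 1 then show ?case by (simp add: ren_Delta0) }
  { case 2 then show ?case by (simp add: ren_Delta0) }
next
  case (Suc k)
  { case 1
    then obtain xs q where "p = foldr Ex xs q" "q \<in> levy_Pi k" by auto
    then show ?case using ren_foldr_Ex[of xs q r] Suc.IH(2) by fastforce }
  { case 2
    then obtain xs q where "p = foldr All xs q" "q \<in> levy_Sigma k" by auto
    then show ?case using ren_foldr_All[of xs q r] Suc.IH(1) by fastforce }
qed

section \<open>Definable relations\<close>

text \<open>Assignments are built from the front: variable \<open>0\<close> is the innermost quantified variable of a relation.\<close>

definition scons :: "'m \<Rightarrow> (nat \<Rightarrow> 'm) \<Rightarrow> nat \<Rightarrow> 'm" (infixr "##" 65) where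
  "(a ## s) i = (case i of 0 \<Rightarrow> a | Suc j \<Rightarrow> s j)"

lemma scons_simps [simp]: "(a ## s) 0 = a" "(a ## s) (Suc i) = s i" "(\<lambda>i. (a ## s) (Suc i)) = s"
  by (simp_all add: scons_def)

lemma range_scons [simp]: "range (a ## s) \<subseteq> A \<longleftrightarrow> a \<in> A \<and> range s \<subseteq> A"
proof -
  have "range (a ## s) = insert a (range s)"
    by (auto simp: scons_def image_iff split: nat.splits)
  then show ?thesis by auto
qed

definition env :: "'m list \<Rightarrow> (nat \<Rightarrow> 'm) \<Rightarrow> nat \<Rightarrow> 'm" where
  "env cs s i = (if i < length cs then cs ! i else s (i - length cs))"

text \<open>Definability is semantic: \<open>R\<close> is represented if one formula of \<open>\<Gamma>\<close>, with one list of constants,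
  defines \<open>R\<close> in all structures of \<open>\<M>\<close> at once. The relations used below are thus ordinary HOL predicates
  whose complexity is established by the closure rules of this section instead of by writing out formulae.
  Two choices of \<open>\<M>\<close> matter: a pair of structures when a fact is transferred between them, and a
  singleton when an axiom scheme is applied in one structure. The constants must belong to every structure of \<open>\<M>\<close>.\<close>

definition rep :: "fm set \<Rightarrow> 'm str set \<Rightarrow> ('m str \<Rightarrow> (nat \<Rightarrow> 'm) \<Rightarrow> bool) \<Rightarrow> bool" where
  "rep \<Gamma> \<M> R \<longleftrightarrow> (\<exists>q\<in>\<Gamma>. \<exists>cs. (\<forall>m\<in>\<M>. set cs \<subseteq> fst m) \<and>
     (\<forall>m\<in>\<M>. \<forall>s. range s \<subseteq> fst m \<longrightarrow> (Sat m (env cs s) q \<longleftrightarrow> R m s)))"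

abbreviation "D0 \<equiv> rep Delta0"
abbreviation "S1 \<equiv> rep (levy_Sigma 1)"
abbreviation "P1 \<equiv> rep (levy_Pi 1)"
abbreviation "P2 \<equiv> rep (levy_Pi 2)"

lemma range_env: "set cs \<subseteq> A \<Longrightarrow> range s \<subseteq> A \<Longrightarrow> range (env cs s) \<subseteq> A"
  by (auto simp: env_def)

definition renc :: "fm set \<Rightarrow> bool" where
  "renc \<Gamma> \<longleftrightarrow> (\<forall>p\<in>\<Gamma>. \<forall>r. ren p r \<in> \<Gamma>)"

lemma renc [simp]: "renc Delta0" "renc (levy_Sigma k)" "renc (levy_Pi k)"
  by (auto simp: renc_def ren_Delta0 ren_levy)

lemma rep_ren:
  assumes "rep \<Gamma> \<M> R" "renc \<Gamma>"
  shows "rep \<Gamma> \<M> (\<lambda>m s. R m (\<lambda>i. s (r i)))"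
proof -
  obtain q cs where q: "q \<in> \<Gamma>" "\<forall>m\<in>\<M>. set cs \<subseteq> fst m"
    "\<And>m s. m \<in> \<M> \<Longrightarrow> range s \<subseteq> fst m \<Longrightarrow> Sat m (env cs s) q \<longleftrightarrow> R m s"
    using assms(1) unfolding rep_def by blast
  let ?r = "\<lambda>i. if i < length cs then i else length cs + r (i - length cs)"
  have "(\<lambda>i. env cs s (?r i)) = env cs (\<lambda>i. s (r i))" for s :: "nat \<Rightarrow> 'a"
    by (auto simp: env_def)
  then have "Sat m (env cs s) (ren q ?r) \<longleftrightarrow> R m (\<lambda>i. s (r i))"
    if "m \<in> \<M>" "range s \<subseteq> fst m" for m s
    using q(3)[OF that(1), of "\<lambda>i. s (r i)"] that(2) by (simp only: sat_ren) auto
  then show ?thesis using q(1,2) assms(2) unfolding rep_def renc_def by blast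
qed

lemma rep_const:
  assumes "rep \<Gamma> \<M> R" "\<forall>m\<in>\<M>. c \<in> fst m"
  shows "rep \<Gamma> \<M> (\<lambda>m s. R m (c ## s))"
proof -
  obtain q cs where q: "q \<in> \<Gamma>" "\<forall>m\<in>\<M>. set cs \<subseteq> fst m"
    "\<And>m s. m \<in> \<M> \<Longrightarrow> range s \<subseteq> fst m \<Longrightarrow> Sat m (env cs s) q \<longleftrightarrow> R m s"
    using assms(1) unfolding rep_def by blast
  have "env (cs @ [c]) s = env cs (c ## s)" for s
  proof
    fix i
    consider "i < length cs" | "i = length cs" | k where "i = Suc (length cs + k)"
      by (metis less_imp_Suc_add linorder_neqE_nat)
    then show "env (cs @ [c]) s i = env cs (c ## s) i"
      by cases (auto simp: env_def Suc_diff_le nth_append)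
  qed
  then have "\<forall>m\<in>\<M>. \<forall>s. range s \<subseteq> fst m \<longrightarrow> Sat m (env (cs @ [c]) s) q \<longleftrightarrow> R m (c ## s)"
    using q(3) assms(2) by simp
  moreover have "\<forall>m\<in>\<M>. set (cs @ [c]) \<subseteq> fst m" using q(2) assms(2) by auto
  ultimately show ?thesis using q(1) unfolding rep_def by blast
qed

lemma rep_cong:
  "rep \<Gamma> \<M> R \<Longrightarrow> (\<And>m s. m \<in> \<M> \<Longrightarrow> range s \<subseteq> fst m \<Longrightarrow> R m s \<longleftrightarrow> R' m s) \<Longrightarrow> rep \<Gamma> \<M> R'"
  unfolding rep_def by metis

lemma rep_sub: "rep \<Gamma> \<M> R \<Longrightarrow> \<Gamma> \<subseteq> \<Gamma>' \<Longrightarrow> rep \<Gamma>' \<M> R"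
  unfolding rep_def by blast

lemma rep_pair:
  assumes "rep \<Gamma> \<M> R" "rep \<Gamma>' \<M> R'" "renc \<Gamma>" "renc \<Gamma>'"
  shows "\<exists>q\<in>\<Gamma>. \<exists>q'\<in>\<Gamma>'. \<exists>cs. (\<forall>m\<in>\<M>. set cs \<subseteq> fst m) \<and>
     (\<forall>m\<in>\<M>. \<forall>s. range s \<subseteq> fst m \<longrightarrow> (Sat m (env cs s) q \<longleftrightarrow> R m s) \<and> (Sat m (env cs s) q' \<longleftrightarrow> R' m s))"
proof -
  obtain q cs where q: "q \<in> \<Gamma>" "\<forall>m\<in>\<M>. set cs \<subseteq> fst m"
    "\<And>m s. m \<in> \<M> \<Longrightarrow> range s \<subseteq> fst m \<Longrightarrow> Sat m (env cs s) q \<longleftrightarrow> R m s"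
    using assms(1) unfolding rep_def by blast
  obtain q' cs' where q': "q' \<in> \<Gamma>'" "\<forall>m\<in>\<M>. set cs' \<subseteq> fst m"
    "\<And>m s. m \<in> \<M> \<Longrightarrow> range s \<subseteq> fst m \<Longrightarrow> Sat m (env cs' s) q' \<longleftrightarrow> R' m s"
    using assms(2) unfolding rep_def by blast
  let ?r = "\<lambda>i. if i < length cs then i else i + length cs'"
  let ?r' = "\<lambda>i. i + length cs"
  have "(\<lambda>i. env (cs @ cs') s (?r i)) = env cs s" "(\<lambda>i. env (cs @ cs') s (?r' i)) = env cs' s"
    for s :: "nat \<Rightarrow> 'a"
    by (auto simp: env_def nth_append)
  then have "(Sat m (env (cs @ cs') s) (ren q ?r) \<longleftrightarrow> R m s) \<and> (Sat m (env (cs @ cs') s) (ren q' ?r') \<longleftrightarrow> R' m s)"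
    if "m \<in> \<M>" "range s \<subseteq> fst m" for m s
    using q(3)[OF that] q'(3)[OF that] by (simp only: sat_ren)
  moreover have "\<forall>m\<in>\<M>. set (cs @ cs') \<subseteq> fst m" using q(2) q'(2) by auto
  moreover have "ren q ?r \<in> \<Gamma>" "ren q' ?r' \<in> \<Gamma>'" using q(1) q'(1) assms(3,4) by (auto simp: renc_def)
  ultimately show ?thesis by blast
qed

lemma D0_neg: "D0 \<M> R \<Longrightarrow> D0 \<M> (\<lambda>m s. \<not> R m s)"
  unfolding rep_def by (metis Delta0.intros(3) sat.simps(3))

lemma D0_conj: assumes "D0 \<M> R" "D0 \<M> R'" shows "D0 \<M> (\<lambda>m s. R m s \<and> R' m s)"
proof -
  obtain q q' cs where "q \<in> Delta0" "q' \<in> Delta0" "\<forall>m\<in>\<M>. set cs \<subseteq> fst m"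
     "\<forall>m\<in>\<M>. \<forall>s. range s \<subseteq> fst m \<longrightarrow> (Sat m (env cs s) q \<longleftrightarrow> R m s) \<and> (Sat m (env cs s) q' \<longleftrightarrow> R' m s)"
    using rep_pair[OF assms] by auto
  then show ?thesis unfolding rep_def
    by (intro bexI[of _ "Conj q q'"] exI[of _ cs]) (auto intro: Delta0.intros)
qed

lemma D0_disj: "D0 \<M> R \<Longrightarrow> D0 \<M> R' \<Longrightarrow> D0 \<M> (\<lambda>m s. R m s \<or> R' m s)"
  by (rule rep_cong[OF D0_neg[OF D0_conj[OF D0_neg D0_neg]]]) simp_all

lemma D0_imp: "D0 \<M> R \<Longrightarrow> D0 \<M> R' \<Longrightarrow> D0 \<M> (\<lambda>m s. R m s \<longrightarrow> R' m s)"
  using D0_disj[OF D0_neg] by (simp only: disj_not1)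

lemma D0_iff: "D0 \<M> R \<Longrightarrow> D0 \<M> R' \<Longrightarrow> D0 \<M> (\<lambda>m s. R m s \<longleftrightarrow> R' m s)"
  unfolding iff_conv_conj_imp by (intro D0_conj D0_imp)

text \<open>Terms are variables or constants. Substituting terms for the arguments of a relation lets the rules
  below be applied backwards by pure syntax-directed search.\<close>

definition tm :: "'m str set \<Rightarrow> ((nat \<Rightarrow> 'm) \<Rightarrow> 'm) \<Rightarrow> bool" where
  "tm \<M> t \<longleftrightarrow> (\<exists>i. t = (\<lambda>s. s i)) \<or> (\<exists>c. t = (\<lambda>s. c) \<and> (\<forall>m\<in>\<M>. c \<in> fst m))"

lemma tm_var: "tm \<M> (\<lambda>s. s i)" and tm_const: "(\<forall>m\<in>\<M>. c \<in> fst m) \<Longrightarrow> tm \<M> (\<lambda>s. c)"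
  unfolding tm_def by blast+

lemma rep_term:
  assumes "rep \<Gamma> \<M> R" "tm \<M> t" "renc \<Gamma>"
  shows "rep \<Gamma> \<M> (\<lambda>m s. R m (t s ## s))"
proof -
  consider i where "t = (\<lambda>s. s i)" | c where "t = (\<lambda>s. c)" "\<forall>m\<in>\<M>. c \<in> fst m"
    using assms(2) unfolding tm_def by blast
  then show ?thesis
  proof cases
    case 1
    have "(\<lambda>j. s ((i ## (\<lambda>j. j)) j)) = s i ## s" for s :: "nat \<Rightarrow> 'a"
      by (auto simp: scons_def split: nat.splits)
    then show ?thesis using rep_ren[OF assms(1,3), of "i ## (\<lambda>j. j)"] 1 by simp
  qed (use rep_const[OF assms(1)] in simp)
qed

lemma env_Nil [simp]: "env [] s = s"
  by (auto simp: env_def)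

lemma rep_Sat: "q \<in> \<Gamma> \<Longrightarrow> rep \<Gamma> \<M> (\<lambda>m s. Sat m s q)"
  unfolding rep_def by (intro bexI[of _ q] exI[of _ "[]"]) auto

lemmas D0_Sat = rep_Sat[of _ Delta0]

lemma tm_shift: "tm \<M> t \<Longrightarrow> tm \<M> (\<lambda>s. t (\<lambda>i. s (Suc i)))"
  unfolding tm_def by auto

lemma rep_term2:
  assumes "rep \<Gamma> \<M> (\<lambda>m s. R m (s 0) (s 1))" "tm \<M> t" "tm \<M> u" "renc \<Gamma>"
  shows "rep \<Gamma> \<M> (\<lambda>m s. R m (t s) (u s))"
proof -
  have "rep \<Gamma> \<M> (\<lambda>m s. R m (t (\<lambda>i. s (Suc i))) (s 0))"
    using rep_term[OF assms(1) tm_shift[OF assms(2)] assms(4)] by simp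
  from rep_term[OF this assms(3,4)] show ?thesis by simp
qed

lemma D0_mem: assumes "tm \<M> t" "tm \<M> u" shows "D0 \<M> (\<lambda>m s. t s \<in> ext m (u s))"
proof (rule rep_term2[OF _ assms])
  show "D0 \<M> (\<lambda>m s. s 0 \<in> ext m (s 1))"
    by (rule rep_cong[OF D0_Sat[OF Delta0.intros(1)[of 0 1]]]) (auto simp: ext_def)
qed simp

lemma D0_eq: assumes "tm \<M> t" "tm \<M> u" shows "D0 \<M> (\<lambda>m s. t s = u s)"
proof (rule rep_term2[OF _ assms])
  show "D0 \<M> (\<lambda>m s. s 0 = s 1)"
    by (rule rep_cong[OF D0_Sat[OF Delta0.intros(2)[of 0 1]]]) auto
qed simp

text \<open>The first step of every quantifier rule: the bound argument gets a variable \<open>z\<close> beyond all constants and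
  all variables of the formula, so that the remaining arguments need not be shifted.\<close>

lemma rep_quant:
  assumes "rep \<Gamma> \<M> (\<lambda>m s. \<Phi> m (s 0) (\<lambda>i. s (Suc i)))" "renc \<Gamma>"
  shows "\<exists>q\<in>\<Gamma>. \<exists>cs z. length cs + j < z \<and> (\<forall>m\<in>\<M>. set cs \<subseteq> fst m) \<and>
     (\<forall>m\<in>\<M>. \<forall>s. range s \<subseteq> fst m \<longrightarrow> (\<forall>a\<in>fst m. (Sat m ((env cs s)(z := a)) q \<longleftrightarrow> \<Phi> m a s)))"
proof -
  obtain q cs where q: "q \<in> \<Gamma>" "\<forall>m\<in>\<M>. set cs \<subseteq> fst m"
    "\<And>m s. m \<in> \<M> \<Longrightarrow> range s \<subseteq> fst m \<Longrightarrow> Sat m (env cs s) q \<longleftrightarrow> \<Phi> m (s 0) (\<lambda>i. s (Suc i))"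
    using assms(1) unfolding rep_def by blast
  let ?n = "length cs"
  define z where "z = fresh (insert (?n + j) (fv q))"
  have z: "?n + j < z" "\<And>i. i \<in> fv q \<Longrightarrow> i < z"
    using fresh_gt[of "insert (?n + j) (fv q)"] finite_fv[of q] by (auto simp: z_def)
  let ?r = "\<lambda>i. if i < ?n then i else if i = ?n then z else i - 1"
  have "Sat m ((env cs s)(z := a)) (ren q ?r) \<longleftrightarrow> \<Phi> m a s"
    if "m \<in> \<M>" "range s \<subseteq> fst m" "a \<in> fst m" for m s a
  proof -
    have "Sat m ((env cs s)(z := a)) (ren q ?r) \<longleftrightarrow> Sat m (env cs (a ## s)) q"
      unfolding sat_ren
    proof (rule sat_cong)
      fix i assume "i \<in> fv q"
      then have "i < z" by (rule z(2))
      consider "i < ?n" | "i = ?n" | k where "i = Suc (?n + k)"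
        by (metis less_imp_Suc_add linorder_neqE_nat)
      then show "((env cs s)(z := a)) (?r i) = env cs (a ## s) i"
        using \<open>i < z\<close> by cases (auto simp: env_def Suc_diff_le)
    qed
    also have "\<dots> \<longleftrightarrow> \<Phi> m a s" using q(3)[OF that(1), of "a ## s"] that by simp
    finally show ?thesis .
  qed
  then show ?thesis using q(1,2) z(1) assms(2) unfolding renc_def by blast
qed

lemma D0_ball0:
  assumes "D0 \<M> (\<lambda>m s. \<Phi> m (s 0) (\<lambda>i. s (Suc i)))"
  shows "D0 \<M> (\<lambda>m s. \<forall>a\<in>ext m (s 0). \<Phi> m a s)"
proof -
  obtain q cs z where q: "q \<in> Delta0" "length cs < z" "\<forall>m\<in>\<M>. set cs \<subseteq> fst m"
     "\<And>m s a. m \<in> \<M> \<Longrightarrow> range s \<subseteq> fst m \<Longrightarrow> a \<in> fst m \<Longrightarrow>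
        (Sat m ((env cs s)(z := a)) q \<longleftrightarrow> \<Phi> m a s)"
    using rep_quant[OF assms, of 0] renc by (metis add_0_right)
  have "Sat m (env cs s) (BAll z (length cs) q) \<longleftrightarrow> (\<forall>a\<in>ext m (s 0). \<Phi> m a s)"
    if "m \<in> \<M>" "range s \<subseteq> fst m" for m s
    using q(4)[OF that] q(2) by (auto simp: ext_def env_def)
  moreover have "BAll z (length cs) q \<in> Delta0" using q(1,2) by (intro Delta0.intros) auto
  ultimately show ?thesis using q(3) unfolding rep_def by blast
qed

lemma D0_ball:
  assumes "tm \<M> t" "D0 \<M> (\<lambda>m s. \<Phi> m (s 0) (\<lambda>i. s (Suc i)))"
  shows "D0 \<M> (\<lambda>m s. \<forall>a\<in>ext m (t s). \<Phi> m a s)"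
proof -
  have "D0 \<M> (\<lambda>m s. \<Phi> m (s 0) (\<lambda>i. s (Suc (Suc i))))"
    using rep_ren[OF assms(2), of "0 ## (\<lambda>i. Suc (Suc i))"] by simp
  then have "D0 \<M> (\<lambda>m s. \<forall>a\<in>ext m (s 0). \<Phi> m a (\<lambda>i. s (Suc i)))"
    by (intro D0_ball0)
  from rep_term[OF this assms(1)] show ?thesis by simp
qed

lemma D0_bex:
  assumes "tm \<M> t" "D0 \<M> (\<lambda>m s. \<Phi> m (s 0) (\<lambda>i. s (Suc i)))"
  shows "D0 \<M> (\<lambda>m s. \<exists>a\<in>ext m (t s). \<Phi> m a s)"
  by (rule rep_cong[OF D0_neg[OF D0_ball[OF assms(1) D0_neg[OF assms(2)]]]]) simp

lemmas D0_intros = D0_ball D0_bex D0_mem D0_eq D0_conj D0_disj D0_imp D0_iff D0_neg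

lemma rep_Ex:
  assumes "rep (levy_Sigma (Suc k)) \<M> (\<lambda>m s. \<Phi> m (s 0) (\<lambda>i. s (Suc i)))"
  shows "rep (levy_Sigma (Suc k)) \<M> (\<lambda>m s. \<exists>a\<in>fst m. \<Phi> m a s)"
proof -
  obtain q cs z where q: "q \<in> levy_Sigma (Suc k)" "\<forall>m\<in>\<M>. set cs \<subseteq> fst m"
     "\<And>m s a. m \<in> \<M> \<Longrightarrow> range s \<subseteq> fst m \<Longrightarrow> a \<in> fst m \<Longrightarrow>
        (Sat m ((env cs s)(z := a)) q \<longleftrightarrow> \<Phi> m a s)"
    using rep_quant[OF assms, of 0] renc by metis
  obtain xs p where p: "q = foldr Ex xs p" "p \<in> levy_Pi k" using q(1) by auto
  have "Ex z q = foldr Ex (z # xs) p" using p(1) by simp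
  then have "Ex z q \<in> levy_Sigma (Suc k)" unfolding levy_Sigma.simps using p(2) by blast
  then show ?thesis using q(2,3) unfolding rep_def
    by (intro bexI[of _ "Ex z q"] exI[of _ cs]) auto
qed

lemma rep_All:
  assumes "rep (levy_Pi (Suc k)) \<M> (\<lambda>m s. \<Phi> m (s 0) (\<lambda>i. s (Suc i)))"
  shows "rep (levy_Pi (Suc k)) \<M> (\<lambda>m s. \<forall>a\<in>fst m. \<Phi> m a s)"
proof -
  obtain q cs z where q: "q \<in> levy_Pi (Suc k)" "\<forall>m\<in>\<M>. set cs \<subseteq> fst m"
     "\<And>m s a. m \<in> \<M> \<Longrightarrow> range s \<subseteq> fst m \<Longrightarrow> a \<in> fst m \<Longrightarrow>
        (Sat m ((env cs s)(z := a)) q \<longleftrightarrow> \<Phi> m a s)"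
    using rep_quant[OF assms, of 0] renc by metis
  obtain xs p where p: "q = foldr All xs p" "p \<in> levy_Sigma k" using q(1) by auto
  have "All z q = foldr All (z # xs) p" using p(1) by simp
  then have "All z q \<in> levy_Pi (Suc k)" unfolding levy_Pi.simps using p(2) by blast
  then show ?thesis using q(2,3) unfolding rep_def
    by (intro bexI[of _ "All z q"] exI[of _ cs]) auto
qed

lemma levy_sub: "levy_Pi k \<subseteq> levy_Sigma (Suc k)" "levy_Sigma k \<subseteq> levy_Pi (Suc k)"
  by (auto intro: exI[of _ "[]"])

lemmas S1_ex = rep_Ex[of 0, folded One_nat_def]
lemmas P1_all = rep_All[of 0, folded One_nat_def]
lemmas P2_all = rep_All[of 1, unfolded Suc_1]

lemma S1_D0: "D0 \<M> R \<Longrightarrow> S1 \<M> R" and P1_D0: "D0 \<M> R \<Longrightarrow> P1 \<M> R"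
  and P2_S1: "S1 \<M> R \<Longrightarrow> P2 \<M> R" and P2_D0: "D0 \<M> R \<Longrightarrow> P2 \<M> R"
proof -
  have "Delta0 \<subseteq> levy_Sigma 1" "Delta0 \<subseteq> levy_Pi 1" using levy_sub[of 0] by (simp_all del: levy_Sigma.simps(2) levy_Pi.simps(2))
  moreover have "levy_Sigma 1 \<subseteq> levy_Pi 2" using levy_sub(2)[of 1] by (simp only: Suc_1)
  ultimately show "D0 \<M> R \<Longrightarrow> S1 \<M> R" "D0 \<M> R \<Longrightarrow> P1 \<M> R" "S1 \<M> R \<Longrightarrow> P2 \<M> R" "D0 \<M> R \<Longrightarrow> P2 \<M> R"
    by (meson rep_sub order_trans)+
qed

section \<open>Bounded descriptions of syntax, satisfaction and levels\<close>

text \<open>All relations are stated with bounded quantifiers only, which makes them \<open>\<Delta>\<^sub>0\<close>; this dictates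
  their form. In \<open>emp\<close> the trivial matrix \<open>u = u\<close> serves this purpose.\<close>

definition emp where "emp m x \<longleftrightarrow> \<not> (\<exists>u\<in>ext m x. u = u)"

definition upr where "upr m z x y \<longleftrightarrow> x \<in> ext m z \<and> y \<in> ext m z \<and> (\<forall>u\<in>ext m z. u = x \<or> u = y)"

definition opr where
  "opr m z x y \<longleftrightarrow> (\<exists>u\<in>ext m z. \<exists>v\<in>ext m z. upr m u x x \<and> upr m v x y \<and> upr m z u v)"

definition inP where "inP m S x y \<longleftrightarrow> (\<exists>z\<in>ext m S. opr m z x y)"

definition suc where
  "suc m y x \<longleftrightarrow> x \<in> ext m y \<and> (\<forall>u\<in>ext m x. u \<in> ext m y) \<and> (\<forall>u\<in>ext m y. u = x \<or> u \<in> ext m x)"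

text \<open>The set \<open>t\<close> is the \<open>k\<close>-th von Neumann numeral; the numerals \<open>0\<close> to \<open>3\<close> tag the constructors of coded formulae.\<close>

primrec tg where
  "tg m 0 t \<longleftrightarrow> emp m t"
| "tg m (Suc k) t \<longleftrightarrow> (\<exists>u\<in>ext m t. tg m k u \<and> suc m t u)"

definition trip where
  "trip m c k a b \<longleftrightarrow> (\<exists>u\<in>ext m c. \<exists>q\<in>ext m u. \<exists>t\<in>ext m u. tg m k t \<and> opr m q a b \<and> opr m c t q)"

text \<open>\<open>e\<close> is a function from \<open>n\<close> to \<open>U\<close>; for a numeral \<open>n\<close> this is a finite sequence.\<close>

definition fn where
  "fn m e n U \<longleftrightarrow> (\<forall>z\<in>ext m e. \<exists>i\<in>ext m n. \<exists>b\<in>ext m U. opr m z i b) \<and>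
     (\<forall>i\<in>ext m n. \<exists>b\<in>ext m U. inP m e i b \<and> (\<forall>b'\<in>ext m U. inP m e i b' \<longrightarrow> b' = b))"

text \<open>\<open>e'\<close> is the sequence \<open>e\<close> of length \<open>n\<close> extended by the entry \<open>a\<close>.\<close>

definition appn where
  "appn m e' e n a \<longleftrightarrow> (\<forall>z\<in>ext m e. z \<in> ext m e') \<and> inP m e' n a \<and>
     (\<forall>z\<in>ext m e'. z \<in> ext m e \<or> opr m z n a)"

text \<open>\<open>E\<close> is the set of all finite sequences over \<open>U\<close>. The closure condition in place of the word \<open>all\<close>
  keeps the quantifiers bounded.\<close>

definition isE where
  "isE m W U E \<longleftrightarrow> (\<forall>e\<in>ext m E. \<exists>n\<in>ext m W. fn m e n U) \<and> (\<exists>e\<in>ext m E. emp m e) \<and>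
     (\<forall>e\<in>ext m E. \<forall>n\<in>ext m W. \<forall>a\<in>ext m U. fn m e n U \<longrightarrow> (\<exists>e'\<in>ext m E. appn m e' e n a))"

text \<open>The Tarski clause for the formula code \<open>c\<close> and the sequence \<open>e\<close>, where \<open>S\<close> supplies the truth values of
  the immediate subformulae. A relation that satisfies it on a set \<open>Z\<close> of codes closed under subformulae is
  satisfaction in \<open>U\<close>.\<close>

definition clause where
  "clause m W Z U E S c e \<longleftrightarrow>
    (\<exists>i\<in>ext m W. \<exists>j\<in>ext m W. trip m c 0 i j \<and>
       (\<exists>a\<in>ext m U. \<exists>b\<in>ext m U. inP m e i a \<and> inP m e j b \<and> a \<in> ext m b)) \<or>
    (\<exists>i\<in>ext m W. \<exists>j\<in>ext m W. trip m c 1 i j \<and> (\<exists>a\<in>ext m U. inP m e i a \<and> inP m e j a)) \<or>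
    (\<exists>c1\<in>ext m Z. \<exists>c2\<in>ext m Z. trip m c 2 c1 c2 \<and> \<not> (inP m S c1 e \<and> inP m S c2 e)) \<or>
    (\<exists>c1\<in>ext m Z. trip m c 3 c1 c1 \<and>
       (\<exists>n\<in>ext m W. \<exists>a\<in>ext m U. \<exists>e'\<in>ext m E. fn m e n U \<and> appn m e' e n a \<and> inP m S c1 e'))"

definition Scl where
  "Scl m W Z U E S \<longleftrightarrow> (\<forall>c\<in>ext m Z. \<forall>e\<in>ext m E. inP m S c e \<longleftrightarrow> clause m W Z U E S c e)"

definition SP where
  "SP m W Cd U E S \<longleftrightarrow> isE m W U E \<and> Scl m W Cd U E S"

text \<open>\<open>y\<close> is the subset of \<open>U\<close> defined by \<open>c\<close> with the parameters \<open>e\<close>; the defined element is the last entry.\<close>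

definition defs where
  "defs m W U E S y c e \<longleftrightarrow> (\<forall>x\<in>ext m y. x \<in> ext m U) \<and> (\<forall>x\<in>ext m U. x \<in> ext m y \<longleftrightarrow>
     (\<exists>n\<in>ext m W. \<exists>e'\<in>ext m E. fn m e n U \<and> appn m e' e n x \<and> inP m S c e'))"

text \<open>\<open>d\<close> is the definable powerset of \<open>U\<close>.\<close>

definition DF where
  "DF m W Cd U E S d \<longleftrightarrow>
     (\<forall>y\<in>ext m d. \<exists>c\<in>ext m Cd. \<exists>e\<in>ext m E. defs m W U E S y c e) \<and>
     (\<forall>c\<in>ext m Cd. \<forall>e\<in>ext m E. \<exists>y\<in>ext m d. defs m W U E S y c e)"

text \<open>The bag \<open>Q\<close> holds the auxiliary sets that certify \<open>d = Def v\<close>, so that no unbounded quantifier is needed.\<close>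

definition IsD where
  "IsD m W Cd v d Q \<longleftrightarrow> (\<exists>E\<in>ext m Q. \<exists>S\<in>ext m Q. SP m W Cd v E S \<and> DF m W Cd v E S d)"

text \<open>Every \<open>v\<close> in \<open>h\<close> is the union of the sets \<open>Def v'\<close> for \<open>v'\<close> in both \<open>h\<close> and \<open>v\<close>, so by \<open>\<in>\<close>-induction \<open>h\<close>
  consists of levels of the constructible hierarchy. Ordinals are not mentioned. The clause \<open>x \<notin> v'\<close> makes
  \<open>v'\<close> the stage at which \<open>x\<close> appears; it forces \<open>h\<close> to contain every level below one of its members.\<close>

definition Hi where
  "Hi m W Cd h Q \<longleftrightarrow> (\<forall>v\<in>ext m h. (\<exists>d\<in>ext m Q. IsD m W Cd v d Q) \<and>
     (\<forall>x\<in>ext m v. \<exists>v'\<in>ext m h. v' \<in> ext m v \<and> x \<notin> ext m v' \<and>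
        (\<exists>d\<in>ext m Q. IsD m W Cd v' d Q \<and> x \<in> ext m d)) \<and>
     (\<forall>v'\<in>ext m h. v' \<in> ext m v \<longrightarrow>
        (\<forall>d\<in>ext m Q. IsD m W Cd v' d Q \<longrightarrow> (\<forall>x\<in>ext m d. x \<in> ext m v))))"

text \<open>The formula \<open>c\<close> holds of the sequence \<open>e\<close> in the level \<open>v\<close>, as certified by the package \<open>(h, Q)\<close>.\<close>

definition TQ where
  "TQ m W Cd h Q v c e \<longleftrightarrow> v \<in> ext m h \<and>
     (\<exists>E\<in>ext m Q. \<exists>S\<in>ext m Q. SP m W Cd v E S \<and> e \<in> ext m E \<and> inP m S c e)"

lemmas tm_intros = tm_var tm_shift

lemma D0_emp: "tm \<M> t \<Longrightarrow> D0 \<M> (\<lambda>m s. emp m (t s))"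
  unfolding emp_def by (intro D0_intros tm_intros)

lemma D0_upr: "tm \<M> z \<Longrightarrow> tm \<M> x \<Longrightarrow> tm \<M> y \<Longrightarrow> D0 \<M> (\<lambda>m s. upr m (z s) (x s) (y s))"
  unfolding upr_def by (intro D0_intros tm_intros)

lemma D0_opr: "tm \<M> z \<Longrightarrow> tm \<M> x \<Longrightarrow> tm \<M> y \<Longrightarrow> D0 \<M> (\<lambda>m s. opr m (z s) (x s) (y s))"
  unfolding opr_def by (intro D0_intros D0_upr tm_intros)

lemma D0_inP: "tm \<M> z \<Longrightarrow> tm \<M> x \<Longrightarrow> tm \<M> y \<Longrightarrow> D0 \<M> (\<lambda>m s. inP m (z s) (x s) (y s))"
  unfolding inP_def by (intro D0_intros D0_opr tm_intros)

lemma D0_suc: "tm \<M> x \<Longrightarrow> tm \<M> y \<Longrightarrow> D0 \<M> (\<lambda>m s. suc m (x s) (y s))"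
  unfolding suc_def by (intro D0_intros tm_intros)

lemma D0_tg: "tm \<M> x \<Longrightarrow> D0 \<M> (\<lambda>m s. tg m k (x s))"
proof (induction k arbitrary: x)
  case 0 then show ?case by (simp add: D0_emp)
next
  case (Suc k) 
  show ?case unfolding tg.simps by (intro D0_intros D0_suc tm_intros Suc)
qed

lemma D0_trip: "tm \<M> x \<Longrightarrow> tm \<M> y \<Longrightarrow> tm \<M> z \<Longrightarrow> D0 \<M> (\<lambda>m s. trip m (x s) k (y s) (z s))"
  unfolding trip_def by (intro D0_intros D0_tg D0_opr tm_intros)

lemma D0_fn: "tm \<M> x \<Longrightarrow> tm \<M> y \<Longrightarrow> tm \<M> z \<Longrightarrow> D0 \<M> (\<lambda>m s. fn m (x s) (y s) (z s))"
  unfolding fn_def by (intro D0_intros D0_inP D0_opr tm_intros)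

lemma D0_appn: "tm \<M> x \<Longrightarrow> tm \<M> y \<Longrightarrow> tm \<M> z \<Longrightarrow> tm \<M> u \<Longrightarrow> 
  D0 \<M> (\<lambda>m s. appn m (x s) (y s) (z s) (u s))"
  unfolding appn_def by (intro D0_intros D0_inP D0_opr tm_intros)

lemma D0_isE: "tm \<M> x \<Longrightarrow> tm \<M> y \<Longrightarrow> tm \<M> z \<Longrightarrow> D0 \<M> (\<lambda>m s. isE m (x s) (y s) (z s))"
  unfolding isE_def by (intro D0_intros D0_emp D0_fn D0_appn tm_intros)

lemma D0_clause: "tm \<M> x \<Longrightarrow> tm \<M> y \<Longrightarrow> tm \<M> z \<Longrightarrow> tm \<M> u \<Longrightarrow> tm \<M> v \<Longrightarrow> tm \<M> w \<Longrightarrow> tm \<M> e \<Longrightarrow>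
  D0 \<M> (\<lambda>m s. clause m (x s) (y s) (z s) (u s) (v s) (w s) (e s))"
  unfolding clause_def by (intro D0_intros D0_trip D0_inP D0_fn D0_appn tm_intros)

lemma D0_Scl: "tm \<M> x \<Longrightarrow> tm \<M> y \<Longrightarrow> tm \<M> z \<Longrightarrow> tm \<M> u \<Longrightarrow> tm \<M> v \<Longrightarrow>
  D0 \<M> (\<lambda>m s. Scl m (x s) (y s) (z s) (u s) (v s))"
  unfolding Scl_def by (intro D0_intros D0_inP D0_clause tm_intros)

lemma D0_SP: "tm \<M> x \<Longrightarrow> tm \<M> y \<Longrightarrow> tm \<M> z \<Longrightarrow> tm \<M> u \<Longrightarrow> tm \<M> v \<Longrightarrow>
  D0 \<M> (\<lambda>m s. SP m (x s) (y s) (z s) (u s) (v s))"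
  unfolding SP_def by (intro D0_intros D0_isE D0_Scl tm_intros)

lemma D0_defs: "tm \<M> x \<Longrightarrow> tm \<M> y \<Longrightarrow> tm \<M> z \<Longrightarrow> tm \<M> u \<Longrightarrow> tm \<M> v \<Longrightarrow> tm \<M> w \<Longrightarrow> tm \<M> e \<Longrightarrow>
  D0 \<M> (\<lambda>m s. defs m (x s) (y s) (z s) (u s) (v s) (w s) (e s))"
  unfolding defs_def by (intro D0_intros D0_inP D0_fn D0_appn tm_intros)

lemma D0_DF: "tm \<M> x \<Longrightarrow> tm \<M> y \<Longrightarrow> tm \<M> z \<Longrightarrow> tm \<M> u \<Longrightarrow> tm \<M> v \<Longrightarrow> tm \<M> w \<Longrightarrow>
  D0 \<M> (\<lambda>m s. DF m (x s) (y s) (z s) (u s) (v s) (w s))"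
  unfolding DF_def by (intro D0_intros D0_defs tm_intros)

lemma D0_IsD: "tm \<M> x \<Longrightarrow> tm \<M> y \<Longrightarrow> tm \<M> z \<Longrightarrow> tm \<M> u \<Longrightarrow> tm \<M> v \<Longrightarrow>
  D0 \<M> (\<lambda>m s. IsD m (x s) (y s) (z s) (u s) (v s))"
  unfolding IsD_def by (intro D0_intros D0_SP D0_DF tm_intros)

lemma D0_Hi: "tm \<M> x \<Longrightarrow> tm \<M> y \<Longrightarrow> tm \<M> z \<Longrightarrow> tm \<M> u \<Longrightarrow>
  D0 \<M> (\<lambda>m s. Hi m (x s) (y s) (z s) (u s))"
  unfolding Hi_def by (intro D0_intros D0_IsD tm_intros)

lemma D0_TQ: "tm \<M> x \<Longrightarrow> tm \<M> y \<Longrightarrow> tm \<M> z \<Longrightarrow> tm \<M> u \<Longrightarrow> tm \<M> v \<Longrightarrow> tm \<M> w \<Longrightarrow> tm \<M> e \<Longrightarrow>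
  D0 \<M> (\<lambda>m s. TQ m (x s) (y s) (z s) (u s) (v s) (w s) (e s))"
  unfolding TQ_def by (intro D0_intros D0_SP D0_inP tm_intros)

lemmas D0_rels = D0_emp D0_upr D0_opr D0_inP D0_suc D0_tg D0_trip D0_fn D0_appn D0_isE D0_clause
  D0_Scl D0_SP D0_defs D0_DF D0_IsD D0_Hi D0_TQ

section \<open>Formulae with de Bruijn levels\<close>

text \<open>Formulae to be coded by sets. A formula is evaluated at a list, and the quantifier appends its
  value to the end of the list. Coded satisfaction then needs only sequences and their extension by one
  entry, never the change of an entry.\<close>

datatype dfm = DMem nat nat | DEq nat nat | DNand dfm dfm | DEx dfm

primrec dsat :: "'m set \<Rightarrow> ('m \<Rightarrow> 'm \<Rightarrow> bool) \<Rightarrow> dfm \<Rightarrow> 'm list \<Rightarrow> bool" where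
  "dsat A E (DMem i j) xs \<longleftrightarrow> i < length xs \<and> j < length xs \<and> E (xs ! i) (xs ! j)"
| "dsat A E (DEq i j) xs \<longleftrightarrow> i < length xs \<and> j < length xs \<and> xs ! i = xs ! j"
| "dsat A E (DNand d e) xs \<longleftrightarrow> \<not> (dsat A E d xs \<and> dsat A E e xs)"
| "dsat A E (DEx d) xs \<longleftrightarrow> (\<exists>a\<in>A. dsat A E d (xs @ [a]))"

definition DNot where "DNot d = DNand d d"

lemma dsat_DNot [simp]: "dsat A E (DNot d) xs \<longleftrightarrow> \<not> dsat A E d xs"
  by (simp add: DNot_def)

text \<open>\<open>r\<close> maps a variable to its position in the list and \<open>n\<close> is the current length of the list.\<close>

primrec enc :: "fm \<Rightarrow> (nat \<Rightarrow> nat) \<Rightarrow> nat \<Rightarrow> dfm" where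
  "enc (Mem x y) r n = DMem (r x) (r y)"
| "enc (Eq x y) r n = DEq (r x) (r y)"
| "enc (Neg p) r n = DNot (enc p r n)"
| "enc (Conj p q) r n = DNot (DNand (enc p r n) (enc q r n))"
| "enc (Disj p q) r n = DNand (DNot (enc p r n)) (DNot (enc q r n))"
| "enc (Imp p q) r n = DNand (enc p r n) (DNot (enc q r n))"
| "enc (All x p) r n = DNot (DEx (DNot (enc p (r(x := n)) (Suc n))))"
| "enc (Ex x p) r n = DEx (enc p (r(x := n)) (Suc n))"

lemma dsat_enc:
  "(\<And>i. i \<in> fv p \<Longrightarrow> r i < length xs \<and> xs ! r i = s i) \<Longrightarrow>
    dsat A E (enc p r (length xs)) xs \<longleftrightarrow> sat A E s p"
proof (induction p arbitrary: r xs s)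
  case (All x p)
  have "dsat A E (enc p (r(x := length xs)) (length (xs @ [a]))) (xs @ [a]) \<longleftrightarrow> sat A E (s(x := a)) p" for a
    by (rule All.IH) (use All.prems in \<open>auto simp: nth_append split: if_splits intro: less_SucI\<close>)
  then show ?case by simp
next
  case (Ex x p)
  have "dsat A E (enc p (r(x := length xs)) (length (xs @ [a]))) (xs @ [a]) \<longleftrightarrow> sat A E (s(x := a)) p" for a
    by (rule Ex.IH) (use Ex.prems in \<open>auto simp: nth_append split: if_splits intro: less_SucI\<close>)
  then show ?case by simp
next
  case (Conj p q)
  then show ?case using Conj.IH(1)[of r xs s] Conj.IH(2)[of r xs s] by auto
next
  case (Disj p q)
  then show ?case using Disj.IH(1)[of r xs s] Disj.IH(2)[of r xs s] by auto
next
  case (Imp p q)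
  then show ?case using Imp.IH(1)[of r xs s] Imp.IH(2)[of r xs s] by auto
next
  case (Neg p)
  then show ?case using Neg.IH[of r xs s] by auto
qed auto

text \<open>The converse translation; position \<open>i\<close> becomes the variable \<open>v i\<close>. Positions outside the list make an
  atom false, which \<open>dec\<close> expresses by a formula without free variables so that no parameter is added.\<close>

primrec dec :: "dfm \<Rightarrow> (nat \<Rightarrow> nat) \<Rightarrow> nat \<Rightarrow> fm" where
  "dec (DMem i j) v n = (if i < n \<and> j < n then Mem (v i) (v j) else Neg (All 0 (Eq 0 0)))"
| "dec (DEq i j) v n = (if i < n \<and> j < n then Eq (v i) (v j) else Neg (All 0 (Eq 0 0)))"
| "dec (DNand d e) v n = Neg (Conj (dec d v n) (dec e v n))"
| "dec (DEx d) v n = Ex (v n) (dec d v (Suc n))"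

lemma fv_dec: "fv (dec d v n) \<subseteq> v ` {..<n}"
proof (induction d arbitrary: n)
  case (DEx d)
  have "fv (dec d v (Suc n)) \<subseteq> v ` {..<Suc n}" by (rule DEx)
  then show ?case by (auto simp: lessThan_Suc)
next
  case (DNand d e)
  show ?case using DNand[of n] by auto
qed auto

lemma sat_dec:
  "inj v \<Longrightarrow> (\<And>i. i < length xs \<Longrightarrow> s (v i) = xs ! i) \<Longrightarrow>
    sat A E s (dec d v (length xs)) \<longleftrightarrow> dsat A E d xs"
proof (induction d arbitrary: xs s)
  case (DEx d)
  have "sat A E (s(v (length xs) := a)) (dec d v (length (xs @ [a]))) \<longleftrightarrow> dsat A E d (xs @ [a])" for a
    by (rule DEx.IH) (use DEx.prems in \<open>auto simp: nth_append less_Suc_eq dest: injD\<close>)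
  then show ?case by simp
qed auto

section \<open>Models of a weak set theory\<close>

text \<open>The axioms that hold both in the model and in its end extension. They suffice to work with
  ordered pairs, finite sets and finite sequences; the schemes are stated for represented relations.\<close>

locale setm0 =
  fixes m :: "'m str"
  assumes ext_eq: "x \<in> fst m \<Longrightarrow> y \<in> fst m \<Longrightarrow> ext m x = ext m y \<Longrightarrow> x = y"
    and pairing: "x \<in> fst m \<Longrightarrow> y \<in> fst m \<Longrightarrow> \<exists>z\<in>fst m. ext m z = {x, y}"
    and union: "x \<in> fst m \<Longrightarrow> \<exists>z\<in>fst m. ext m z = (\<Union>y\<in>ext m x. ext m y)"
    and founded: "x \<in> fst m \<Longrightarrow> ext m x \<noteq> {} \<Longrightarrow> \<exists>y\<in>ext m x. ext m y \<inter> ext m x = {}"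
    and sep: "D0 {m} (\<lambda>m s. \<Phi> m (s 0)) \<Longrightarrow> w \<in> fst m \<Longrightarrow> \<exists>y\<in>fst m. ext m y = {x \<in> ext m w. \<Phi> m x}"
    and coll: "D0 {m} (\<lambda>m s. \<Psi> m (s 0) (s 1)) \<Longrightarrow> w \<in> fst m \<Longrightarrow> \<forall>x\<in>ext m w. \<exists>y\<in>fst m. \<Psi> m x y \<Longrightarrow>
       \<exists>c\<in>fst m. \<forall>x\<in>ext m w. \<exists>y\<in>ext m c. \<Psi> m x y"
    and empty_ex: "\<exists>z\<in>fst m. ext m z = {}"
begin

abbreviation "M \<equiv> fst m"

lemma emp_iff [simp]: "emp m x \<longleftrightarrow> ext m x = {}"
  by (auto simp: emp_def)

lemma upr_iff: "upr m z x y \<longleftrightarrow> ext m z = {x, y}"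
  by (auto simp: upr_def)

lemma suc_iff: "suc m y x \<longleftrightarrow> ext m y = insert x (ext m x)"
  by (auto simp: suc_def)

lemma opr_car: "opr m z x y \<Longrightarrow> x \<in> M \<and> y \<in> M"
  unfolding opr_def upr_def by (meson ext_car)

lemma opr_ex: assumes "x \<in> M" "y \<in> M" shows "\<exists>z\<in>M. opr m z x y"
proof -
  obtain u where u: "u \<in> M" "ext m u = {x,x}" using pairing[OF assms(1,1)] by blast
  obtain v where v: "v \<in> M" "ext m v = {x,y}" using pairing[OF assms] by blast
  obtain z where z: "z \<in> M" "ext m z = {u,v}" using pairing[OF u(1) v(1)] by blast
  have "upr m u x x" "upr m v x y" "upr m z u v" using u v z by (simp_all add: upr_iff)
  then have "opr m z x y" unfolding opr_def using z(2) by auto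
  then show ?thesis using z(1) by blast
qed

lemma opr_inj: assumes "opr m z x y" "opr m z x' y'" shows "x = x' \<and> y = y'"
proof -
  obtain u v where uv: "ext m u = {x,x}" "ext m v = {x,y}" "ext m z = {u,v}"
    using assms(1) unfolding opr_def upr_iff by blast
  obtain u' v' where uv': "ext m u' = {x',x'}" "ext m v' = {x',y'}" "ext m z = {u',v'}"
    using assms(2) unfolding opr_def upr_iff by blast
  have "{{x},{x,y}} = {{x'},{x',y'}}"
    using uv uv' by (metis image_empty image_insert insert_absorb2)
  then show ?thesis by (auto simp: doubleton_eq_iff)
qed

lemma opr_unique: assumes "opr m z x y" "opr m z' x y" "z \<in> M" "z' \<in> M" shows "z = z'"
proof -
  obtain u v where uv: "ext m u = {x,x}" "ext m v = {x,y}" "ext m z = {u,v}"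
    using assms(1) unfolding opr_def upr_iff by blast
  obtain u' v' where uv': "ext m u' = {x,x}" "ext m v' = {x,y}" "ext m z' = {u',v'}"
    using assms(2) unfolding opr_def upr_iff by blast
  have "u = u'" "v = v'" using uv uv' by (metis ext_car ext_eq insertI1 insertI2)+
  then show ?thesis using uv uv' assms(3,4) ext_eq by simp
qed

definition pr where "pr x y = (THE z. z \<in> M \<and> opr m z x y)"

lemma opr_pr: assumes "x \<in> M" "y \<in> M" shows "pr x y \<in> M \<and> opr m (pr x y) x y"
proof -
  have "\<exists>!z. z \<in> M \<and> opr m z x y" using opr_ex[OF assms] opr_unique[of _ x y] by blast
  from theI'[OF this] show ?thesis unfolding pr_def .
qed

lemma pr_car [simp]: "x \<in> M \<Longrightarrow> y \<in> M \<Longrightarrow> pr x y \<in> M"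
  using opr_pr by blast

lemma opr_iff: "x \<in> M \<Longrightarrow> y \<in> M \<Longrightarrow> z \<in> M \<Longrightarrow> opr m z x y \<longleftrightarrow> z = pr x y"
  using opr_pr[of x y] opr_unique[of z x y "pr x y"] by auto

lemma pr_inj: "x \<in> M \<Longrightarrow> y \<in> M \<Longrightarrow> x' \<in> M \<Longrightarrow> y' \<in> M \<Longrightarrow> pr x y = pr x' y' \<longleftrightarrow> x = x' \<and> y = y'"
  using opr_pr[of x y] opr_pr[of x' y'] opr_inj[of "pr x y" x y x' y'] by auto

lemma inP_iff: "x \<in> M \<Longrightarrow> y \<in> M \<Longrightarrow> inP m S x y \<longleftrightarrow> pr x y \<in> ext m S"
proof -
  assume xy: "x \<in> M" "y \<in> M"
  have "opr m z x y \<longleftrightarrow> z = pr x y" if "z \<in> ext m S" for z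
    using opr_iff[OF xy ext_car[OF that]] .
  then show ?thesis unfolding inP_def by auto
qed

lemma un_ex: assumes "x \<in> M" "y \<in> M" shows "\<exists>z\<in>M. ext m z = ext m x \<union> ext m y"
proof -
  obtain p where p: "p \<in> M" "ext m p = {x, y}" using pairing[OF assms] by blast
  then show ?thesis using union[of p] by auto
qed

lemma ins_ex: assumes "x \<in> M" "y \<in> M" shows "\<exists>z\<in>M. ext m z = insert y (ext m x)"
proof -
  obtain p where p: "p \<in> M" "ext m p = {y, y}" using pairing assms by blast
  then show ?thesis using un_ex[of p x] assms by auto
qed

lemma finite_ex: "finite A \<Longrightarrow> A \<subseteq> M \<Longrightarrow> \<exists>z\<in>M. ext m z = A"
proof (induction rule: finite_induct)
  case (insert x F)
  then obtain z where "z \<in> M" "ext m z = F" by auto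
  then show ?case using ins_ex[of z x] insert by auto
qed (use empty_ex in simp)

lemma no_self: assumes "x \<in> M" shows "x \<notin> ext m x"
proof
  assume a: "x \<in> ext m x"
  obtain z where z: "z \<in> M" "ext m z = {x}" using finite_ex[of "{x}"] assms by auto
  then have "\<exists>y\<in>ext m z. ext m y \<inter> ext m z = {}" by (intro founded) auto
  then show False using a z by auto
qed

end

text \<open>A set whose members are exactly the true numerals. In the end extension this set comes from the model,
  so internal finite sequences are honest lists and formula codes are codes of honest formulae.\<close>

locale setm = setm0 m for m :: "'m str" +
  fixes num :: "nat \<Rightarrow> 'm" and W :: 'm
  assumes num_car [simp]: "num n \<in> fst m"
    and num_0: "ext m (num 0) = {}"
    and num_Suc: "ext m (num (Suc n)) = insert (num n) (ext m (num n))"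
    and W_car [simp]: "W \<in> fst m"
    and W_ext: "ext m W = range num"
begin

lemma num_ext: "ext m (num n) = num ` {..<n}"
  by (induction n) (auto simp: num_0 num_Suc lessThan_Suc)

lemma num_inj [simp]: "num i = num j \<longleftrightarrow> i = j"
proof -
  have "num i \<noteq> num j" if "i < j" for i j
    using no_self[of "num j"] num_ext[of j] that num_car by (metis image_eqI lessThan_iff)
  then show ?thesis by (metis linorder_neqE_nat)
qed

lemma tg_iff: "t \<in> M \<Longrightarrow> tg m k t \<longleftrightarrow> t = num k"
proof (induction k arbitrary: t)
  case 0 then show ?case using ext_eq[of t "num 0"] num_0 by auto
next
  case (Suc k)
  have "tg m (Suc k) t \<longleftrightarrow> ext m t = insert (num k) (ext m (num k))"
    using Suc.IH ext_car[of _ m t] by (auto simp: suc_iff)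
  then show ?case using ext_eq[of t "num (Suc k)"] num_Suc Suc.prems by auto
qed

lemma trip_iff:
  assumes "c \<in> M" "a \<in> M" "b \<in> M" shows "trip m c k a b \<longleftrightarrow> c = pr (num k) (pr a b)"
proof
  assume "trip m c k a b"
  then obtain u q t where "u \<in> ext m c" "q \<in> ext m u" "t \<in> ext m u" "tg m k t" "opr m q a b" "opr m c t q"
    unfolding trip_def by blast
  then show "c = pr (num k) (pr a b)" using assms opr_iff tg_iff ext_car by metis
next
  assume c: "c = pr (num k) (pr a b)"
  then have o: "opr m c (num k) (pr a b)" using opr_pr assms by auto
  then obtain u v where "u \<in> ext m c" "v \<in> ext m c" "ext m v = {num k, pr a b}"
    unfolding opr_def upr_iff by blast
  then have v: "v \<in> ext m c" "pr a b \<in> ext m v" "num k \<in> ext m v" by blast+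
  moreover have "tg m k (num k)" "opr m (pr a b) a b" using assms by (simp_all add: tg_iff opr_pr)
  ultimately show "trip m c k a b" unfolding trip_def using o by blast
qed

text \<open>The dummy second component of the code of \<open>DEx\<close> gives all constructors the shape of a tagged pair.\<close>

primrec code where
  "code (DMem i j) = pr (num 0) (pr (num i) (num j))"
| "code (DEq i j) = pr (num 1) (pr (num i) (num j))"
| "code (DNand d e) = pr (num 2) (pr (code d) (code e))"
| "code (DEx d) = pr (num 3) (pr (code d) (code d))"

lemma code_car [simp]: "code d \<in> M"
  by (induction d) auto

lemma code_inj [simp]: "code d = code e \<longleftrightarrow> d = e"
proof (induction d arbitrary: e)
  case (DMem i j) show ?case by (cases e) (simp_all add: pr_inj)
next
  case (DEq i j) show ?case by (cases e) (simp_all add: pr_inj)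
next
  case (DNand d d') show ?case by (cases e) (simp_all add: pr_inj DNand)
next
  case (DEx d) show ?case by (cases e) (simp_all add: pr_inj DEx)
qed

definition sq where
  "sq xs = (THE e. e \<in> M \<and> ext m e = (\<lambda>i. pr (num i) (xs ! i)) ` {..<length xs})"

lemma the_ext: assumes "z \<in> M" "ext m z = A" shows "(THE e. e \<in> M \<and> ext m e = A) = z"
  by (rule the_equality) (simp_all add: assms ext_eq)

lemma sq: assumes "set xs \<subseteq> M" 
  shows sq_car: "sq xs \<in> M" and sq_ext: "ext m (sq xs) = (\<lambda>i. pr (num i) (xs ! i)) ` {..<length xs}"
proof -
  have "pr (num i) (xs ! i) \<in> M" if "i < length xs" for i
    using that assms nth_mem[of i xs] by (intro pr_car) auto
  then have "\<exists>e\<in>M. ext m e = (\<lambda>i. pr (num i) (xs ! i)) ` {..<length xs}"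
    by (intro finite_ex) auto
  then obtain e where e: "e \<in> M" "ext m e = (\<lambda>i. pr (num i) (xs ! i)) ` {..<length xs}" by blast
  then have "sq xs = e" unfolding sq_def by (rule the_ext)
  then show "sq xs \<in> M" "ext m (sq xs) = (\<lambda>i. pr (num i) (xs ! i)) ` {..<length xs}"
    using e by simp_all
qed

lemma nth_car: "set xs \<subseteq> M \<Longrightarrow> i < length xs \<Longrightarrow> xs ! i \<in> M"
  using nth_mem by blast

lemma inP_sq: assumes "set xs \<subseteq> M" "a \<in> M" 
  shows "inP m (sq xs) (num i) a \<longleftrightarrow> i < length xs \<and> xs ! i = a"
proof -
  have "inP m (sq xs) (num i) a \<longleftrightarrow> (\<exists>j<length xs. pr (num i) a = pr (num j) (xs ! j))"
    using inP_iff[OF num_car[of i] assms(2), of "sq xs"] by (auto simp: sq_ext[OF assms(1)])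
  also have "\<dots> \<longleftrightarrow> i < length xs \<and> xs ! i = a"
    using assms pr_inj nth_car by auto
  finally show ?thesis .
qed

lemma sq_inj: assumes "set xs \<subseteq> M" "set ys \<subseteq> M" shows "sq xs = sq ys \<longleftrightarrow> xs = ys"
proof
  assume eq: "sq xs = sq ys"
  have le: "i < length xs \<longleftrightarrow> i < length ys \<and> xs ! i = ys ! i" if "i < length xs" for i
    using inP_sq[OF assms(1), of "xs ! i" i] inP_sq[OF assms(2), of "xs ! i" i] eq assms that nth_car by auto
  have ge: "i < length xs" if "i < length ys" for i
    using inP_sq[OF assms(1), of "ys ! i" i] inP_sq[OF assms(2), of "ys ! i" i] eq assms that nth_car by auto
  have "length xs = length ys" using le ge by (meson linorder_neqE_nat order_less_irrefl)
  then show "xs = ys" using le by (intro nth_equalityI) auto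
qed auto

lemma fn_sq: assumes "set xs \<subseteq> ext m U" shows "fn m (sq xs) (num (length xs)) U"
proof -
  have M: "set xs \<subseteq> M" using assms ext_car by fast
  have "\<exists>i\<in>ext m (num (length xs)). \<exists>b\<in>ext m U. opr m z i b" if z: "z \<in> ext m (sq xs)" for z
  proof -
    obtain i where i: "i < length xs" "z = pr (num i) (xs ! i)" using z unfolding sq_ext[OF M] by blast
    then have "xs ! i \<in> ext m U" "xs ! i \<in> M" using assms M nth_mem by auto
    then show ?thesis using i by (intro bexI[of _ "num i"] bexI[of _ "xs ! i"]) (auto simp: num_ext opr_pr)
  qed
  moreover have "\<exists>b\<in>ext m U. inP m (sq xs) (num i) b \<and> (\<forall>b'\<in>ext m U. inP m (sq xs) (num i) b' \<longrightarrow> b' = b)"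
    if "i < length xs" for i
    using that assms M nth_car inP_sq[OF M] ext_car[of _ m U] nth_mem by (intro bexI[of _ "xs ! i"]) auto
  ultimately show ?thesis unfolding fn_def by (auto simp: num_ext)
qed

lemma fn_num: assumes "set xs \<subseteq> ext m U" "fn m (sq xs) (num k) U" shows "k = length xs"
proof -
  have M: "set xs \<subseteq> M" using assms ext_car by fast
  have "i < length xs" if "i < k" for i
    using assms(2) that inP_sq[OF M, of _ i] unfolding fn_def by (fastforce simp: num_ext dest: ext_car)
  moreover have "i < k" if "i < length xs" for i
  proof -
    have "pr (num i) (xs ! i) \<in> ext m (sq xs)" using that by (auto simp: sq_ext[OF M])
    then obtain j b where "j \<in> ext m (num k)" "b \<in> ext m U" "opr m (pr (num i) (xs ! i)) j b"
      using assms(2) unfolding fn_def by blast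
    then have "j = num i" using opr_inj opr_pr[OF num_car nth_car[OF M that], of i] by blast
    then show ?thesis using \<open>j \<in> ext m (num k)\<close> by (auto simp: num_ext)
  qed
  ultimately show ?thesis by (meson linorder_neqE_nat order_less_irrefl)
qed

text \<open>An internal sequence of numeral length is a list, because a numeral has finitely many members, which are themselves numerals.\<close>

lemma fn_list: assumes "e \<in> M" "U \<in> M" "fn m e (num k) U"
  shows "\<exists>xs. set xs \<subseteq> ext m U \<and> length xs = k \<and> e = sq xs"
proof -
  have "\<forall>i<k. \<exists>b. b \<in> ext m U \<and> inP m e (num i) b \<and> (\<forall>b'\<in>ext m U. inP m e (num i) b' \<longrightarrow> b' = b)"
    using assms(3) unfolding fn_def by (fastforce simp: num_ext)
  then obtain f where f: "\<And>i. i < k \<Longrightarrow> f i \<in> ext m U \<and> inP m e (num i) (f i) \<and> (\<forall>b'\<in>ext m U. inP m e (num i) b' \<longrightarrow> b' = f i)"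
    by metis
  let ?xs = "map f [0..<k]"
  have s: "set ?xs \<subseteq> ext m U" using f by auto
  then have M: "set ?xs \<subseteq> M" using ext_car by fast
  have "ext m e = ext m (sq ?xs)"
  proof
    show "ext m e \<subseteq> ext m (sq ?xs)"
    proof
      fix z assume z: "z \<in> ext m e"
      then obtain i b where ib: "i < k" "b \<in> ext m U" "opr m z (num i) b"
        using assms(3) unfolding fn_def by (fastforce simp: num_ext)
      then have "inP m e (num i) b" using z inP_def by fast
      then have "b = f i" using f ib by auto
      moreover have "z = pr (num i) b" using ib opr_iff ext_car[OF z] ext_car num_car by metis
      ultimately show "z \<in> ext m (sq ?xs)" using ib(1) by (auto simp: sq_ext[OF M])
    qed
    show "ext m (sq ?xs) \<subseteq> ext m e"
    proof
      fix z assume "z \<in> ext m (sq ?xs)"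
      then obtain i where i: "i < k" "z = pr (num i) (f i)" by (auto simp: sq_ext[OF M])
      have "f i \<in> M" using f[OF i(1)] ext_car by fast
      then show "z \<in> ext m e" using f[OF i(1)] i(2) inP_iff[OF num_car[of i], of "f i" e] by simp
    qed
  qed
  then have "e = sq ?xs" using ext_eq assms(1) sq_car[OF M] by blast
  then show ?thesis using s by (intro exI[of _ ?xs]) auto
qed

lemma appn_iff: assumes "set xs \<subseteq> M" "a \<in> M" "e' \<in> M"
  shows "appn m e' (sq xs) (num (length xs)) a \<longleftrightarrow> e' = sq (xs @ [a])"
proof -
  have M: "set (xs @ [a]) \<subseteq> M" using assms by auto
  have "ext m (sq (xs @ [a])) = insert (pr (num (length xs)) a) (ext m (sq xs))"
    unfolding sq_ext[OF M] sq_ext[OF assms(1)] by (auto simp: lessThan_Suc nth_append)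
  moreover have "appn m e' (sq xs) (num (length xs)) a \<longleftrightarrow> ext m e' = insert (pr (num (length xs)) a) (ext m (sq xs))"
    unfolding appn_def using assms inP_iff opr_iff[OF num_car assms(2)] ext_car[of _ m e'] by auto
  ultimately show ?thesis using ext_eq[OF assms(3) sq_car[OF M]] by auto
qed

lemma isE_iff: assumes "U \<in> M" "E \<in> M" shows "isE m W U E \<longleftrightarrow> ext m E = sq ` lists (ext m U)"
proof
  assume E: "isE m W U E"
  have car: "set xs \<subseteq> M" if "set xs \<subseteq> ext m U" for xs using that ext_car by fast
  have 1: "\<exists>xs. set xs \<subseteq> ext m U \<and> e = sq xs" if "e \<in> ext m E" for e
    using E that fn_list[of e U] ext_car[OF that] assms unfolding isE_def W_ext by blast
  have 2: "sq xs \<in> ext m E" if "set xs \<subseteq> ext m U" for xs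
    using that
  proof (induction xs rule: rev_induct)
    case Nil
    obtain e where e: "e \<in> ext m E" "ext m e = {}" using E unfolding isE_def by auto
    then have "e = sq []" using ext_eq[of e "sq []"] sq_car[of "[]"] sq_ext[of "[]"] ext_car[OF e(1)] by auto
    then show ?case using e by simp
  next
    case (snoc a xs)
    then have "\<exists>e'\<in>ext m E. appn m e' (sq xs) (num (length xs)) a"
      using E fn_sq[of xs U] unfolding isE_def W_ext by simp
    then show ?case using appn_iff[OF car[of xs], of a] snoc.prems ext_car by (metis append_eq_conv_conj le_sup_iff list.set_intros(1) set_append subset_eq)
  qed
  show "ext m E = sq ` lists (ext m U)" using 1 2 by (auto simp: lists_eq_set)
next
  assume E: "ext m E = sq ` lists (ext m U)"
  have car: "set xs \<subseteq> M" if "set xs \<subseteq> ext m U" for xs using that ext_car by fast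
  have 1: "\<exists>n\<in>ext m W. fn m e n U" if "e \<in> ext m E" for e
    using that fn_sq unfolding E W_ext lists_eq_set by auto
  have 2: "\<exists>e\<in>ext m E. ext m e = {}"
    unfolding E by (rule bexI[of _ "sq []"]) (auto simp: sq_ext)
  have 3: "\<exists>e'\<in>ext m E. appn m e' e n a" if that: "e \<in> ext m E" "n \<in> ext m W" "a \<in> ext m U" "fn m e n U" for e n a
  proof -
    note E' = that
    obtain xs where xs: "set xs \<subseteq> ext m U" "e = sq xs" using E' unfolding E lists_eq_set by auto
    then have n: "n = num (length xs)" using that fn_num unfolding W_ext by auto
    have "set (xs @ [a]) \<subseteq> ext m U" using xs that by auto
    then show ?thesis using appn_iff[OF car[OF xs(1)], of a "sq (xs @ [a])"] sq_car[OF car, of "xs @ [a]"] ext_car[OF that(3)]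
      unfolding E n xs lists_eq_set by blast
  qed
  show "isE m W U E" unfolding isE_def using 1 2 3 by auto
qed

lemma app_ex:
  assumes "U \<in> M" "set xs \<subseteq> ext m U" "E \<in> M" "ext m E = sq ` lists (ext m U)"
  shows "(\<exists>n\<in>ext m W. \<exists>a\<in>ext m U. \<exists>e'\<in>ext m E. fn m (sq xs) n U \<and> appn m e' (sq xs) n a \<and> P a e')
     \<longleftrightarrow> (\<exists>a\<in>ext m U. P a (sq (xs @ [a])))"
proof -
  have car: "set xs \<subseteq> M" using assms ext_car by fast
  have 1: "fn m (sq xs) n U \<and> appn m e' (sq xs) n a \<longleftrightarrow> n = num (length xs) \<and> e' = sq (xs @ [a])"
    if "n \<in> ext m W" "a \<in> ext m U" "e' \<in> ext m E" for n a e'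
    using fn_num[OF assms(2)] fn_sq[OF assms(2)] appn_iff[OF car ext_car[OF that(2)] ext_car[OF that(3)]] that(1)
    unfolding W_ext by blast
  have 2: "sq (xs @ [a]) \<in> ext m E" if "a \<in> ext m U" for a
    using assms that by (auto simp: lists_eq_set)
  have 3: "num (length xs) \<in> ext m W" by (auto simp: W_ext)
  show ?thesis (is "?L \<longleftrightarrow> ?R")
  proof
    assume ?L
    then obtain n a e' where *: "n \<in> ext m W" "a \<in> ext m U" "e' \<in> ext m E"
      "fn m (sq xs) n U" "appn m e' (sq xs) n a" "P a e'" by blast
    then show ?R using 1[OF *(1-3)] by auto
  next
    assume ?R
    then obtain a where *: "a \<in> ext m U" "P a (sq (xs @ [a]))" by blast
    then show ?L using 1[OF 3 *(1) 2[OF *(1)]] 2[OF *(1)] 3 by blast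
  qed
qed

lemma clause_code:
  assumes "U \<in> M" "E \<in> M" "ext m Z = code ` D" "ext m E = sq ` lists (ext m U)"
    and "\<forall>d e. DNand d e \<in> D \<longrightarrow> d \<in> D \<and> e \<in> D" "\<forall>d. DEx d \<in> D \<longrightarrow> d \<in> D"
    and "d \<in> D" "set xs \<subseteq> ext m U"
  shows "clause m W Z U E S (code d) (sq xs) \<longleftrightarrow> (case d of
      DNand d e \<Rightarrow> \<not> (inP m S (code d) (sq xs) \<and> inP m S (code e) (sq xs))
    | DEx d \<Rightarrow> (\<exists>a\<in>ext m U. inP m S (code d) (sq (xs @ [a])))
    | _ \<Rightarrow> dsat (ext m U) (snd m) d xs)"
proof -
  have car: "set xs \<subseteq> M" using assms(8) ext_car[of _ m U] by blast
  show ?thesis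
  proof (cases d)
    case d: (DMem i j)
    have "clause m W Z U E S (code (DMem i j)) (sq xs) \<longleftrightarrow>
        (\<exists>a\<in>ext m U. \<exists>b\<in>ext m U. inP m (sq xs) (num i) a \<and> inP m (sq xs) (num j) b \<and> a \<in> ext m b)"
      by (auto simp: clause_def trip_iff pr_inj W_ext assms(3))
    also have "\<dots> \<longleftrightarrow> (\<exists>a\<in>ext m U. \<exists>b\<in>ext m U. (i < length xs \<and> xs ! i = a) \<and> (j < length xs \<and> xs ! j = b) \<and> a \<in> ext m b)"
      using inP_sq[OF car] ext_car[of _ m U] by (intro bex_cong) auto
    also have "\<dots> \<longleftrightarrow> dsat (ext m U) (snd m) (DMem i j) xs"
      using assms(8) nth_mem[of i xs] nth_mem[of j xs] nth_car[OF car]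
      by (auto simp: ext_def[of m "xs ! j"])
    finally show ?thesis using d by simp
  next
    case d: (DEq i j)
    have "clause m W Z U E S (code (DEq i j)) (sq xs) \<longleftrightarrow>
        (\<exists>a\<in>ext m U. inP m (sq xs) (num i) a \<and> inP m (sq xs) (num j) a)"
      by (auto simp: clause_def trip_iff pr_inj W_ext assms(3))
    also have "\<dots> \<longleftrightarrow> (\<exists>a\<in>ext m U. (i < length xs \<and> xs ! i = a) \<and> (j < length xs \<and> xs ! j = a))"
      using inP_sq[OF car] ext_car[of _ m U] by (intro bex_cong) auto
    also have "\<dots> \<longleftrightarrow> dsat (ext m U) (snd m) (DEq i j) xs"
      using assms(8) nth_mem[of i xs] by auto
    finally show ?thesis using d by simp
  next
    case d: (DNand d1 d2)
    then have D: "d1 \<in> D" "d2 \<in> D" using assms(5,7) by blast+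
    have "clause m W Z U E S (code (DNand d1 d2)) (sq xs) \<longleftrightarrow>
       \<not> (inP m S (code d1) (sq xs) \<and> inP m S (code d2) (sq xs))"
      using D by (auto simp: clause_def trip_iff pr_inj W_ext assms(3))
    then show ?thesis using d by simp
  next
    case d: (DEx d1)
    then have D: "d1 \<in> D" using assms(6,7) by blast
    have "clause m W Z U E S (code (DEx d1)) (sq xs) \<longleftrightarrow>
      (\<exists>n\<in>ext m W. \<exists>a\<in>ext m U. \<exists>e'\<in>ext m E. fn m (sq xs) n U \<and> appn m e' (sq xs) n a \<and> inP m S (code d1) e')"
      using D by (auto simp: clause_def trip_iff pr_inj W_ext assms(3))
    also have "\<dots> \<longleftrightarrow> (\<exists>a\<in>ext m U. inP m S (code d1) (sq (xs @ [a])))"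
      by (rule app_ex[OF assms(1,8,2,4)])
    finally show ?thesis using d by simp
  qed
qed

text \<open>Uniqueness of satisfaction, by induction on honest formulae. The set \<open>D\<close> of formulae is only required to be
  closed under subformulae: finite sets of subformulae give the partial satisfaction relations from which
  the full relation is put together.\<close>

lemma Scl_iff:
  assumes "U \<in> M" "E \<in> M" "ext m Z = code ` D" "ext m E = sq ` lists (ext m U)"
    and "\<forall>d e. DNand d e \<in> D \<longrightarrow> d \<in> D \<and> e \<in> D" "\<forall>d. DEx d \<in> D \<longrightarrow> d \<in> D"
  shows "Scl m W Z U E S \<longleftrightarrow> (\<forall>d\<in>D. \<forall>xs. set xs \<subseteq> ext m U \<longrightarrow>
    (inP m S (code d) (sq xs) \<longleftrightarrow> dsat (ext m U) (snd m) d xs))" (is "_ \<longleftrightarrow> ?R")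
proof -
  have *: "Scl m W Z U E S \<longleftrightarrow> (\<forall>d\<in>D. \<forall>xs. set xs \<subseteq> ext m U \<longrightarrow>
    (inP m S (code d) (sq xs) \<longleftrightarrow> clause m W Z U E S (code d) (sq xs)))"
    unfolding Scl_def assms(3,4) lists_eq_set by blast
  note cl = clause_code[OF assms]
  show ?thesis
  proof
    assume R: ?R
    have "clause m W Z U E S (code d) (sq xs) \<longleftrightarrow> dsat (ext m U) (snd m) d xs"
      if d: "d \<in> D" "set xs \<subseteq> ext m U" for d xs
    proof (cases d)
      case (DNand d1 d2)
      then have "d1 \<in> D" "d2 \<in> D" using assms(5) d by blast+
      then have "inP m S (code d1) (sq xs) \<longleftrightarrow> dsat (ext m U) (snd m) d1 xs"
        "inP m S (code d2) (sq xs) \<longleftrightarrow> dsat (ext m U) (snd m) d2 xs" using R d(2) by blast+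
      then show ?thesis using cl[OF d, of S] DNand by simp
    next
      case (DEx d1)
      then have "d1 \<in> D" using assms(6) d by blast
      moreover have "set (xs @ [a]) \<subseteq> ext m U" if "a \<in> ext m U" for a using that d by simp
      ultimately have "inP m S (code d1) (sq (xs @ [a])) \<longleftrightarrow> dsat (ext m U) (snd m) d1 (xs @ [a])" if "a \<in> ext m U" for a
        using R that by blast
      then show ?thesis using cl[OF d, of S] DEx by simp
    qed (use cl[OF d, of S] in simp_all)
    then show "Scl m W Z U E S" using R unfolding * by blast
  next
    assume "Scl m W Z U E S"
    then have st: "inP m S (code d) (sq xs) \<longleftrightarrow> clause m W Z U E S (code d) (sq xs)"
      if "d \<in> D" "set xs \<subseteq> ext m U" for d xs using that unfolding * by blast
    have "inP m S (code d) (sq xs) \<longleftrightarrow> dsat (ext m U) (snd m) d xs"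
      if "d \<in> D" "set xs \<subseteq> ext m U" for d xs
      using that
    proof (induction d arbitrary: xs)
      case (DNand d1 d2)
      then have D: "d1 \<in> D" "d2 \<in> D" using assms(5) by blast+
      show ?case using st[OF DNand.prems] cl[OF DNand.prems, of S] DNand.IH(1)[OF D(1) DNand.prems(2)]
          DNand.IH(2)[OF D(2) DNand.prems(2)] by simp
    next
      case (DEx d1)
      then have D: "d1 \<in> D" using assms(6) by blast
      have "inP m S (code d1) (sq (xs @ [a])) \<longleftrightarrow> dsat (ext m U) (snd m) d1 (xs @ [a])" if "a \<in> ext m U" for a
        using DEx.IH[OF D] DEx.prems(2) that by simp
      then show ?case using st[OF DEx.prems] cl[OF DEx.prems, of S] by simp
    next
      case (DMem i j)
      show ?case using st[OF DMem] cl[OF DMem, of S] by simp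
    next
      case (DEq i j)
      show ?case using st[OF DEq] cl[OF DEq, of S] by simp
    qed
    then show ?R by blast
  qed
qed

end

lemma rep_term3:
  assumes "rep \<Gamma> \<M> (\<lambda>m s. R m (s 0) (s 1) (s 2))" "tm \<M> t" "tm \<M> u" "tm \<M> v" "renc \<Gamma>"
  shows "rep \<Gamma> \<M> (\<lambda>m s. R m (t s) (u s) (v s))"
proof -
  have "rep \<Gamma> \<M> (\<lambda>m s. R m (s 2) (s 1) (s 0))"
    using rep_ren[OF assms(1,5), of "\<lambda>i. 2 - i"] by (simp add: numeral_2_eq_2)
  from rep_term[OF this tm_shift[OF tm_shift[OF assms(4)]] assms(5)]
  have "rep \<Gamma> \<M> (\<lambda>m s. R m (s 1) (s 0) (v (\<lambda>i. s (Suc (Suc i)))))"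
    by (simp add: numeral_2_eq_2)
  from rep_term[OF this tm_shift[OF assms(3)] assms(5)]
  have "rep \<Gamma> \<M> (\<lambda>m s. R m (s 0) (u (\<lambda>i. s (Suc i))) (v (\<lambda>i. s (Suc i))))"
    by simp
  from rep_term[OF this assms(2,5)] show ?thesis by simp
qed

lemma tm_single: "c \<in> fst m \<Longrightarrow> tm {m} (\<lambda>s. c)"
  by (rule tm_const) simp

text \<open>Bounded quantifiers over elements of \<open>A\<close> have the same range in \<open>A\<close> and in the structure.\<close>

lemma Delta0_abs:
  assumes "q \<in> Delta0" "A \<subseteq> fst m" "\<And>x. x \<in> A \<Longrightarrow> ext m x \<subseteq> A"
  shows "range s \<subseteq> A \<Longrightarrow> sat A (snd m) s q \<longleftrightarrow> Sat m s q"
  using assms(1)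
proof (induction q arbitrary: s)
  case (7 p x y)
  have "sat A (snd m) (s(x := a)) p \<longleftrightarrow> Sat m (s(x := a)) p" if "a \<in> A" for a
    by (rule 7) (use 7 that in auto)
  moreover have "s y \<in> A" using 7 by auto
  then have "a \<in> A" if "a \<in> fst m" "snd m a (s y)" for a using that assms(3) by (auto simp: ext_def)
  ultimately show ?case using 7 assms(2) by auto
next
  case (8 p x y)
  have "sat A (snd m) (s(x := a)) p \<longleftrightarrow> Sat m (s(x := a)) p" if "a \<in> A" for a
    by (rule 8) (use 8 that in auto)
  moreover have "s y \<in> A" using 8 by auto
  then have "a \<in> A" if "a \<in> fst m" "snd m a (s y)" for a using that assms(3) by (auto simp: ext_def)
  ultimately show ?case using 8 assms(2) by auto
qed auto

section \<open>Recursion along the natural numbers\<close>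

text \<open>The definable subsets of \<open>A\<close>, for an arbitrary structure and in terms of coded formulae, so that the same
  notion applies to sets of the model and of its end extension.\<close>

definition Dfs :: "'m set \<Rightarrow> ('m \<Rightarrow> 'm \<Rightarrow> bool) \<Rightarrow> 'm set set" where
  "Dfs A E = {{x \<in> A. dsat A E d (xs @ [x])} | d xs. set xs \<subseteq> A}"

context setm
begin

text \<open>A sequence of elements that is determined step by step by a \<open>\<Delta>\<^sub>0\<close> relation has a range that is a set. The argument \<open>w\<close>
  carries auxiliary sets that turn a \<open>\<Sigma>\<^sub>1\<close> step into a \<open>\<Delta>\<^sub>0\<close> one. Finite approximations exist as
  hereditarily finite sets over the given elements, and Collection over the set of numerals gathers
  them. The induction that shows the approximations to be correct takes place outside the structure.\<close>

lemma omega_rec: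
  assumes D: "D0 {m} (\<lambda>m s. \<psi> m (s 0) (s 1) (s 2))"
    and x: "\<And>i. x i \<in> M"
    and step: "\<And>i. \<exists>w\<in>M. \<psi> m (x i) (x (Suc i)) w"
    and func: "\<And>i y w. y \<in> M \<Longrightarrow> w \<in> M \<Longrightarrow> \<psi> m (x i) y w \<Longrightarrow> y = x (Suc i)"
  shows "\<exists>Z\<in>M. ext m Z = range x"
proof -
  \<comment> \<open>\<open>P\<close> is a finite approximation of the sequence and \<open>V\<close> contains its values and the step witnesses.\<close>
  define good where "good m' P V \<longleftrightarrow> (\<forall>z\<in>ext m' P. \<exists>j\<in>ext m' W. \<exists>y\<in>ext m' V. opr m' z j y \<and> 
     (emp m' j \<longrightarrow> y = x 0) \<and> (\<forall>k\<in>ext m' W. suc m' j k \<longrightarrow> 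
     (\<exists>y'\<in>ext m' V. \<exists>w\<in>ext m' V. inP m' P k y' \<and> \<psi> m' y' y w)))" for m' P V
  note D3 = rep_term3[OF D]
  have Dgood: "tm {m} t \<Longrightarrow> tm {m} u \<Longrightarrow> D0 {m} (\<lambda>m s. good m (t s) (u s))" for t u
    unfolding good_def by (intro D0_intros D0_rels D3 tm_single tm_intros renc x W_car)
  have val: "y = x j" if g: "good m P V" and "inP m P (num j) y" for P V j y
    using that(2)
  proof (induction j arbitrary: y)
    case 0
    then obtain z where z: "z \<in> ext m P" "opr m z (num 0) y" unfolding inP_def by blast
    then obtain j y1 where j: "opr m z j y1" "emp m j \<longrightarrow> y1 = x 0" using g unfolding good_def by blast
    show ?case using opr_inj[OF z(2) j(1)] j(2) by (auto simp: num_0)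
  next
    case (Suc k)
    then obtain z where z: "z \<in> ext m P" "opr m z (num (Suc k)) y" unfolding inP_def by blast
    then obtain j y1 where *: "opr m z j y1" "y1 \<in> ext m V" 
      "\<forall>k\<in>ext m W. suc m j k \<longrightarrow> (\<exists>y'\<in>ext m V. \<exists>w\<in>ext m V. inP m P k y' \<and> \<psi> m y' y1 w)"
      using g unfolding good_def by blast
    then have e: "j = num (Suc k)" "y1 = y" using opr_inj[OF z(2)] by auto
    have "suc m j (num k)" "num k \<in> ext m W" by (auto simp: e suc_iff num_Suc W_ext)
    then obtain y' w where "w \<in> ext m V" "inP m P (num k) y'" "\<psi> m y' y w" using *(3) e by blast
    then show ?case using Suc.IH func[of y w k] ext_car[of _ m V] *(2) e by auto
  qed
  obtain w where w: "\<And>i. w i \<in> M" "\<And>i. \<psi> m (x i) (x (Suc i)) (w i)" using step by metis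
  define \<Phi> where "\<Phi> m' n y \<longleftrightarrow> (\<exists>P\<in>ext m' y. \<exists>V\<in>ext m' y. good m' P V \<and> (\<exists>x\<in>ext m' V. inP m' P n x))" for m' n y
  have D\<Phi>: "D0 {m} (\<lambda>m s. \<Phi> m (s 0) (s 1))"
    unfolding \<Phi>_def by (intro D0_intros Dgood D0_rels tm_intros)
  have "\<exists>y\<in>M. \<Phi> m (num n) y" for n
  proof -
    have sub: "(\<lambda>i. pr (num i) (x i)) ` {..n} \<subseteq> M" "x ` {..n} \<union> w ` {..n} \<subseteq> M"
      "finite ((\<lambda>i. pr (num i) (x i)) ` {..n})" "finite (x ` {..n} \<union> w ` {..n})"
      using x w by auto
    obtain P where P: "P \<in> M" "ext m P = (\<lambda>i. pr (num i) (x i)) ` {..n}"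
      using finite_ex[of "(\<lambda>i. pr (num i) (x i)) ` {..n}"] sub by blast
    obtain V where V: "V \<in> M" "ext m V = x ` {..n} \<union> w ` {..n}"
      using finite_ex[of "x ` {..n} \<union> w ` {..n}"] sub by blast
    obtain y where y: "y \<in> M" "ext m y = {P, V}" using pairing P V by blast
    have "\<exists>j\<in>ext m W. \<exists>y\<in>ext m V. opr m z j y \<and> (emp m j \<longrightarrow> y = x 0) \<and> (\<forall>k\<in>ext m W. suc m j k \<longrightarrow> 
     (\<exists>y'\<in>ext m V. \<exists>w\<in>ext m V. inP m P k y' \<and> \<psi> m y' y w))" if "z \<in> ext m P" for z
    proof -
      from that obtain i where i: "i \<le> n" "z = pr (num i) (x i)" unfolding P by blast
      have "opr m z (num i) (x i)" using i opr_pr x by auto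
      moreover have "i = 0" if "emp m (num i)" using that by (auto simp: num_ext)
      moreover have "\<exists>y'\<in>ext m V. \<exists>w\<in>ext m V. inP m P k y' \<and> \<psi> m y' (x i) w" if k: "k \<in> ext m W" "suc m (num i) k" for k
      proof -
        obtain l where l: "k = num l" using k by (auto simp: W_ext)
        have "ext m (num i) = ext m (num (Suc l))" using k(2) l by (simp add: suc_iff num_Suc)
        then have "i = Suc l" using ext_eq num_car num_inj by blast
        moreover have "inP m P k (x l)" using i x calculation l P(2) by (auto simp: inP_iff)
        ultimately show ?thesis using w(2)[of l] i V(2) by (intro bexI[of _ "x l"] bexI[of _ "w l"]) auto
      qed
      moreover have "num i \<in> ext m W" "x i \<in> ext m V" using i V W_ext by auto
      ultimately show ?thesis by metis
    qed
    then have "good m P V" unfolding good_def by blast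
    moreover have "x n \<in> ext m V" "inP m P (num n) (x n)" using V P x by (auto simp: inP_iff)
    ultimately have "\<Phi> m (num n) y" unfolding \<Phi>_def y(2) by blast
    then show ?thesis using y(1) by blast
  qed
  then have "\<forall>n\<in>ext m W. \<exists>y\<in>M. \<Phi> m n y" by (auto simp: W_ext)
  from coll[OF D\<Phi> W_car this] obtain c where c: "c \<in> M" "\<forall>n\<in>ext m W. \<exists>y\<in>ext m c. \<Phi> m n y" by blast
  \<comment> \<open>The values lie two levels below \<open>c\<close>: in some \<open>V\<close> that belongs to some \<open>y\<close> in \<open>c\<close>.\<close>
  obtain u1 where u1: "u1 \<in> M" "ext m u1 = (\<Union>y\<in>ext m c. ext m y)" using union[OF c(1)] by blast
  obtain u2 where u2: "u2 \<in> M" "ext m u2 = (\<Union>y\<in>ext m u1. ext m y)" using union[OF u1(1)] by blast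
  define \<Theta> where "\<Theta> m' a \<longleftrightarrow> (\<exists>y\<in>ext m' c. \<exists>P\<in>ext m' y. \<exists>V\<in>ext m' y. good m' P V \<and> (\<exists>j\<in>ext m' W. inP m' P j a))" for m' a
  have "D0 {m} (\<lambda>m s. \<Theta> m (s 0))"
    unfolding \<Theta>_def by (intro D0_intros Dgood D0_rels tm_single tm_intros W_car c(1))
  from sep[OF this u2(1)] obtain Z where Z: "Z \<in> M" "ext m Z = {a \<in> ext m u2. \<Theta> m a}" by blast
  have "ext m Z = range x"
  proof
    show "ext m Z \<subseteq> range x"
      unfolding Z \<Theta>_def W_ext using val by blast
    show "range x \<subseteq> ext m Z"
    proof
      fix a assume "a \<in> range x"
      then obtain n where n: "a = x n" by blast
      have "num n \<in> ext m W" by (auto simp: W_ext)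
      then obtain y P V a' where *: "y \<in> ext m c" "P \<in> ext m y" "V \<in> ext m y" "good m P V" "a' \<in> ext m V" "inP m P (num n) a'"
        using c(2) unfolding \<Phi>_def by blast
      then have "a' = a" using val n by blast
      moreover have "\<Theta> m a'" unfolding \<Theta>_def using * \<open>num n \<in> ext m W\<close> by blast
      moreover have "a' \<in> ext m u2" using * u1 u2 by blast
      ultimately show "a \<in> ext m Z" using Z by blast
    qed
  qed
  then show ?thesis using Z(1) by blast
qed

end

text \<open>With such a set of codes, internal satisfaction relations contain no nonstandard formulae.\<close>

locale setc = setm +
  fixes Cd
  assumes Cd_car [simp]: "Cd \<in> fst m" and Cd_ext: "ext m Cd = range code"
begin

lemma SP_E: "SP m W Cd U E S \<Longrightarrow> U \<in> M \<Longrightarrow> E \<in> M \<Longrightarrow> ext m E = sq ` lists (ext m U)"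
  using isE_iff unfolding SP_def by blast

lemma SP_S: "SP m W Cd U E S \<Longrightarrow> U \<in> M \<Longrightarrow> E \<in> M \<Longrightarrow> S \<in> M \<Longrightarrow> set xs \<subseteq> ext m U \<Longrightarrow>
  inP m S (code d) (sq xs) \<longleftrightarrow> dsat (ext m U) (snd m) d xs"
  using Scl_iff[of U E Cd UNIV S] SP_E[of U E S] Cd_ext unfolding SP_def by blast

lemma SP_mem:
  assumes "SP m W Cd U E S" "U \<in> M" "E \<in> M" "set xs \<subseteq> M"
  shows "sq xs \<in> ext m E \<longleftrightarrow> set xs \<subseteq> ext m U"
proof -
  have "sq xs \<in> ext m E \<longleftrightarrow> (\<exists>ys. set ys \<subseteq> ext m U \<and> sq xs = sq ys)"
    unfolding SP_E[OF assms(1-3)] lists_eq_set by auto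
  also have "\<dots> \<longleftrightarrow> set xs \<subseteq> ext m U"
    using sq_inj[OF assms(4)] ext_car[of _ m U] by blast
  finally show ?thesis .
qed

lemma app1:
  assumes "U \<in> M" "set xs \<subseteq> ext m U" "E \<in> M" "ext m E = sq ` lists (ext m U)" "a \<in> ext m U"
  shows "(\<exists>n\<in>ext m W. \<exists>e'\<in>ext m E. fn m (sq xs) n U \<and> appn m e' (sq xs) n a \<and> P e')
     \<longleftrightarrow> P (sq (xs @ [a]))"
  using app_ex[OF assms(1-4), of "\<lambda>a' e'. a' = a \<and> P e'"] assms(5) by blast

lemma defs_iff:
  assumes "SP m W Cd U E S" "U \<in> M" "E \<in> M" "S \<in> M" "set xs \<subseteq> ext m U"
  shows "defs m W U E S y (code d) (sq xs) \<longleftrightarrow> ext m y = {x \<in> ext m U. dsat (ext m U) (snd m) d (xs @ [x])}"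
proof -
  have "(\<exists>n\<in>ext m W. \<exists>e'\<in>ext m E. fn m (sq xs) n U \<and> appn m e' (sq xs) n x \<and> inP m S (code d) e')
    \<longleftrightarrow> dsat (ext m U) (snd m) d (xs @ [x])" if "x \<in> ext m U" for x
    unfolding app1[OF assms(2,5,3) SP_E[OF assms(1-3)] that, of "inP m S (code d)"]
    using SP_S[OF assms(1-4), of "xs @ [x]"] assms(5) that by simp
  then show ?thesis unfolding defs_def by auto
qed

lemma DF_iff:
  assumes "SP m W Cd U E S" "DF m W Cd U E S d" "U \<in> M" "E \<in> M" "S \<in> M"
  shows "ext m d = {y \<in> M. ext m y \<in> Dfs (ext m U) (snd m)}"
proof -
  note E = SP_E[OF assms(1,3,4)]
  show ?thesis
  proof (intro equalityI subsetI)
    fix y assume y: "y \<in> ext m d"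
    then obtain c e where "c \<in> ext m Cd" "e \<in> ext m E" "defs m W U E S y c e"
      using assms(2) unfolding DF_def by blast
    then obtain dd xs where "set xs \<subseteq> ext m U" "defs m W U E S y (code dd) (sq xs)"
      unfolding E Cd_ext lists_eq_set by blast
    then show "y \<in> {y \<in> M. ext m y \<in> Dfs (ext m U) (snd m)}"
      using defs_iff[OF assms(1,3,4,5)] ext_car[OF y] unfolding Dfs_def by blast
  next
    fix y assume "y \<in> {y \<in> M. ext m y \<in> Dfs (ext m U) (snd m)}"
    then obtain dd xs where y: "y \<in> M" "set xs \<subseteq> ext m U" "ext m y = {x \<in> ext m U. dsat (ext m U) (snd m) dd (xs @ [x])}"
      unfolding Dfs_def by blast
    then have "sq xs \<in> ext m E" "code dd \<in> ext m Cd" unfolding E Cd_ext by (auto simp: lists_eq_set)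
    then obtain y' where y': "y' \<in> ext m d" "defs m W U E S y' (code dd) (sq xs)"
      using assms(2) unfolding DF_def by blast
    then have "ext m y' = ext m y" using defs_iff[OF assms(1,3,4,5) y(2)] y(3) by simp
    then have "y' = y" using ext_eq y(1) ext_car[OF y'(1)] by blast
    then show "y \<in> ext m d" using y' by blast
  qed
qed

lemma IsD_iff:
  assumes "IsD m W Cd v d Q" "v \<in> M"
  shows "ext m d = {y \<in> M. ext m y \<in> Dfs (ext m v) (snd m)}"
proof -
  obtain E S where *: "E \<in> ext m Q" "S \<in> ext m Q" "SP m W Cd v E S" "DF m W Cd v E S d"
    using assms unfolding IsD_def by blast
  show ?thesis by (rule DF_iff[OF *(3,4) assms(2) ext_car[OF *(1)] ext_car[OF *(2)]])
qed

text \<open>The package only certifies truth: it does not influence it.\<close>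

lemma TQ_iff:
  assumes "Hi m W Cd h Q" "v \<in> ext m h" "set xs \<subseteq> M"
  shows "TQ m W Cd h Q v (code d) (sq xs) \<longleftrightarrow> set xs \<subseteq> ext m v \<and> dsat (ext m v) (snd m) d xs"
proof -
  have v: "v \<in> M" using assms(2) ext_car by metis
  have *: "sq xs \<in> ext m E \<and> inP m S (code d) (sq xs) \<longleftrightarrow> set xs \<subseteq> ext m v \<and> dsat (ext m v) (snd m) d xs"
    if "E \<in> ext m Q" "S \<in> ext m Q" "SP m W Cd v E S" for E S
    using SP_mem[OF that(3) v ext_car[OF that(1)] assms(3)]
      SP_S[OF that(3) v ext_car[OF that(1)] ext_car[OF that(2)]] by blast
  obtain E S where "E \<in> ext m Q" "S \<in> ext m Q" "SP m W Cd v E S"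
    using assms(1,2) unfolding Hi_def IsD_def by blast
  then show ?thesis unfolding TQ_def using * assms(2) by blast
qed

end

section \<open>The axiom schemes for represented relations\<close>

lemma range_const_env: "set cs \<subseteq> A \<Longrightarrow> a \<in> A \<Longrightarrow> range (env cs (\<lambda>_. a)) \<subseteq> A"
  by (rule range_env) auto

text \<open>The scheme is stated for formulae with parameters as free variables; constants of a represented
  relation become such parameters.\<close>

lemma sep_of_models:
  assumes mod: "models (fst m) (snd m) (Separation Delta0)"
    and D: "D0 {m} (\<lambda>m s. \<Phi> m (s 0))" and w: "w \<in> fst m"
  shows "\<exists>y\<in>fst m. ext m y = {x \<in> ext m w. \<Phi> m x}"
proof -
  obtain q cs where q: "q \<in> Delta0" "set cs \<subseteq> fst m"
    "\<And>s. range s \<subseteq> fst m \<Longrightarrow> Sat m (env cs s) q \<longleftrightarrow> \<Phi> m (s 0)"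
    using D unfolding rep_def by auto
  let ?n = "length cs"
  define k where "k = fresh (insert ?n (fv q))"
  have k: "?n < k" "\<And>i. i \<in> fv q \<Longrightarrow> i < k"
    using fresh_gt[of "insert ?n (fv q)"] finite_fv[of q] by (auto simp: k_def)
  have k': "k \<notin> fv q" "Suc k \<notin> fv q" using k(2)[of k] k(2)[of "Suc k"] by auto
  let ?F = "All (Suc k) (Ex k (All ?n (Iff (Mem ?n k) (Conj (Mem ?n (Suc k)) q))))"
  have "?F \<in> Separation Delta0" unfolding Separation_def using q(1) k(1) k'
    by (auto intro!: exI[of _ q] exI[of _ ?n] exI[of _ k] exI[of _ "Suc k"])
  then have "Sat m (env cs (\<lambda>_. w)) ?F" using mod range_const_env[OF q(2) w] unfolding models_def by blast
  then have "\<forall>w'\<in>fst m. \<exists>y\<in>fst m. \<forall>a\<in>fst m. snd m a y \<longleftrightarrow> snd m a w' \<and>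
     Sat m ((env cs (\<lambda>_. w))(Suc k := w', k := y, ?n := a)) q" using k(1)
    by (simp add: iff_conv_conj_imp[symmetric])
  note sat_F = bspec[OF this w]
  obtain y where y: "y \<in> fst m" "\<And>a. a \<in> fst m \<Longrightarrow> snd m a y \<longleftrightarrow> snd m a w \<and>
     Sat m ((env cs (\<lambda>_. w))(Suc k := w, k := y, ?n := a)) q"
    using w k(1) sat_F by blast
  have "Sat m ((env cs (\<lambda>_. w))(Suc k := w, k := y, ?n := a)) q \<longleftrightarrow> \<Phi> m a" if "a \<in> fst m" for a
  proof -
    have "Sat m ((env cs (\<lambda>_. w))(Suc k := w, k := y, ?n := a)) q \<longleftrightarrow> Sat m (env cs (a ## (\<lambda>_. w))) q"
      by (rule sat_cong) (use k(2) in \<open>fastforce simp: env_def scons_def split: nat.splits\<close>)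
    then show ?thesis using q(3)[of "a ## (\<lambda>_. w)"] that w by simp
  qed
  then show ?thesis using y by (intro bexI[of _ y]) (auto simp: ext_def)
qed

lemma coll_of_models:
  assumes mod: "models (fst m) (snd m) (Collection \<Gamma>)"
    and D: "rep \<Gamma> {m} (\<lambda>m s. \<Psi> m (s 0) (s 1))" and w: "w \<in> fst m"
    and tot: "\<forall>x\<in>ext m w. \<exists>y\<in>fst m. \<Psi> m x y"
  shows "\<exists>c\<in>fst m. \<forall>x\<in>ext m w. \<exists>y\<in>ext m c. \<Psi> m x y"
proof -
  obtain q cs where q: "q \<in> \<Gamma>" "set cs \<subseteq> fst m"
    "\<And>s. range s \<subseteq> fst m \<Longrightarrow> Sat m (env cs s) q \<longleftrightarrow> \<Psi> m (s 0) (s 1)"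
    using D unfolding rep_def by auto
  let ?n = "length cs"
  define k where "k = fresh (insert (Suc ?n) (fv q))"
  have k: "Suc ?n < k" "\<And>i. i \<in> fv q \<Longrightarrow> i < k"
    using fresh_gt[of "insert (Suc ?n) (fv q)"] finite_fv[of q] by (auto simp: k_def)
  have k': "k \<notin> fv q" "Suc k \<notin> fv q" using k(2)[of k] k(2)[of "Suc k"] by auto
  let ?F = "All (Suc k) (Imp (BAll ?n (Suc k) (Ex (Suc ?n) q)) (Ex k (BAll ?n (Suc k) (BEx (Suc ?n) k q))))"
  have "?F \<in> Collection \<Gamma>" unfolding Collection_def using q(1) k(1) k'
    by (auto intro!: exI[of _ q] exI[of _ ?n] exI[of _ "Suc ?n"] exI[of _ k] exI[of _ "Suc k"])
  then have F: "Sat m (env cs (\<lambda>_. w)) ?F" using mod range_const_env[OF q(2) w] unfolding models_def by blast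
  have *: "Sat m s q \<longleftrightarrow> \<Psi> m a b" if "a \<in> fst m" "b \<in> fst m" "s ?n = a" "s (Suc ?n) = b" 
    "\<And>i. i < ?n \<Longrightarrow> s i = cs ! i" "\<And>i. Suc ?n < i \<Longrightarrow> i < k \<Longrightarrow> s i = w" for s a b
  proof -
    have "Sat m s q \<longleftrightarrow> Sat m (env cs (a ## b ## (\<lambda>_. w))) q"
    proof (rule sat_cong)
      fix i assume "i \<in> fv q"
      then have "i < k" by (rule k(2))
      consider "i < ?n" | "i = ?n" | "i = Suc ?n" | j where "i = Suc (Suc (?n + j))"
        by (metis add_Suc_right less_imp_Suc_add linorder_neqE_nat not_less_eq)
      then show "s i = env cs (a ## b ## (\<lambda>_. w)) i"
        using that \<open>i < k\<close> by cases (auto simp: env_def Suc_diff_le)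
    qed
    then show ?thesis using q(3)[of "a ## b ## (\<lambda>_. w)"] that w by simp
  qed
  have 1: "Sat m ((env cs (\<lambda>_. w))(Suc k := w, ?n := a, Suc ?n := b)) q \<longleftrightarrow> \<Psi> m a b"
    if "a \<in> fst m" "b \<in> fst m" for a b
    by (rule *[OF that]) (use k(1) in \<open>simp_all add: env_def\<close>)
  have 2: "Sat m ((env cs (\<lambda>_. w))(Suc k := w, k := c, ?n := a, Suc ?n := b)) q \<longleftrightarrow> \<Psi> m a b"
    if "a \<in> fst m" "b \<in> fst m" for a b c
    by (rule *[OF that]) (use k(1) in \<open>simp_all add: env_def\<close>)
  have "\<forall>a\<in>fst m. snd m a w \<longrightarrow> (\<exists>b\<in>fst m. \<Psi> m a b)" using tot by (auto simp: ext_def)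
  then have "\<exists>c\<in>fst m. \<forall>a\<in>fst m. snd m a w \<longrightarrow> (\<exists>b\<in>fst m. snd m b c \<and> \<Psi> m a b)"
  proof -
    let ?s = "(env cs (\<lambda>_. w))(Suc k := w)"
    have "\<forall>w'\<in>fst m. (\<forall>a\<in>fst m. snd m a w' \<longrightarrow> (\<exists>b\<in>fst m.
        Sat m ((env cs (\<lambda>_. w))(Suc k := w', ?n := a, Suc ?n := b)) q)) \<longrightarrow>
      (\<exists>c\<in>fst m. \<forall>a\<in>fst m. snd m a w' \<longrightarrow> (\<exists>b\<in>fst m. snd m b c \<and>
        Sat m ((env cs (\<lambda>_. w))(Suc k := w', k := c, ?n := a, Suc ?n := b)) q))"
      using F k(1) by simp
    note F' = bspec[OF this w]
    have "\<forall>a\<in>fst m. snd m a w \<longrightarrow> (\<exists>b\<in>fst m. Sat m (?s(?n := a, Suc ?n := b)) q)"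
      using \<open>\<forall>a\<in>fst m. snd m a w \<longrightarrow> (\<exists>b\<in>fst m. \<Psi> m a b)\<close> 1 by blast
    then show ?thesis using F' 2 by meson
  qed
  then obtain c where "c \<in> fst m" "\<forall>a\<in>fst m. snd m a w \<longrightarrow> (\<exists>b\<in>fst m. snd m b c \<and> \<Psi> m a b)" by blast
  then show ?thesis by (intro bexI[of _ c]) (auto simp: ext_def)
qed

lemma small_image: "small A \<Longrightarrow> small (f ` A)" for f :: "'a V \<Rightarrow> 'a V"
proof -
  assume "small A"
  then obtain g :: "'a \<Rightarrow> 'a V" where g: "A \<subseteq> range g" unfolding small_def by blast
  then have "f ` A \<subseteq> range (\<lambda>a. f (g a))" by blast
  then show ?thesis unfolding small_def by blast
qed

lemma V_induct [case_names step]: "(\<And>x. (\<And>y. y \<in> elts x \<Longrightarrow> P y) \<Longrightarrow> P x) \<Longrightarrow> P x"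
  using wf_induct[OF wf_vmem, of P x] by (auto simp: vmem_def)

lemma V_trancl_induct: 
  assumes "\<And>x. (\<And>y. (y, x) \<in> {(x, y). vmem x y}\<^sup>+ \<Longrightarrow> P y) \<Longrightarrow> P x" shows "P x"
  using wf_induct[OF wf_trancl[OF wf_vmem], of P x] assms by blast

lemma V_noself: "x \<notin> elts x"
  by (induction x rule: V_induct) blast

section \<open>Definable powersets and the constructible hierarchy\<close>

text \<open>Both notions of definability agree: the parameters at variables other than \<open>0\<close> are listed first, and
  variable \<open>0\<close> is moved to the last position.\<close>

lemma Def_iff: "y \<in> Def X \<longleftrightarrow> elts y \<in> Dfs (elts X) vmem"
proof
  assume "y \<in> Def X"
  then obtain p s where ps: "\<forall>i\<in>fv p - {0}. s i \<in> elts X" 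
    "elts y = {x \<in> elts X. sat (elts X) vmem (s(0 := x)) p}" unfolding Def_def by blast
  show "elts y \<in> Dfs (elts X) vmem"
  proof (cases "elts X = {}")
    case True
    then show ?thesis using ps(2) unfolding Dfs_def by (auto intro: exI[of _ "[]"])
  next
    case False
    then obtain u where u: "u \<in> elts X" by blast
    define n where "n = fresh (fv p)"
    have n: "i < n" if "i \<in> fv p" for i using fresh_gt[OF finite_fv that] by (simp add: n_def)
    define xs where "xs = map (\<lambda>i. if i \<in> fv p - {0} then s i else u) [0..<n]"
    have xs: "set xs \<subseteq> elts X" "length xs = n" using ps(1) u by (auto simp: xs_def)
    define r where "r i = (if i = 0 then n else i)" for i
    have "dsat (elts X) vmem (enc p r (length (xs @ [x]))) (xs @ [x]) \<longleftrightarrow> sat (elts X) vmem (s(0 := x)) p" for x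
      by (rule dsat_enc) (use n in \<open>auto simp: r_def xs nth_append intro: less_SucI; auto simp: xs_def\<close>)
    then have "elts y = {x \<in> elts X. dsat (elts X) vmem (enc p r (Suc n)) (xs @ [x])}"
      using ps(2) xs(2) by simp
    then show ?thesis using xs(1) unfolding Dfs_def by blast
  qed
next
  assume "elts y \<in> Dfs (elts X) vmem"
  then obtain d xs where dx: "set xs \<subseteq> elts X" "elts y = {x \<in> elts X. dsat (elts X) vmem d (xs @ [x])}"
    unfolding Dfs_def by blast
  let ?n = "length xs"
  \<comment> \<open>The last position must become variable \<open>0\<close>, and \<open>v\<close> must stay injective.\<close>
  define v where "v i = (if i = ?n then 0 else Suc i)" for i
  have v: "inj v" by (auto simp: inj_def v_def)
  define s where "s i = xs ! (i - 1)" for i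
  have "sat (elts X) vmem (s(0 := x)) (dec d v (length (xs @ [x]))) \<longleftrightarrow> dsat (elts X) vmem d (xs @ [x])" for x
    by (rule sat_dec[OF v]) (auto simp: v_def s_def nth_append less_Suc_eq)
  moreover have "s i \<in> elts X" if "i \<in> fv (dec d v (Suc ?n)) - {0}" for i
  proof -
    have "i \<in> v ` {..<Suc ?n}" "i \<noteq> 0" using that fv_dec[of d v "Suc ?n"] by auto
    then obtain j where "j < ?n" "i = Suc j" by (auto simp: v_def less_Suc_eq split: if_splits)
    then show ?thesis using dx(1) nth_mem by (auto simp: s_def)
  qed
  ultimately show "y \<in> Def X" unfolding Def_def using dx(2)
    by (intro CollectI exI[of _ "dec d v (Suc ?n)"] exI[of _ s]) auto
qed

lemma Def_subset: "y \<in> Def X \<Longrightarrow> elts y \<subseteq> elts X"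
  unfolding Def_def by blast

lemma Def_self: "X \<in> Def X"
  unfolding Def_def by (intro CollectI exI[of _ "Eq 0 0"]) auto

lemma Def_mem: "y \<in> elts X \<Longrightarrow> elts y \<subseteq> elts X \<Longrightarrow> y \<in> Def X"
  unfolding Def_def by (intro CollectI exI[of _ "Mem 0 1"] exI[of _ "\<lambda>_. y"]) (auto simp: vmem_def)

lemma Lset_step: "y \<in> elts x \<Longrightarrow> Def (Lset y) \<subseteq> elts (Lset x)" for x :: "'a::infinite V"
  unfolding elts_Lset[of x] by blast

lemma Lset_trans: "z \<in> elts (Lset x) \<Longrightarrow> elts z \<subseteq> elts (Lset x)" for x :: "'a::infinite V"
proof (induction x arbitrary: z rule: V_induct)
  case (step x)
  then obtain y where y: "y \<in> elts x" "z \<in> Def (Lset y)" unfolding elts_Lset[of x] by blast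
  have "elts z \<subseteq> elts (Lset y)" using y Def_subset by blast
  moreover have "elts (Lset y) \<subseteq> Def (Lset y)" using step.IH[OF y(1)] Def_mem by blast
  ultimately show ?case using Lset_step[OF y(1)] by blast
qed

lemma Lset_in: "y \<in> elts x \<Longrightarrow> Lset y \<in> elts (Lset x)" for x :: "'a::infinite V"
  using Lset_step Def_self by blast

lemma Lset_Def: "elts (Lset y) \<subseteq> Def (Lset y)" for y :: "'a::infinite V"
  using Def_mem Lset_trans by blast

text \<open>Levels are compared without ordinals, by simultaneous \<open>\<in>\<close>-induction on both indices.\<close>

lemma Lset_linear:
  fixes x y :: "'a::infinite V"
  shows "Lset x = Lset y \<or> Def (Lset x) \<subseteq> elts (Lset y) \<or> Def (Lset y) \<subseteq> elts (Lset x)"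
proof (induction x arbitrary: y rule: V_induct)
  case (step x)
  note IHx = this
  show ?case
  proof (induction y rule: V_induct)
    case (step y)
    show ?case
    proof (cases "\<exists>y'\<in>elts y. \<not> Def (Lset y') \<subseteq> elts (Lset x)")
      case True
      then obtain y' where y': "y' \<in> elts y" "\<not> Def (Lset y') \<subseteq> elts (Lset x)" by blast
      then have "Def (Lset x) \<subseteq> Def (Lset y')" using step[OF y'(1)] Lset_Def[of y'] by auto
      then show ?thesis using Lset_step[OF y'(1)] by blast
    next
      case F: False
      show ?thesis
      proof (cases "\<exists>x'\<in>elts x. \<not> Def (Lset x') \<subseteq> elts (Lset y)")
        case True
        then obtain x' where x': "x' \<in> elts x" "\<not> Def (Lset x') \<subseteq> elts (Lset y)" by blast
        then have "Def (Lset y) \<subseteq> Def (Lset x')" using IHx[OF x'(1), of y] Lset_Def[of x'] by auto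
        then show ?thesis using Lset_step[OF x'(1)] by blast
      next
        case False
        then have "elts (Lset x) = elts (Lset y)" using F unfolding elts_Lset[of x] elts_Lset[of y] by blast
        then show ?thesis using V_ext by blast
      qed
    qed
  qed
qed

section \<open>The standard model\<close>

primrec vnum :: "nat \<Rightarrow> 'a V" where
  "vnum 0 = vset {}"
| "vnum (Suc n) = vset (insert (vnum n) (elts (vnum n)))"

locale kmod =
  fixes \<kappa> :: "'a::infinite V"
  assumes trans: "transitive \<kappa>"
    and mods: "models (elts \<kappa>) vmem (M_theory \<union> Collection (levy_Pi 1))"
begin

abbreviation "K \<equiv> elts \<kappa>"
abbreviation kk :: "'a V str" where "kk \<equiv> (elts \<kappa>, vmem)"

lemma K_trans: "x \<in> K \<Longrightarrow> y \<in> elts x \<Longrightarrow> y \<in> K"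
  using trans unfolding transitive_def by blast

lemma ext_k: "y \<in> K \<Longrightarrow> ext kk y = elts y"
  using K_trans[of y] by (auto simp: ext_def vmem_def)

lemma kex: "(\<exists>z\<in>fst kk. ext kk z = A) \<longleftrightarrow> (\<exists>z\<in>K. elts z = A)"
  by (auto simp: ext_k)

lemma ax: "p \<in> M_theory \<union> Collection (levy_Pi 1) \<Longrightarrow> x \<in> K \<Longrightarrow> sat K vmem (\<lambda>_. x) p"
  using mods unfolding models_def by (auto intro: image_subsetI)

lemma K_ne: "\<exists>x. x \<in> K"
  using mods unfolding models_def by blast

lemma k_pairing: assumes "x \<in> K" "y \<in> K" shows "\<exists>z\<in>K. elts z = {x, y}"
proof -
  have "sat K vmem (\<lambda>_. x) ax_Pair" by (rule ax) (use assms in \<open>auto simp: M_theory_def M_minus_def\<close>)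
  then have "\<forall>x\<in>K. \<forall>y\<in>K. \<exists>z\<in>K. \<forall>u\<in>K. (u \<in> elts z \<longrightarrow> u = x \<or> u = y) \<and>
      (u = x \<longrightarrow> u \<in> elts z) \<and> (u = y \<longrightarrow> u \<in> elts z)"
    by (simp add: ax_Pair_def vmem_def)
  then obtain z where "z \<in> K" "\<forall>u\<in>K. (u \<in> elts z \<longrightarrow> u = x \<or> u = y) \<and>
      (u = x \<longrightarrow> u \<in> elts z) \<and> (u = y \<longrightarrow> u \<in> elts z)" using assms by blast
  then show ?thesis using assms K_trans by (intro bexI[of _ z]) auto
qed

lemma k_union: assumes "x \<in> K" shows "\<exists>z\<in>K. elts z = (\<Union>y\<in>elts x. elts y)"
proof -
  have "sat K vmem (\<lambda>_. x) ax_Union" by (rule ax) (use assms in \<open>auto simp: M_theory_def M_minus_def\<close>)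
  then have "\<forall>x\<in>K. \<exists>z\<in>K. \<forall>u\<in>K. u \<in> elts z \<longleftrightarrow> (\<exists>y\<in>K. y \<in> elts x \<and> u \<in> elts y)"
    by (simp add: ax_Union_def vmem_def iff_conv_conj_imp[symmetric])
  then obtain z where "z \<in> K" "\<forall>u\<in>K. u \<in> elts z \<longleftrightarrow> (\<exists>y\<in>K. y \<in> elts x \<and> u \<in> elts y)" using assms by blast
  moreover have "elts z = (\<Union>y\<in>elts x. elts y)"
  proof (intro equalityI subsetI)
    fix u assume "u \<in> elts z"
    then show "u \<in> (\<Union>y\<in>elts x. elts y)" using calculation(2) K_trans[OF calculation(1)] by blast
  next
    fix u assume "u \<in> (\<Union>y\<in>elts x. elts y)"
    then obtain y where y: "y \<in> elts x" "u \<in> elts y" by blast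
    then have "y \<in> K" using K_trans[OF assms] by blast
    then show "u \<in> elts z" using y K_trans[OF \<open>y \<in> K\<close>] calculation(2) by blast
  qed
  ultimately show ?thesis by blast
qed

lemma k_power: assumes "x \<in> K" shows "\<exists>z\<in>K. elts z = {y \<in> K. elts y \<subseteq> elts x}"
proof -
  have "sat K vmem (\<lambda>_. x) ax_Powerset" by (rule ax) (use assms in \<open>auto simp: M_theory_def M_minus_def\<close>)
  then have "\<forall>x\<in>K. \<exists>z\<in>K. \<forall>y\<in>K. y \<in> elts z \<longleftrightarrow> (\<forall>u\<in>K. u \<in> elts y \<longrightarrow> u \<in> elts x)"
    by (simp add: ax_Powerset_def vmem_def iff_conv_conj_imp[symmetric])
  then obtain z where z: "z \<in> K" "\<forall>y\<in>K. y \<in> elts z \<longleftrightarrow> (\<forall>u\<in>K. u \<in> elts y \<longrightarrow> u \<in> elts x)" using assms by blast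
  have "(\<forall>u\<in>K. u \<in> elts y \<longrightarrow> u \<in> elts x) \<longleftrightarrow> elts y \<subseteq> elts x" if "y \<in> K" for y
    using K_trans[OF that] by blast
  then have "elts z = {y \<in> K. elts y \<subseteq> elts x}" using z K_trans[OF z(1)] by blast
  then show ?thesis using z(1) by blast
qed

lemma k_empty: "\<exists>z\<in>K. elts z = {}"
proof -
  obtain x where "x \<in> K" using K_ne by blast
  then have "sat K vmem (\<lambda>_. x) ax_Emptyset" by (intro ax) (auto simp: M_theory_def M_minus_def)
  then obtain z where "z \<in> K" "\<forall>u\<in>K. u \<notin> elts z" by (auto simp: ax_Emptyset_def vmem_def)
  then show ?thesis using K_trans by (intro bexI[of _ z]) auto
qed

lemma k_infinity: "\<exists>I\<in>K. (\<exists>e\<in>elts I. elts e = {}) \<and> (\<forall>y\<in>elts I. \<exists>y'\<in>elts I. elts y' = insert y (elts y))"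
proof -
  obtain x where "x \<in> K" using K_ne by blast
  then have "sat K vmem (\<lambda>_. x) ax_Infinity" by (intro ax) (auto simp: M_theory_def M_minus_def)
  then have "\<exists>I\<in>K. (\<exists>e\<in>K. e \<in> elts I \<and> (\<forall>u\<in>K. u \<notin> elts e)) \<and>
    (\<forall>y\<in>K. y \<in> elts I \<longrightarrow> (\<exists>y'\<in>K. y' \<in> elts I \<and> (\<forall>u\<in>K. (u \<in> elts y' \<longrightarrow> u \<in> elts y \<or> u = y) \<and> 
      (u \<in> elts y \<or> u = y \<longrightarrow> u \<in> elts y'))))"
    by (simp add: ax_Infinity_def vmem_def)
  then show ?thesis
  proof (elim bexE conjE)
    fix I e assume I: "I \<in> K" and e: "e \<in> K" "e \<in> elts I" "\<forall>u\<in>K. u \<notin> elts e"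
      and suc: "\<forall>y\<in>K. y \<in> elts I \<longrightarrow> (\<exists>y'\<in>K. y' \<in> elts I \<and> (\<forall>u\<in>K. (u \<in> elts y' \<longrightarrow> u \<in> elts y \<or> u = y) \<and> 
        (u \<in> elts y \<or> u = y \<longrightarrow> u \<in> elts y')))"
    have "elts e = {}" using K_trans[OF e(1)] e(3) by blast
    then have "\<exists>e\<in>elts I. elts e = {}" using e(2) by blast
  moreover have "\<exists>y'\<in>elts I. elts y' = insert y (elts y)" if y: "y \<in> elts I" for y
  proof -
    have "y \<in> K" using K_trans[OF I] y by blast
    then obtain y' where "y' \<in> K" "y' \<in> elts I" "\<forall>u\<in>K. (u \<in> elts y' \<longrightarrow> u \<in> elts y \<or> u = y) \<and> 
      (u \<in> elts y \<or> u = y \<longrightarrow> u \<in> elts y')" using bspec[OF suc] y by blast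
    moreover have "elts y' = insert y (elts y)"
      using calculation(3) K_trans[OF calculation(1)] K_trans[OF \<open>y \<in> K\<close>] \<open>y \<in> K\<close> by blast
    ultimately show ?thesis by blast
  qed
    ultimately show "\<exists>I\<in>K. (\<exists>e\<in>elts I. elts e = {}) \<and> (\<forall>y\<in>elts I. \<exists>y'\<in>elts I. elts y' = insert y (elts y))"
      using I by blast
  qed
qed

lemma k_sep: 
  assumes "D0 {kk} (\<lambda>m s. \<Phi> m (s 0))" "w \<in> K"
  shows "\<exists>y\<in>K. elts y = {x \<in> elts w. \<Phi> kk x}"
proof -
  have "models (fst kk) (snd kk) (Separation Delta0)"
    using mods unfolding models_def M_theory_def M_minus_def by auto
  from sep_of_models[OF this assms(1)] assms(2) obtain y where "y \<in> K" "ext kk y = {x \<in> ext kk w. \<Phi> kk x}" by auto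
  then show ?thesis using assms(2) by (auto simp: ext_k)
qed

lemma k_coll:
  assumes "P1 {kk} (\<lambda>m s. \<Psi> m (s 0) (s 1))" "w \<in> K" "\<forall>x\<in>elts w. \<exists>y\<in>K. \<Psi> kk x y"
  shows "\<exists>c\<in>K. \<forall>x\<in>elts w. \<exists>y\<in>elts c. \<Psi> kk x y"
proof -
  have "models (fst kk) (snd kk) (Collection (levy_Pi 1))"
    using mods unfolding models_def by auto
  from coll_of_models[OF this assms(1), of w] assms(2,3) obtain c where "c \<in> K" "\<forall>x\<in>ext kk w. \<exists>y\<in>ext kk c. \<Psi> kk x y"
    by (auto simp: ext_k)
  then show ?thesis using assms(2) by (auto simp: ext_k)
qed

sublocale k0: setm0 kk
proof
  fix x y assume "x \<in> fst kk" "y \<in> fst kk" "ext kk x = ext kk y"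
  then show "x = y" by (auto simp: ext_k intro: V_ext)
next
  fix x y assume "x \<in> fst kk" "y \<in> fst kk"
  then show "\<exists>z\<in>fst kk. ext kk z = {x, y}" unfolding kex using k_pairing by simp
next
  fix x assume x: "x \<in> fst kk"
  then have "(\<Union>y\<in>ext kk x. ext kk y) = (\<Union>y\<in>elts x. elts y)" using ext_k K_trans by auto
  then show "\<exists>z\<in>fst kk. ext kk z = (\<Union>y\<in>ext kk x. ext kk y)" unfolding kex using k_union x by simp
next
  fix x assume x: "x \<in> fst kk" "ext kk x \<noteq> {}"
  then obtain y where "y \<in> elts x" by (auto simp: ext_k)
  then have "\<exists>y\<in>elts x. elts y \<inter> elts x = {}"
  proof (induction y rule: V_induct)
    case (step y) then show ?case by (cases "elts y \<inter> elts x = {}") blast+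
  qed
  then show "\<exists>y\<in>ext kk x. ext kk y \<inter> ext kk x = {}" using x K_trans by (auto simp: ext_k)
next
  fix \<Phi> :: "'a V str \<Rightarrow> 'a V \<Rightarrow> bool" and w
  assume "D0 {kk} (\<lambda>m s. \<Phi> m (s 0))" "w \<in> fst kk"
  then show "\<exists>y\<in>fst kk. ext kk y = {x \<in> ext kk w. \<Phi> kk x}"
    unfolding kex using k_sep[of \<Phi> w] by (simp add: ext_k)
next
  fix \<Psi> :: "'a V str \<Rightarrow> 'a V \<Rightarrow> 'a V \<Rightarrow> bool" and w
  assume *: "D0 {kk} (\<lambda>m s. \<Psi> m (s 0) (s 1))" "w \<in> fst kk" "\<forall>x\<in>ext kk w. \<exists>y\<in>fst kk. \<Psi> kk x y"
  then obtain c where "c \<in> K" "\<forall>x\<in>elts w. \<exists>y\<in>elts c. \<Psi> kk x y"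
    using k_coll[OF P1_D0[OF *(1)], of w] by (auto simp: ext_k)
  then show "\<exists>c\<in>fst kk. \<forall>x\<in>ext kk w. \<exists>y\<in>ext kk c. \<Psi> kk x y"
    using *(2) by (auto simp: ext_k)
next
  show "\<exists>z\<in>fst kk. ext kk z = {}" unfolding kex by (rule k_empty)
qed

lemma vset_K: "z \<in> K \<Longrightarrow> elts z = A \<Longrightarrow> vset A = z"
  using elts_vset[of A] small_elts[of z] V_ext by metis

lemma tmk: "c \<in> K \<Longrightarrow> tm {kk} (\<lambda>s. c)"
  by (rule tm_single) simp

text \<open>\<open>\<Delta>\<^sub>0\<close>-Separation on the powerset of a bound \<open>B\<close> yields least fixed points of monotone \<open>\<Delta>\<^sub>0\<close> operators.
  The set of numerals and the set of codes are obtained in this way.\<close>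

lemma fixpoint_ex:
  assumes B: "B \<in> K" and D: "D0 {kk} (\<lambda>m s. \<Gamma> m (s 0) (s 1))"
    and mono: "\<And>Z Z' c. Z \<in> K \<Longrightarrow> Z' \<in> K \<Longrightarrow> elts Z \<subseteq> elts Z' \<Longrightarrow> c \<in> K \<Longrightarrow> \<Gamma> kk Z c \<Longrightarrow> \<Gamma> kk Z' c"
  shows "\<exists>L\<in>K. elts L = {c \<in> elts B. \<Gamma> kk L c}"
proof -
  obtain P where P: "P \<in> K" "elts P = {y \<in> K. elts y \<subseteq> elts B}" using k_power[OF B] by blast
  note D2 = rep_term2[OF D]
  have D3: "D0 {kk} (\<lambda>m s. \<forall>Z\<in>ext m P. (\<forall>c\<in>ext m B. \<Gamma> m Z c \<longrightarrow> c \<in> ext m Z) \<longrightarrow> s 0 \<in> ext m Z)"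
    by (intro D0_intros D2 tmk tm_intros renc P(1) B)
  obtain L where L: "L \<in> K" "elts L = {x \<in> elts B. \<forall>Z\<in>ext kk P. (\<forall>c\<in>ext kk B. \<Gamma> kk Z c \<longrightarrow> c \<in> ext kk Z) \<longrightarrow> x \<in> ext kk Z}"
    using k_sep[where \<Phi> = "\<lambda>m x. \<forall>Z\<in>ext m P. (\<forall>c\<in>ext m B. \<Gamma> m Z c \<longrightarrow> c \<in> ext m Z) \<longrightarrow> x \<in> ext m Z", OF D3 B] by blast
  have extZ: "ext kk Z = elts Z" if "Z \<in> elts P" for Z using that P ext_k by auto
  have L': "elts L = {x \<in> elts B. \<forall>Z\<in>elts P. (\<forall>c\<in>elts B. \<Gamma> kk Z c \<longrightarrow> c \<in> elts Z) \<longrightarrow> x \<in> elts Z}"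
    unfolding L(2) ext_k[OF P(1)] ext_k[OF B] using extZ by simp
  have 1: "c \<in> elts L" if "c \<in> elts B" "\<Gamma> kk L c" for c
  proof -
    have "c \<in> elts Z" if Z: "Z \<in> elts P" "\<forall>c\<in>elts B. \<Gamma> kk Z c \<longrightarrow> c \<in> elts Z" for Z
    proof -
      have "elts L \<subseteq> elts Z" using Z unfolding L' by blast
      then have "\<Gamma> kk Z c" using mono[of L Z c] L(1) Z(1) P(2) K_trans[OF B \<open>c \<in> elts B\<close>] \<open>\<Gamma> kk L c\<close> by blast
      then show ?thesis using Z(2) \<open>c \<in> elts B\<close> by blast
    qed
    then show ?thesis unfolding L' using that(1) by blast
  qed
  have "D0 {kk} (\<lambda>m s. \<Gamma> m L (s 0))" by (intro D2 tmk tm_intros renc L(1))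
  from k_sep[where \<Phi> = "\<lambda>m x. \<Gamma> m L x", OF this L(1)] obtain L2 where L2: "L2 \<in> K" "elts L2 = {x \<in> elts L. \<Gamma> kk L x}"
    by blast
  have "L2 \<in> elts P" using L2 L' P(2) by blast
  moreover have "c \<in> elts L2" if "c \<in> elts B" "\<Gamma> kk L2 c" for c
  proof -
    have "\<Gamma> kk L c" using mono[of L2 L c] L2 L(1) that K_trans[OF B] by blast
    then show ?thesis using 1 that(1) L2(2) by blast
  qed
  ultimately have "elts L \<subseteq> elts L2" unfolding L' by blast
  then have "elts L = {c \<in> elts B. \<Gamma> kk L c}" using 1 L2(2) L' by blast
  then show ?thesis using L(1) by blast
qed

text \<open>The least set containing the empty set and closed under successor consists of true numerals, because \<open>K\<close> is well-founded.\<close>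

lemma W_ex: "(\<forall>n. vnum n \<in> K \<and> ext kk (vnum 0) = {} \<and> ext kk (vnum (Suc n)) = insert (vnum n) (ext kk (vnum n))) \<and>
  (\<exists>W\<in>K. elts W = range vnum)"
proof -
  obtain I where I: "I \<in> K" "\<exists>e\<in>elts I. elts e = {}" "\<forall>y\<in>elts I. \<exists>y'\<in>elts I. elts y' = insert y (elts y)"
    using k_infinity by blast
  have n: "vnum n \<in> elts I \<and> elts (vnum 0 :: 'a V) = {} \<and> elts (vnum (Suc n) :: 'a V) = insert (vnum n) (elts (vnum n))" for n
  proof (induction n)
    case 0
    obtain e where e: "e \<in> elts I" "elts e = {}" using I(2) by blast
    then have "vnum 0 = e" using vset_K[of e] K_trans[OF I(1)] by simp
    moreover obtain e' where e': "e' \<in> elts I" "elts e' = insert e (elts e)" using I(3) e(1) by blast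
    moreover have "vnum (Suc 0) = e'"
      using vset_K[of e'] K_trans[OF I(1)] calculation by (simp only: vnum.simps(2))
    ultimately show ?case using e by (simp del: vnum.simps)
  next
    case (Suc n)
    have "vnum (Suc n) \<in> elts I"
    proof -
      obtain e' where e': "e' \<in> elts I" "elts e' = insert (vnum n) (elts (vnum n))" using I(3) Suc by blast
      then have "vnum (Suc n) = e'" using vset_K[of e'] K_trans[OF I(1)] by simp
      then show ?thesis using e' by simp
    qed
    moreover obtain e' where e': "e' \<in> elts I" "elts e' = insert (vnum (Suc n)) (elts (vnum (Suc n)))" using I(3) calculation by blast
    moreover have "vnum (Suc (Suc n)) = e'" using vset_K[of e'] K_trans[OF I(1)] e' by simp
    ultimately show ?case using Suc by simp
  qed
  have nK: "vnum n \<in> K" for n using n K_trans[OF I(1)] by blast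
  have "D0 {kk} (\<lambda>m s. emp m (s 1) \<or> (\<exists>y\<in>ext m (s 0). suc m (s 1) y))"
    by (intro D0_intros D0_rels tm_intros)
  then have "\<exists>W\<in>K. elts W = {c \<in> elts I. emp kk c \<or> (\<exists>y\<in>ext kk W. suc kk c y)}"
    by (rule fixpoint_ex[OF I(1)]) (auto simp: ext_k)
  then obtain W where W: "W \<in> K" "elts W = {c \<in> elts I. ext kk c = {} \<or> (\<exists>y\<in>ext kk W. ext kk c = insert y (ext kk y))}"
    by (auto simp: k0.suc_iff)
  have W2: "c \<in> elts W \<longleftrightarrow> c \<in> elts I \<and> (ext kk c = {} \<or> (\<exists>y\<in>elts W. ext kk c = insert y (ext kk y)))" for c
  proof -
    have eq: "elts W = {c \<in> elts I. ext kk c = {} \<or> (\<exists>y\<in>elts W. ext kk c = insert y (ext kk y))}"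
      using W(2) unfolding ext_k[OF W(1)] .
    show ?thesis by (subst eq) (rule mem_Collect_eq)
  qed
  have "vnum n \<in> elts W" for n
  proof (induction n)
    case 0 show ?case using n[of 0] ext_k[OF nK[of 0]] W2[of "vnum 0"] by simp
  next
    case (Suc k)
    have "ext kk (vnum (Suc k)) = insert (vnum k) (ext kk (vnum k))" using n[of k] nK ext_k by (simp del: vnum.simps)
    then show ?case using n[of "Suc k"] Suc W2[of "vnum (Suc k)"] by blast
  qed
  moreover have "c \<in> range vnum" if "c \<in> elts W" for c
    using that
  proof (induction c rule: V_induct)
    case (step c)
    then have cK: "c \<in> K" using K_trans[OF W(1)] by blast
    consider "ext kk c = {}" | y where "y \<in> elts W" "ext kk c = insert y (ext kk y)"
      using step.prems W2[of c] by blast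
    then show ?case
    proof cases
      case 1
      then have "elts c = elts (vnum 0)" using n[of 0] ext_k cK by simp
      then show ?thesis using V_ext by blast
    next
      case 2
      then have yK: "y \<in> K" using K_trans[OF W(1)] by blast
      then have ec: "elts c = insert y (elts y)" using 2 ext_k cK by simp
      then obtain k where "y = vnum k" using step.IH[of y] 2(1) by blast
      then have "elts c = elts (vnum (Suc k))" using n[of k] ec by simp
      then show ?thesis using V_ext by blast
    qed
  qed
  ultimately have "elts W = range vnum" by blast
  moreover have "ext kk (vnum k) = elts (vnum k)" for k by (rule ext_k[OF nK])
  ultimately show ?thesis using n nK W(1) by (simp del: vnum.simps) blast
qed

definition W :: "'a V" where "W = vset (range vnum)"

lemma W: "W \<in> K" "elts W = range vnum"
proof -
  obtain w where w: "w \<in> K" "elts w = range vnum" using W_ex by blast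
  then have "W = w" unfolding W_def by (intro vset_K)
  then show "W \<in> K" "elts W = range vnum" using w by simp_all
qed

declare vnum.simps [simp del]

sublocale k: setm kk vnum W
proof
  show "vnum n \<in> fst kk" "ext kk (vnum 0) = {}" "ext kk (vnum (Suc n)) = insert (vnum n) (ext kk (vnum n))" for n
    using W_ex by simp_all
  show "W \<in> fst kk" "ext kk W = range vnum" using W ext_k by simp_all
qed

lemma prod_ex:
  assumes "x \<in> K" "y \<in> K" shows "\<exists>z\<in>K. elts z = {k0.pr a b | a b. a \<in> elts x \<and> b \<in> elts y}"
proof -
  obtain u where u: "u \<in> K" "elts u = elts x \<union> elts y" using k0.un_ex[of x y] assms by (auto simp: ext_k)
  obtain P where P: "P \<in> K" "elts P = {y \<in> K. elts y \<subseteq> elts u}" using k_power[OF u(1)] by blast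
  obtain Q where Q: "Q \<in> K" "elts Q = {y \<in> K. elts y \<subseteq> elts P}" using k_power[OF P(1)] by blast
  have "D0 {kk} (\<lambda>m s. \<exists>a\<in>ext m x. \<exists>b\<in>ext m y. opr m (s 0) a b)"
    by (intro D0_intros D0_rels tmk tm_intros assms)
  from k_sep[where \<Phi> = "\<lambda>m z. \<exists>a\<in>ext m x. \<exists>b\<in>ext m y. opr m z a b", OF this Q(1)] obtain z where
    z: "z \<in> K" "elts z = {z \<in> elts Q. \<exists>a\<in>ext kk x. \<exists>b\<in>ext kk y. opr kk z a b}" by blast
  have ab: "a \<in> K" "b \<in> K" if "a \<in> elts x" "b \<in> elts y" for a b using that assms K_trans by blast+
  have "k0.pr a b \<in> elts Q" if a: "a \<in> elts x" "b \<in> elts y" for a b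
  proof -
    have p: "k0.pr a b \<in> K" "opr kk (k0.pr a b) a b" using k0.opr_pr[of a b] ab[OF a] by auto
    then obtain v w where vw: "v \<in> elts (k0.pr a b)" "w \<in> elts (k0.pr a b)" "ext kk v = {a}" "ext kk w = {a,b}" "elts (k0.pr a b) = {v,w}"
      unfolding opr_def k0.upr_iff by (auto simp: ext_k)
    have "v \<in> K" "w \<in> K" using vw(1,2) p(1) K_trans by blast+
    then have "v \<in> elts P" "w \<in> elts P" unfolding P(2) u(2) using vw(3,4) a by (auto simp: ext_k)
    then show ?thesis unfolding Q(2) using vw(5) p(1) by simp
  qed
  then have "elts z = {k0.pr a b | a b. a \<in> elts x \<and> b \<in> elts y}"
  proof -
    have "opr kk v a b \<longleftrightarrow> v = k0.pr a b" if "v \<in> elts Q" "a \<in> elts x" "b \<in> elts y" for v a b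
      using k0.opr_iff[of a b v] ab[OF that(2,3)] K_trans[OF Q(1) that(1)] by simp
    then show ?thesis unfolding z(2) ext_k[OF assms(1)] ext_k[OF assms(2)]
      using \<open>\<And>a b. a \<in> elts x \<Longrightarrow> b \<in> elts y \<Longrightarrow> k0.pr a b \<in> elts Q\<close> by blast
  qed
  then show ?thesis using z(1) by blast
qed

end

section \<open>Codes and satisfaction relations in the standard model\<close>

primrec subs :: "dfm \<Rightarrow> dfm set" where
  "subs (DMem i j) = {DMem i j}"
| "subs (DEq i j) = {DEq i j}"
| "subs (DNand d e) = insert (DNand d e) (subs d \<union> subs e)"
| "subs (DEx d) = insert (DEx d) (subs d)"

lemma subs_self: "d \<in> subs d" by (cases d) auto

lemma subs_closed: "(DNand a b \<in> subs d \<longrightarrow> a \<in> subs d \<and> b \<in> subs d) \<and> (DEx a \<in> subs d \<longrightarrow> a \<in> subs d)"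
  by (induction d) (auto simp: subs_self)

lemma finite_subs: "finite (subs d)" by (induction d) auto

context kmod
begin

text \<open>A bound for the set of codes: the numerals are closed off under pairing by iterating the
  step from \<open>x\<close> to \<open>x\<close> together with all unordered pairs over \<open>x\<close>.\<close>

lemma B_ex: "\<exists>B\<in>K. elts W \<subseteq> elts B \<and> (\<forall>a\<in>elts B. \<forall>b\<in>elts B. k0.pr a b \<in> elts B)"
proof -
  define \<psi> where "\<psi> m x y w \<longleftrightarrow> (\<forall>u\<in>ext m x. u \<in> ext m y) \<and> (\<forall>u\<in>ext m x. \<forall>v\<in>ext m x. \<exists>p\<in>ext m y. upr m p u v) \<and>
     (\<forall>p\<in>ext m y. p \<in> ext m x \<or> (\<exists>u\<in>ext m x. \<exists>v\<in>ext m x. upr m p u v))" for m :: "'a V str" and x y w :: "'a V"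
  have D: "D0 {kk} (\<lambda>m s. \<psi> m (s 0) (s 1) (s 2))"
    unfolding \<psi>_def by (intro D0_intros D0_rels tm_intros)
  have tot: "\<exists>y\<in>K. \<psi> kk x y y" if x: "x \<in> K" for x
  proof -
    obtain P where P: "P \<in> K" "elts P = {y \<in> K. elts y \<subseteq> elts x}" using k_power[OF x] by blast
    have "D0 {kk} (\<lambda>m s. \<exists>u\<in>ext m x. \<exists>v\<in>ext m x. upr m (s 0) u v)"
      by (intro D0_intros D0_rels tmk tm_intros x)
    from k_sep[where \<Phi> = "\<lambda>m p. \<exists>u\<in>ext m x. \<exists>v\<in>ext m x. upr m p u v", OF this P(1)] obtain z where
      z: "z \<in> K" "elts z = {p \<in> elts P. \<exists>u\<in>ext kk x. \<exists>v\<in>ext kk x. upr kk p u v}" by blast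
    obtain y where y: "y \<in> K" "elts y = elts x \<union> elts z" using k0.un_ex[of x z] x z(1) by (auto simp: ext_k)
    have "\<exists>p\<in>elts y. upr kk p u v" if uv: "u \<in> elts x" "v \<in> elts x" for u v
    proof -
      have uvK: "u \<in> K" "v \<in> K" using uv K_trans[OF x] by auto
      then obtain p where p: "p \<in> K" "elts p = {u, v}" using k_pairing by blast
      then have "p \<in> elts P" "upr kk p u v" using P(2) uv by (auto simp: k0.upr_iff ext_k)
      then show ?thesis using y(2) z(2) uv ext_k[OF x] by blast
    qed
    then have "\<psi> kk x y y" unfolding \<psi>_def ext_k[OF x] ext_k[OF y(1)] using y(2) z(2) ext_k[OF x] by auto
    then show ?thesis using y(1) by blast
  qed
  then obtain f where f: "\<And>x. x \<in> K \<Longrightarrow> f x \<in> K \<and> \<psi> kk x (f x) (f x)" by metis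
  define x where "x n = (f ^^ n) W" for n
  have xK: "x n \<in> K" for n by (induction n) (use W f in \<open>auto simp: x_def\<close>)
  have xs: "\<psi> kk (x n) (x (Suc n)) (x 0)" for n using f[OF xK[of n]] by (simp add: x_def \<psi>_def)
  have char: "elts y = elts a \<union> {p \<in> K. \<exists>u\<in>elts a. \<exists>v\<in>elts a. elts p = {u, v}}"
    if *: "\<psi> kk a y w" "a \<in> K" "y \<in> K" for a y w
  proof -
    have upr: "upr kk p u v \<longleftrightarrow> elts p = {u, v}" if "p \<in> K" for p u v
      using that by (simp add: k0.upr_iff ext_k)
    have 1: "elts a \<subseteq> elts y" and 2: "\<forall>u\<in>elts a. \<forall>v\<in>elts a. \<exists>p\<in>elts y. upr kk p u v"
      and 3: "\<forall>p\<in>elts y. p \<in> elts a \<or> (\<exists>u\<in>elts a. \<exists>v\<in>elts a. upr kk p u v)"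
      using *(1) unfolding \<psi>_def ext_k[OF *(2)] ext_k[OF *(3)] by blast+
    have A: "p \<in> elts y" if p: "p \<in> K" "u \<in> elts a" "v \<in> elts a" "elts p = {u, v}" for p u v
    proof -
      obtain p' where p': "p' \<in> elts y" "upr kk p' u v" using 2 p by blast
      then have "elts p' = elts p" using upr[of p'] K_trans[OF *(3)] p(4) by simp
      then show ?thesis using p'(1) V_ext by blast
    qed
    have B: "p \<in> elts a \<or> (\<exists>u\<in>elts a. \<exists>v\<in>elts a. elts p = {u, v})" if "p \<in> elts y" for p
      using bspec[OF 3 that] unfolding upr[OF K_trans[OF *(3) that]] .
    show ?thesis
    proof (intro equalityI subsetI)
      fix p assume p: "p \<in> elts y"
      show "p \<in> elts a \<union> {p \<in> K. \<exists>u\<in>elts a. \<exists>v\<in>elts a. elts p = {u, v}}"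
        using B[OF p] K_trans[OF *(3) p] by simp
    next
      fix p assume "p \<in> elts a \<union> {p \<in> K. \<exists>u\<in>elts a. \<exists>v\<in>elts a. elts p = {u, v}}"
      then consider "p \<in> elts a" | u v where "p \<in> K" "u \<in> elts a" "v \<in> elts a" "elts p = {u, v}" by blast
      then show "p \<in> elts y" using 1 A by cases blast+
    qed
  qed
  have st: "\<exists>w\<in>fst kk. \<psi> kk (x i) (x (Suc i)) w" for i using xs xK[of 0] by auto
  have fu: "y = x (Suc i)" if that: "y \<in> fst kk" "w \<in> fst kk" "\<psi> kk (x i) y w" for i y w
  proof -
    have "y \<in> K" using that by simp
    then have "elts y = elts (x (Suc i))" using char[OF that(3) xK] char[OF xs[of i] xK xK] by simp
    then show ?thesis by (rule V_ext)
  qed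
  \<comment> \<open>The step relation needs no auxiliary set, so its last argument is a dummy.\<close>
  have "\<exists>Z\<in>fst kk. ext kk Z = range x"
  proof (rule k.omega_rec[where \<psi> = \<psi> and x = x])
    show "D0 {kk} (\<lambda>m s. \<psi> m (s 0) (s 1) (s 2))" by (rule D)
    show "x i \<in> fst kk" for i using xK by simp
    show "\<exists>w\<in>fst kk. \<psi> kk (x i) (x (Suc i)) w" for i by (rule st)
    show "y = x (Suc i)" if "y \<in> fst kk" "w \<in> fst kk" "\<psi> kk (x i) y w" for i y w by (rule fu[OF that])
  qed
  then obtain Z where Z: "Z \<in> K" "elts Z = range x" unfolding kex by blast
  obtain B where B: "B \<in> K" "elts B = (\<Union>y\<in>elts Z. elts y)" using k_union[OF Z(1)] by blast
  have mono1: "elts (x n) \<subseteq> elts (x (Suc n))" for n using xs[of n] ext_k[OF xK] unfolding \<psi>_def by auto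
  have mono: "elts (x n) \<subseteq> elts (x m)" if "n \<le> m" for n m
    using that mono1 by (rule lift_Suc_mono_le[of "\<lambda>n. elts (x n)", rotated])
  have pair: "\<exists>p\<in>elts (x (Suc n)). upr kk p u v" if "u \<in> elts (x n)" "v \<in> elts (x n)" for n u v
    using xs[of n] that ext_k[OF xK] unfolding \<psi>_def by auto
  have "k0.pr a b \<in> elts B" if ab: "a \<in> elts B" "b \<in> elts B" for a b
  proof -
    obtain i j where "a \<in> elts (x i)" "b \<in> elts (x j)" using ab B(2) Z(2) by auto
    then have n: "a \<in> elts (x (max i j))" "b \<in> elts (x (max i j))" using mono[of i "max i j"] mono[of j "max i j"] by auto
    obtain p q where pq: "p \<in> elts (x (Suc (max i j)))" "upr kk p a a" "q \<in> elts (x (Suc (max i j)))" "upr kk q a b"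
      using pair[OF n(1) n(1)] pair[OF n] by blast
    obtain r where r: "r \<in> elts (x (Suc (Suc (max i j))))" "upr kk r p q" using pair[OF pq(1,3)] by blast
    have "opr kk r a b" unfolding opr_def using pq r(2) k0.upr_iff[of r] by blast
    moreover have "a \<in> K" "b \<in> K" "r \<in> K" using ab K_trans[OF B(1)] K_trans[OF xK r(1)] by auto
    ultimately have "r = k0.pr a b" using k0.opr_iff[of a b r] by simp
    then show ?thesis using r(1) B(2) Z(2) by blast
  qed
  moreover have "elts W \<subseteq> elts B" using B(2) Z(2) by (auto simp: x_def intro!: exI[of _ 0])
  ultimately show ?thesis using B(1) by blast
qed

text \<open>Components of a pair come before the pair in the well-founded order, which makes induction on codes possible.\<close>

lemma pr_below:
  assumes "a \<in> K" "b \<in> K"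
  shows "(a, k0.pr a b) \<in> {(x, y). vmem x y}\<^sup>+" "(b, k0.pr a b) \<in> {(x, y). vmem x y}\<^sup>+"
proof -
  have p: "k0.pr a b \<in> K" "opr kk (k0.pr a b) a b" using k0.opr_pr[of a b] assms by auto
  then obtain v where v: "v \<in> elts (k0.pr a b)" "ext kk v = {a,b}"
    unfolding opr_def k0.upr_iff by (auto simp: ext_k)
  then have "v \<in> K" using K_trans p by blast
  then have "elts v = {a, b}" using v ext_k by simp
  then show "(a, k0.pr a b) \<in> {(x, y). vmem x y}\<^sup>+" "(b, k0.pr a b) \<in> {(x, y). vmem x y}\<^sup>+"
    using v(1) by (auto simp: vmem_def intro!: trancl_trans[OF r_into_trancl r_into_trancl, of _ v])
qed

lemma Cd_ex: "\<exists>L\<in>K. elts L = range k.code"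
proof -
  obtain B where B: "B \<in> K" "elts W \<subseteq> elts B" "\<And>a b. a \<in> elts B \<Longrightarrow> b \<in> elts B \<Longrightarrow> k0.pr a b \<in> elts B"
    using B_ex by blast
  define \<Gamma> where "\<Gamma> m Z c \<longleftrightarrow> (\<exists>i\<in>ext m W. \<exists>j\<in>ext m W. trip m c 0 i j \<or> trip m c 1 i j) \<or>
    (\<exists>c1\<in>ext m Z. \<exists>c2\<in>ext m Z. trip m c 2 c1 c2) \<or> (\<exists>c1\<in>ext m Z. trip m c 3 c1 c1)" for m :: "'a V str" and Z c
  have D: "D0 {kk} (\<lambda>m s. \<Gamma> m (s 0) (s 1))"
    unfolding \<Gamma>_def by (intro D0_intros D0_rels tmk tm_intros W(1))
  have "\<exists>L\<in>K. elts L = {c \<in> elts B. \<Gamma> kk L c}"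
    by (rule fixpoint_ex[OF B(1) D]) (unfold \<Gamma>_def, auto simp: ext_k)
  then obtain L where L: "L \<in> K" "elts L = {c \<in> elts B. \<Gamma> kk L c}" by blast
  have cB: "k.code d \<in> elts B" for d
    by (induction d) (use B W in \<open>auto intro!: B(3)\<close>)
  have WK: "vnum i \<in> ext kk W" for i using k.W_ext by auto
  have "k.code d \<in> elts L" for d
  proof (induction d)
    case (DMem i j)
    have "trip kk (k.code (DMem i j)) 0 (vnum i) (vnum j)" using k.trip_iff[of "k.code (DMem i j)" "vnum i" "vnum j" 0] k.code_car[of "DMem i j"] k.num_car by simp
    then show ?case unfolding L(2) \<Gamma>_def using cB[of "DMem i j"] WK by blast
  next
    case (DEq i j)
    have "trip kk (k.code (DEq i j)) 1 (vnum i) (vnum j)" using k.trip_iff[of "k.code (DEq i j)" "vnum i" "vnum j" 1] k.code_car[of "DEq i j"] k.num_car by simp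
    then show ?case unfolding L(2) \<Gamma>_def using cB[of "DEq i j"] WK by blast
  next
    case (DNand d e)
    have "trip kk (k.code (DNand d e)) 2 (k.code d) (k.code e)" using k.trip_iff[of "k.code (DNand d e)" "k.code d" "k.code e" 2] k.code_car[of "DNand d e"] k.code_car[of d] k.code_car[of e] by simp
    then show ?case unfolding L(2) \<Gamma>_def using cB[of "DNand d e"] DNand ext_k[OF L(1)] L(2) by blast
  next
    case (DEx d)
    have "trip kk (k.code (DEx d)) 3 (k.code d) (k.code d)" using k.trip_iff[of "k.code (DEx d)" "k.code d" "k.code d" 3] k.code_car[of "DEx d"] k.code_car[of d] by simp
    then show ?case unfolding L(2) \<Gamma>_def using cB[of "DEx d"] DEx ext_k[OF L(1)] L(2) by blast
  qed
  moreover have "c \<in> range k.code" if "c \<in> elts L" for c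
    using that
  proof (induction c rule: V_trancl_induct)
    case (1 c)
    have cK: "c \<in> K" using 1 K_trans[OF L(1)] by blast
    have below: "(a, c) \<in> {(x, y). vmem x y}\<^sup>+" "(b, c) \<in> {(x, y). vmem x y}\<^sup>+"
      if "trip kk c k a b" "a \<in> elts L" "b \<in> elts L" for a b k
    proof -
      have ab: "a \<in> K" "b \<in> K" using that K_trans[OF L(1)] by auto
      then have "c = k0.pr (vnum k) (k0.pr a b)" using k.trip_iff[of c a b k] that cK by simp
      then show "(a, c) \<in> {(x, y). vmem x y}\<^sup>+" "(b, c) \<in> {(x, y). vmem x y}\<^sup>+"
        using pr_below[OF ab] pr_below(2)[of "vnum k" "k0.pr a b"] k.num_car[of k] k0.pr_car[of a b] ab
        by (auto intro: trancl_trans)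
    qed
    have "\<Gamma> kk L c" using 1(2) L(2) by blast
    then consider i j where "trip kk c 0 (vnum i) (vnum j)" | i j where "trip kk c 1 (vnum i) (vnum j)"
      | c1 c2 where "c1 \<in> elts L" "c2 \<in> elts L" "trip kk c 2 c1 c2" | c1 where "c1 \<in> elts L" "trip kk c 3 c1 c1"
      unfolding \<Gamma>_def ext_k[OF L(1)] k.W_ext by blast
    then show ?case
    proof cases
      case (1 i j)
      then have "c = k.code (DMem i j)" using k.trip_iff cK k.num_car by simp
      then show ?thesis by blast
    next
      case (2 i j)
      then have "c = k.code (DEq i j)" using k.trip_iff cK k.num_car by simp
      then show ?thesis by blast
    next
      case (3 c1 c2)
      obtain d e where "c1 = k.code d" "c2 = k.code e" using 1(1)[OF below(1)[OF 3(3,1,2)] 3(1)] 1(1)[OF below(2)[OF 3(3,1,2)] 3(2)] by blast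
      then have "c = k.code (DNand d e)" using 3(3) k.trip_iff cK k.code_car by simp
      then show ?thesis by blast
    next
      case (4 c1)
      obtain d where "c1 = k.code d" using 1(1)[OF below(1)[OF 4(2,1,1)] 4(1)] by blast
      then have "c = k.code (DEx d)" using 4(2) k.trip_iff cK k.code_car by simp
      then show ?thesis by blast
    qed
  qed
  ultimately have "elts L = range k.code" by blast
  then show ?thesis using L(1) by blast
qed

definition Cd :: "'a V" where "Cd = vset (range k.code)"

lemma Cd: "Cd \<in> K" "elts Cd = range k.code"
proof -
  obtain w where w: "w \<in> K" "elts w = range k.code" using Cd_ex by blast
  then have "Cd = w" unfolding Cd_def by (intro vset_K)
  then show "Cd \<in> K" "elts Cd = range k.code" using w by simp_all
qed

sublocale k: setc kk vnum W Cd
  by unfold_locales (use Cd ext_k in auto)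

lemma E_ex: assumes U: "U \<in> K" shows "\<exists>E\<in>K. ext kk E = k.sq ` lists (elts U)"
proof -
  obtain X where X: "X \<in> K" "elts X = {k0.pr a b | a b. a \<in> elts W \<and> b \<in> elts U}"
    using prod_ex[OF W(1) U] by blast
  obtain P where P: "P \<in> K" "elts P = {y \<in> K. elts y \<subseteq> elts X}" using k_power[OF X(1)] by blast
  have "D0 {kk} (\<lambda>m s. \<exists>n\<in>ext m W. fn m (s 0) n U)"
    by (intro D0_intros D0_rels tmk tm_intros U W)
  from k_sep[where \<Phi> = "\<lambda>m e. \<exists>n\<in>ext m W. fn m e n U", OF this P(1)] obtain E where
    E: "E \<in> K" "elts E = {e \<in> elts P. \<exists>n\<in>ext kk W. fn kk e n U}" by blast
  have "e \<in> k.sq ` lists (elts U)" if e: "e \<in> elts E" for e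
  proof -
    have "e \<in> K" using that K_trans[OF E(1)] by blast
    moreover obtain n where "fn kk e (vnum n) U" using e unfolding E(2) k.W_ext by blast
    ultimately show ?thesis using k.fn_list[of e U n] U ext_k[OF U] by (auto simp: lists_eq_set)
  qed
  moreover have "k.sq xs \<in> elts E" if xs: "set xs \<subseteq> elts U" for xs
  proof -
    have xK: "set xs \<subseteq> fst kk" using xs K_trans[OF U] by auto
    have "fn kk (k.sq xs) (vnum (length xs)) U" using k.fn_sq[of xs U] xs ext_k[OF U] by simp
    moreover have "k.sq xs \<in> K" using k.sq_car[OF xK] by simp
    moreover have "elts (k.sq xs) \<subseteq> elts X"
    proof
      fix z assume "z \<in> elts (k.sq xs)"
      then obtain i where "i < length xs" "z = k0.pr (vnum i) (xs ! i)"
        using k.sq_ext[OF xK] ext_k[OF \<open>k.sq xs \<in> K\<close>] by auto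
      then show "z \<in> elts X" using X(2) W(2) xs nth_mem by blast
    qed
    ultimately show ?thesis unfolding E(2) P(2) k.W_ext by blast
  qed
  ultimately have "elts E = k.sq ` lists (elts U)" by (auto simp: lists_eq_set)
  then show ?thesis using E(1) ext_k by auto
qed

lemma slice_eq:
  assumes "ext kk E = k.sq ` lists (elts U)" "E \<in> K" "elts A = {e \<in> elts E. P e}"
    "\<And>xs. set xs \<subseteq> elts U \<Longrightarrow> P (k.sq xs) \<longleftrightarrow> Q xs"
  shows "elts A = {k.sq xs | xs. set xs \<subseteq> elts U \<and> Q xs}"
proof -
  have E: "elts E = {k.sq xs | xs. set xs \<subseteq> elts U}"
    using assms(1) unfolding ext_k[OF assms(2)] lists_eq_set by auto
  show ?thesis
  proof (intro equalityI subsetI)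
    fix e assume "e \<in> elts A"
    then obtain xs where "e = k.sq xs" "set xs \<subseteq> elts U" "P (k.sq xs)" using assms(3) E by auto
    then show "e \<in> {k.sq xs | xs. set xs \<subseteq> elts U \<and> Q xs}" using assms(4)[of xs] by blast
  next
    fix e assume "e \<in> {k.sq xs | xs. set xs \<subseteq> elts U \<and> Q xs}"
    then obtain xs where *: "e = k.sq xs" "set xs \<subseteq> elts U" "Q xs" by blast
    then have "e \<in> elts E" "P e" using E assms(4)[of xs] by auto
    then show "e \<in> elts A" using assms(3) by simp
  qed
qed

text \<open>For each formula its extension over \<open>U\<close> is a set of \<open>K\<close>; the induction on formulae takes place outside \<open>K\<close>.\<close>

lemma slice_ex:
  assumes U: "U \<in> K" and E: "E \<in> K" "ext kk E = k.sq ` lists (elts U)"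
  shows "\<exists>A\<in>K. elts A = {k.sq xs | xs. set xs \<subseteq> elts U \<and> dsat (elts U) vmem d xs}"
proof (induction d)
  case (DMem i j)
  have eU: "ext kk U = elts U" by (rule ext_k[OF U])
  have "D0 {kk} (\<lambda>m s. \<exists>a\<in>ext m U. \<exists>b\<in>ext m U. inP m (s 0) (vnum i) a \<and> inP m (s 0) (vnum j) b \<and> a \<in> ext m b)"
    by (intro D0_intros D0_rels tmk tm_intros U) (use k.num_car in auto)
  from k_sep[where \<Phi> = "\<lambda>m e. \<exists>a\<in>ext m U. \<exists>b\<in>ext m U. inP m e (vnum i) a \<and> inP m e (vnum j) b \<and> a \<in> ext m b", OF this E(1)]
  obtain A where A: "A \<in> K" "elts A = {e \<in> elts E. \<exists>a\<in>ext kk U. \<exists>b\<in>ext kk U. inP kk e (vnum i) a \<and> inP kk e (vnum j) b \<and> a \<in> ext kk b}" by blast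
  have "(\<exists>a\<in>ext kk U. \<exists>b\<in>ext kk U. inP kk (k.sq xs) (vnum i) a \<and> inP kk (k.sq xs) (vnum j) b \<and> a \<in> ext kk b)
     \<longleftrightarrow> dsat (elts U) vmem (DMem i j) xs" if xs: "set xs \<subseteq> elts U" for xs
  proof -
    have xK: "set xs \<subseteq> fst kk" using xs K_trans[OF U] by auto
    have "(\<exists>a\<in>elts U. \<exists>b\<in>elts U. inP kk (k.sq xs) (vnum i) a \<and> inP kk (k.sq xs) (vnum j) b \<and> a \<in> ext kk b) \<longleftrightarrow>
      (\<exists>a\<in>elts U. \<exists>b\<in>elts U. (i < length xs \<and> xs ! i = a) \<and> (j < length xs \<and> xs ! j = b) \<and> a \<in> elts b)"
      using k.inP_sq[OF xK] K_trans[OF U] ext_k by (intro bex_cong) auto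
    then show ?thesis unfolding eU using xs nth_mem[of i xs] nth_mem[of j xs] by (auto simp: vmem_def)
  qed
  from slice_eq[OF E(2,1) A(2) this] show ?case using A(1) by blast
next
  case (DEq i j)
  have eU: "ext kk U = elts U" by (rule ext_k[OF U])
  have "D0 {kk} (\<lambda>m s. \<exists>a\<in>ext m U. inP m (s 0) (vnum i) a \<and> inP m (s 0) (vnum j) a)"
    by (intro D0_intros D0_rels tmk tm_intros U) (use k.num_car in auto)
  from k_sep[where \<Phi> = "\<lambda>m e. \<exists>a\<in>ext m U. inP m e (vnum i) a \<and> inP m e (vnum j) a", OF this E(1)]
  obtain A where A: "A \<in> K" "elts A = {e \<in> elts E. \<exists>a\<in>ext kk U. inP kk e (vnum i) a \<and> inP kk e (vnum j) a}" by blast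
  have "(\<exists>a\<in>ext kk U. inP kk (k.sq xs) (vnum i) a \<and> inP kk (k.sq xs) (vnum j) a)
     \<longleftrightarrow> dsat (elts U) vmem (DEq i j) xs" if xs: "set xs \<subseteq> elts U" for xs
  proof -
    have xK: "set xs \<subseteq> fst kk" using xs K_trans[OF U] by auto
    have "(\<exists>a\<in>elts U. inP kk (k.sq xs) (vnum i) a \<and> inP kk (k.sq xs) (vnum j) a) \<longleftrightarrow>
      (\<exists>a\<in>elts U. (i < length xs \<and> xs ! i = a) \<and> (j < length xs \<and> xs ! j = a))"
      using k.inP_sq[OF xK] K_trans[OF U] ext_k by (intro bex_cong) auto
    then show ?thesis unfolding eU using xs nth_mem[of i xs] by auto
  qed
  from slice_eq[OF E(2,1) A(2) this] show ?case using A(1) by blast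
next
  case (DNand d e)
  obtain A where A: "A \<in> K" "elts A = {k.sq xs | xs. set xs \<subseteq> elts U \<and> dsat (elts U) vmem d xs}" using DNand(1) by blast
  obtain B where B: "B \<in> K" "elts B = {k.sq xs | xs. set xs \<subseteq> elts U \<and> dsat (elts U) vmem e xs}" using DNand(2) by blast
  have "D0 {kk} (\<lambda>m s. \<not> (s 0 \<in> ext m A \<and> s 0 \<in> ext m B))"
    by (intro D0_intros D0_rels tmk tm_intros A B)
  from k_sep[where \<Phi> = "\<lambda>m e. \<not> (e \<in> ext m A \<and> e \<in> ext m B)", OF this E(1)]
  obtain C where C: "C \<in> K" "elts C = {e \<in> elts E. \<not> (e \<in> elts A \<and> e \<in> elts B)}" using ext_k A(1) B(1) by auto
  have inj: "k.sq xs = k.sq ys \<longleftrightarrow> xs = ys" if "set xs \<subseteq> elts U" "set ys \<subseteq> elts U" for xs ys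
    using k.sq_inj[of xs ys] that K_trans[OF U] by auto
  have "k.sq xs \<in> elts A \<longleftrightarrow> dsat (elts U) vmem d xs" "k.sq xs \<in> elts B \<longleftrightarrow> dsat (elts U) vmem e xs" if "set xs \<subseteq> elts U" for xs
    using that inj unfolding A(2) B(2) by blast+
  then have "\<not> (k.sq xs \<in> elts A \<and> k.sq xs \<in> elts B) \<longleftrightarrow> dsat (elts U) vmem (DNand d e) xs"
    if "set xs \<subseteq> elts U" for xs using that by simp
  from slice_eq[OF E(2,1) C(2) this] show ?case using C(1) by blast
next
  case (DEx d)
  obtain A where A: "A \<in> K" "elts A = {k.sq xs | xs. set xs \<subseteq> elts U \<and> dsat (elts U) vmem d xs}" using DEx by blast
  have "D0 {kk} (\<lambda>m s. \<exists>n\<in>ext m W. \<exists>a\<in>ext m U. \<exists>e'\<in>ext m E. fn m (s 0) n U \<and> appn m e' (s 0) n a \<and> e' \<in> ext m A)"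
    by (intro D0_intros D0_rels tmk tm_intros A U E W)
  from k_sep[where \<Phi> = "\<lambda>m e. \<exists>n\<in>ext m W. \<exists>a\<in>ext m U. \<exists>e'\<in>ext m E. fn m e n U \<and> appn m e' e n a \<and> e' \<in> ext m A", OF this E(1)]
  obtain C where C: "C \<in> K" "elts C = {e \<in> elts E. \<exists>n\<in>ext kk W. \<exists>a\<in>ext kk U. \<exists>e'\<in>ext kk E. fn kk e n U \<and> appn kk e' e n a \<and> e' \<in> ext kk A}" by blast
  have inj: "k.sq xs = k.sq ys \<longleftrightarrow> xs = ys" if "set xs \<subseteq> elts U" "set ys \<subseteq> elts U" for xs ys
    using k.sq_inj[of xs ys] that K_trans[OF U] by auto
  have "k.sq xs \<in> ext kk A \<longleftrightarrow> dsat (elts U) vmem d xs" if "set xs \<subseteq> elts U" for xs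
    using that inj unfolding ext_k[OF A(1)] A(2) by blast
  then have "(\<exists>a\<in>ext kk U. k.sq (xs @ [a]) \<in> ext kk A) \<longleftrightarrow> dsat (elts U) vmem (DEx d) xs" if "set xs \<subseteq> elts U" for xs
    using that ext_k[OF U] by auto
  moreover have "(\<exists>n\<in>ext kk W. \<exists>a\<in>ext kk U. \<exists>e'\<in>ext kk E. fn kk (k.sq xs) n U \<and> appn kk e' (k.sq xs) n a \<and> e' \<in> ext kk A)
    \<longleftrightarrow> (\<exists>a\<in>ext kk U. k.sq (xs @ [a]) \<in> ext kk A)" if "set xs \<subseteq> elts U" for xs
    using k.app_ex[of U xs E "\<lambda>a e'. e' \<in> ext kk A"] U E that ext_k[OF U] by simp
  ultimately have "(\<exists>n\<in>ext kk W. \<exists>a\<in>ext kk U. \<exists>e'\<in>ext kk E. fn kk (k.sq xs) n U \<and> appn kk e' (k.sq xs) n a \<and> e' \<in> ext kk A)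
    \<longleftrightarrow> dsat (elts U) vmem (DEx d) xs" if "set xs \<subseteq> elts U" for xs
    using that by simp
  from slice_eq[OF E(2,1) C(2) this] show ?case using C(1) by blast
qed

end

context kmod
begin

text \<open>A partial satisfaction relation for the subformulae of one formula is a finite union of slices.\<close>

lemma GS_ex:
  assumes U: "U \<in> K" and E: "E \<in> K" "ext kk E = k.sq ` lists (elts U)"
  shows "\<exists>S\<in>K. elts S = {k0.pr (k.code d') (k.sq xs) | d' xs. d' \<in> subs d \<and> set xs \<subseteq> elts U \<and> dsat (elts U) vmem d' xs}"
proof -
  have T: "\<exists>S\<in>K. elts S = {k0.pr (k.code d) (k.sq xs) | xs. set xs \<subseteq> elts U \<and> dsat (elts U) vmem d xs}" for d
  proof -
    obtain A where A: "A \<in> K" "elts A = {k.sq xs | xs. set xs \<subseteq> elts U \<and> dsat (elts U) vmem d xs}"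
      using slice_ex[OF assms] by blast
    obtain c where c: "c \<in> K" "elts c = {k.code d}" using k_pairing[of "k.code d" "k.code d"] k.code_car by auto
    obtain S where "S \<in> K" "elts S = {k0.pr a b | a b. a \<in> elts c \<and> b \<in> elts A}" using prod_ex[OF c(1) A(1)] by blast
    then show ?thesis using c(2) A(2) by (intro bexI[of _ S]) auto
  qed
  have un: "\<exists>S\<in>K. elts S = elts a \<union> elts b" if "a \<in> K" "b \<in> K" for a b
    using k0.un_ex[of a b] that by (auto simp: ext_k)
  show ?thesis
  proof (induction d)
    case (DMem i j) show ?case using T[of "DMem i j"] by auto
  next
    case (DEq i j) show ?case using T[of "DEq i j"] by auto
  next
    case (DNand d e)
    obtain A where A: "A \<in> K" "elts A = {k0.pr (k.code d') (k.sq xs) | d' xs. d' \<in> subs d \<and> set xs \<subseteq> elts U \<and> dsat (elts U) vmem d' xs}" using DNand(1) by blast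
    obtain B where B: "B \<in> K" "elts B = {k0.pr (k.code d') (k.sq xs) | d' xs. d' \<in> subs e \<and> set xs \<subseteq> elts U \<and> dsat (elts U) vmem d' xs}" using DNand(2) by blast
    obtain C where C: "C \<in> K" "elts C = {k0.pr (k.code (DNand d e)) (k.sq xs) | xs. set xs \<subseteq> elts U \<and> dsat (elts U) vmem (DNand d e) xs}" using T by blast
    obtain AB where AB: "AB \<in> K" "elts AB = elts A \<union> elts B" using un A B by blast
    obtain S where S: "S \<in> K" "elts S = elts C \<union> elts AB" using un[OF C(1) AB(1)] by blast
    show ?case
      by (rule bexI[OF _ S(1)]) (unfold S(2) AB(2) A(2) B(2) C(2) subs.simps, blast)
  next
    case (DEx d)
    obtain A where A: "A \<in> K" "elts A = {k0.pr (k.code d') (k.sq xs) | d' xs. d' \<in> subs d \<and> set xs \<subseteq> elts U \<and> dsat (elts U) vmem d' xs}" using DEx by blast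
    obtain C where C: "C \<in> K" "elts C = {k0.pr (k.code (DEx d)) (k.sq xs) | xs. set xs \<subseteq> elts U \<and> dsat (elts U) vmem (DEx d) xs}" using T by blast
    obtain S where S: "S \<in> K" "elts S = elts C \<union> elts A" using un[OF C(1) A(1)] by blast
    show ?case
      by (rule bexI[OF _ S(1)]) (unfold S(2) A(2) C(2) subs.simps, blast)
  qed
qed

text \<open>The full satisfaction relation: a pair belongs to it if some partial satisfaction relation, on a set of codes
  closed under subformulae, says so. Two partial relations agree by \<open>Scl_iff\<close>, and all of them are members of
  a powerset, so the definition is \<open>\<Delta>\<^sub>0\<close>.\<close>

lemma S_ex:
  assumes U: "U \<in> K" and E: "E \<in> K" "ext kk E = k.sq ` lists (elts U)"
  shows "\<exists>S\<in>K. Scl kk W Cd U E S"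
proof -
  have Ee: "elts E = k.sq ` lists (elts U)" using E ext_k by simp
  obtain X where X: "X \<in> K" "elts X = {k0.pr a b | a b. a \<in> elts Cd \<and> b \<in> elts E}" using prod_ex[OF Cd(1) E(1)] by blast
  obtain PC where PC: "PC \<in> K" "elts PC = {y \<in> K. elts y \<subseteq> elts Cd}" using k_power[OF Cd(1)] by blast
  obtain PX where PX: "PX \<in> K" "elts PX = {y \<in> K. elts y \<subseteq> elts X}" using k_power[OF X(1)] by blast
  define cl where "cl m Z \<longleftrightarrow> (\<forall>c\<in>ext m Z. \<forall>c1\<in>ext m Cd. \<forall>c2\<in>ext m Cd. (trip m c 2 c1 c2 \<longrightarrow> c1 \<in> ext m Z \<and> c2 \<in> ext m Z) \<and>
    (trip m c 3 c1 c1 \<longrightarrow> c1 \<in> ext m Z))" for m :: "'a V str" and Z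
  define \<Theta> where "\<Theta> m z \<longleftrightarrow> (\<exists>Z\<in>ext m PC. \<exists>S\<in>ext m PX. cl m Z \<and> Scl m W Z U E S \<and>
    (\<exists>c\<in>ext m Z. \<exists>e\<in>ext m E. opr m z c e) \<and> z \<in> ext m S)" for m :: "'a V str" and z
  have "D0 {kk} (\<lambda>m s. \<Theta> m (s 0))"
    unfolding \<Theta>_def cl_def by (intro D0_intros D0_rels tmk tm_intros PC(1) PX(1) W(1) U E(1) Cd(1))
  from k_sep[where \<Phi> = \<Theta>, OF this X(1)] obtain S where S: "S \<in> K" "elts S = {z \<in> elts X. \<Theta> kk z}" by blast
  have trN: "trip kk (k.code (DNand a b)) 2 (k.code a) (k.code b)" for a b
    using k.trip_iff[of "k.code (DNand a b)" "k.code a" "k.code b" 2] k.code_car[of "DNand a b"] k.code_car[of a] k.code_car[of b] by simp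
  have trE: "trip kk (k.code (DEx a)) 3 (k.code a) (k.code a)" for a
    using k.trip_iff[of "k.code (DEx a)" "k.code a" "k.code a" 3] k.code_car[of "DEx a"] k.code_car[of a] by simp
  have cC: "k.code d \<in> ext kk Cd" for d using k.Cd_ext by auto
  have sqK: "k.sq xs \<in> K" if "set xs \<subseteq> elts U" for xs using that k.sq_car[of xs] K_trans[OF U] by auto
  have main: "inP kk S (k.code d) (k.sq xs) \<longleftrightarrow> dsat (ext kk U) (snd kk) d xs" if xs: "set xs \<subseteq> ext kk U" for d xs
  proof -
    have xsU: "set xs \<subseteq> elts U" using xs ext_k[OF U] by simp
    let ?z = "k0.pr (k.code d) (k.sq xs)"
    have zK: "?z \<in> K" "opr kk ?z (k.code d) (k.sq xs)" using k0.opr_pr[of "k.code d" "k.sq xs"] k.code_car[of d] sqK[OF xsU] by auto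
    have sqE: "k.sq xs \<in> ext kk E" using E(2) xsU by (auto simp: lists_eq_set)
    have zX: "?z \<in> elts X" unfolding X(2) using Cd(2) Ee xsU by (auto simp: lists_eq_set)
    have "inP kk S (k.code d) (k.sq xs) \<longleftrightarrow> ?z \<in> elts S"
      using k0.inP_iff[of "k.code d" "k.sq xs" S] k.code_car[of d] sqK[OF xsU] ext_k[OF S(1)] by simp
    also have "\<dots> \<longleftrightarrow> \<Theta> kk ?z" using S(2) zX by simp
    also have "\<dots> \<longleftrightarrow> dsat (ext kk U) (snd kk) d xs"
    proof
      assume "\<Theta> kk ?z"
      then obtain Z T c e where *: "Z \<in> ext kk PC" "T \<in> ext kk PX" "cl kk Z" "Scl kk W Z U E T"
        "c \<in> ext kk Z" "opr kk ?z c e" "?z \<in> ext kk T" unfolding \<Theta>_def by blast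
      have ZT: "Z \<in> K" "T \<in> K" "elts Z \<subseteq> elts Cd" using *(1,2) PC PX ext_k by auto
      have c: "c = k.code d" using k0.opr_inj[OF *(6) zK(2)] by simp
      define D where "D = {d. k.code d \<in> ext kk Z}"
      have eZ: "ext kk Z = k.code ` D" using ZT(3) Cd(2) ext_k[OF ZT(1)] by (auto simp: D_def)
      have cl1: "\<forall>a b. DNand a b \<in> D \<longrightarrow> a \<in> D \<and> b \<in> D" using *(3) trN cC unfolding cl_def D_def by blast
      have cl2: "\<forall>a. DEx a \<in> D \<longrightarrow> a \<in> D" using *(3) trE cC unfolding cl_def D_def by blast
      have E': "ext kk E = k.sq ` lists (ext kk U)" using E(2) ext_k[OF U] by simp
      have "inP kk T (k.code d) (k.sq xs)" using *(7) zK(2) unfolding inP_def by blast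
      moreover have "d \<in> D" using *(5) c D_def by simp
      moreover have "Scl kk W Z U E T \<longleftrightarrow> (\<forall>d\<in>D. \<forall>xs. set xs \<subseteq> ext kk U \<longrightarrow>
        (inP kk T (k.code d) (k.sq xs) \<longleftrightarrow> dsat (ext kk U) (snd kk) d xs))"
        by (rule k.Scl_iff[OF _ _ eZ E' cl1 cl2]) (use U E(1) in simp_all)
      ultimately show "dsat (ext kk U) (snd kk) d xs" using *(4) xs by blast
    next
      assume ds: "dsat (ext kk U) (snd kk) d xs"
      obtain Z where Z: "Z \<in> K" "elts Z = k.code ` subs d"
        using k0.finite_ex[of "k.code ` subs d"] finite_subs k.code_car by (auto simp: ext_k)
      obtain T where T: "T \<in> K" "elts T = {k0.pr (k.code d') (k.sq xs) | d' xs. d' \<in> subs d \<and> set xs \<subseteq> elts U \<and> dsat (elts U) vmem d' xs}"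
        using GS_ex[OF assms] by blast
      have inT: "inP kk T (k.code d') (k.sq ys) \<longleftrightarrow> dsat (ext kk U) (snd kk) d' ys"
        if d': "d' \<in> subs d" "set ys \<subseteq> ext kk U" for d' ys
      proof -
        have ysU: "set ys \<subseteq> elts U" using d' ext_k[OF U] by simp
        have inj: "k0.pr (k.code d') (k.sq ys) = k0.pr (k.code d2) (k.sq zs) \<longleftrightarrow> d' = d2 \<and> ys = zs" if "set zs \<subseteq> elts U" for d2 zs
          using k0.pr_inj[of "k.code d'" "k.sq ys" "k.code d2" "k.sq zs"] k.code_car[of d'] k.code_car[of d2] sqK[OF ysU] sqK[OF that]
            k.sq_inj[of ys zs] ysU that K_trans[OF U] by auto
        have "inP kk T (k.code d') (k.sq ys) \<longleftrightarrow> k0.pr (k.code d') (k.sq ys) \<in> elts T"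
          using k0.inP_iff[of "k.code d'" "k.sq ys" T] k.code_car[of d'] sqK[OF ysU] ext_k[OF T(1)] by simp
        also have "\<dots> \<longleftrightarrow> dsat (elts U) vmem d' ys"
        proof -
          have "k0.pr (k.code d') (k.sq ys) \<in> elts T \<longleftrightarrow> (\<exists>d2 zs. k0.pr (k.code d') (k.sq ys) = k0.pr (k.code d2) (k.sq zs) \<and>
              d2 \<in> subs d \<and> set zs \<subseteq> elts U \<and> dsat (elts U) vmem d2 zs)"
            unfolding T(2) by (rule mem_Collect_eq)
          also have "\<dots> \<longleftrightarrow> (\<exists>d2 zs. (d' = d2 \<and> ys = zs) \<and> d2 \<in> subs d \<and> set zs \<subseteq> elts U \<and> dsat (elts U) vmem d2 zs)"
            by (intro ex_cong1) (metis inj)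
          finally show ?thesis using d'(1) ysU by simp
        qed
        finally show ?thesis using ext_k[OF U] by simp
      qed
      have E': "ext kk E = k.sq ` lists (ext kk U)" using E(2) ext_k[OF U] by simp
      have eZ: "ext kk Z = k.code ` subs d" using Z ext_k by simp
      have "Scl kk W Z U E T \<longleftrightarrow> (\<forall>d'\<in>subs d. \<forall>xs. set xs \<subseteq> ext kk U \<longrightarrow>
        (inP kk T (k.code d') (k.sq xs) \<longleftrightarrow> dsat (ext kk U) (snd kk) d' xs))"
      proof (rule k.Scl_iff[OF _ _ eZ E'])
        show "\<forall>a b. DNand a b \<in> subs d \<longrightarrow> a \<in> subs d \<and> b \<in> subs d" "\<forall>a. DEx a \<in> subs d \<longrightarrow> a \<in> subs d"
          using subs_closed by blast+
      qed (use U E(1) in simp_all)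
      then have "Scl kk W Z U E T" using inT by blast
      moreover have "cl kk Z"
        unfolding cl_def
      proof (intro ballI conjI impI)
        fix c c1 c2 assume c: "c \<in> ext kk Z" "c1 \<in> ext kk Cd" "c2 \<in> ext kk Cd"
        obtain d0 where d0: "c = k.code d0" "d0 \<in> subs d" using c(1) eZ by blast
        obtain d1 d2 where d12: "c1 = k.code d1" "c2 = k.code d2" using c(2,3) unfolding k.Cd_ext by blast
        note d = d0 d12
        { assume "trip kk c 2 c1 c2"
          then have "k.code d0 = k.code (DNand d1 d2)" using k.trip_iff[of c c1 c2 2] d k.code_car[of d0] k.code_car[of d1] k.code_car[of d2] by simp
          then have "d0 = DNand d1 d2" using k.code_inj by blast
          then have "d1 \<in> subs d \<and> d2 \<in> subs d" using subs_closed[of d1 d2 d] d(2) by simp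
          then show "c1 \<in> ext kk Z" "c2 \<in> ext kk Z" using eZ d by auto }
        { assume "trip kk c 3 c1 c1"
          then have "k.code d0 = k.code (DEx d1)" using k.trip_iff[of c c1 c1 3] d k.code_car[of d0] k.code_car[of d1] by simp
          then have "d0 = DEx d1" using k.code_inj by blast
          then have "d1 \<in> subs d" using subs_closed[of d1 _ d] d(2) by simp
          then show "c1 \<in> ext kk Z" using eZ d by auto }
      qed
      moreover have "Z \<in> ext kk PC" unfolding ext_k[OF PC(1)] PC(2) using Z Cd(2) by auto
      moreover have "elts T \<subseteq> elts X" unfolding T(2) X(2) Cd(2) Ee by (auto simp: lists_eq_set)
      then have "T \<in> ext kk PX" unfolding ext_k[OF PX(1)] PX(2) using T(1) by blast
      moreover have "k.code d \<in> ext kk Z" using eZ subs_self by auto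
      moreover have "?z \<in> ext kk T"
      proof -
        have "dsat (elts U) vmem d xs" using ds ext_k[OF U] by simp
        then show ?thesis unfolding ext_k[OF T(1)] T(2) using subs_self xsU by blast
      qed
      ultimately show "\<Theta> kk ?z" unfolding \<Theta>_def using zK(2) sqE by blast
    qed
    finally show ?thesis .
  qed
  have E': "ext kk E = k.sq ` lists (ext kk U)" using E(2) ext_k[OF U] by simp
  have "Scl kk W Cd U E S \<longleftrightarrow> (\<forall>d\<in>UNIV. \<forall>xs. set xs \<subseteq> ext kk U \<longrightarrow>
        (inP kk S (k.code d) (k.sq xs) \<longleftrightarrow> dsat (ext kk U) (snd kk) d xs))"
    by (rule k.Scl_iff[OF _ _ k.Cd_ext E']) (use U E(1) in simp_all)
  then show ?thesis using main S(1) by blast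
qed

lemma SP_ex: assumes U: "U \<in> K" shows "\<exists>E\<in>K. \<exists>S\<in>K. SP kk W Cd U E S"
proof -
  obtain E where E: "E \<in> K" "ext kk E = k.sq ` lists (elts U)" using E_ex[OF U] by blast
  obtain S where S: "S \<in> K" "Scl kk W Cd U E S" using S_ex[OF U E] by blast
  have "isE kk W U E" using k.isE_iff[of U E] U E ext_k[OF U] by simp
  then show ?thesis using E(1) S unfolding SP_def by blast
qed

lemma Dfs_ex:
  assumes v: "v \<in> K" and y: "B \<in> Dfs (elts v) vmem" shows "\<exists>y\<in>K. elts y = B"
proof -
  obtain d xs where B: "set xs \<subseteq> elts v" "B = {x \<in> elts v. dsat (elts v) vmem d (xs @ [x])}"
    using y unfolding Dfs_def by blast
  obtain E S where ES: "E \<in> K" "S \<in> K" "SP kk W Cd v E S" using SP_ex[OF v] by blast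
  have xv: "set xs \<subseteq> ext kk v" using B ext_k[OF v] by simp
  have sqK: "k.sq xs \<in> K" using k.sq_car[of xs] xv by (auto simp: ext_def)
  have "D0 {kk} (\<lambda>m s. \<exists>n\<in>ext m W. \<exists>e'\<in>ext m E. fn m (k.sq xs) n v \<and> appn m e' (k.sq xs) n (s 0) \<and> inP m S (k.code d) e')"
    by (intro D0_intros D0_rels tmk tm_intros W(1) ES sqK v) (use k.code_car in auto)
  from k_sep[where \<Phi> = "\<lambda>m x. \<exists>n\<in>ext m W. \<exists>e'\<in>ext m E. fn m (k.sq xs) n v \<and> appn m e' (k.sq xs) n x \<and> inP m S (k.code d) e'", OF this v]
  obtain y where y: "y \<in> K" "elts y = {x \<in> elts v. \<exists>n\<in>ext kk W. \<exists>e'\<in>ext kk E. fn kk (k.sq xs) n v \<and> appn kk e' (k.sq xs) n x \<and> inP kk S (k.code d) e'}" by blast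
  have "defs kk W v E S y (k.code d) (k.sq xs)" unfolding defs_def ext_k[OF v] ext_k[OF y(1)] using y(2) by blast
  then have "ext kk y = {x \<in> ext kk v. dsat (ext kk v) (snd kk) d (xs @ [x])}"
    using k.defs_iff[OF ES(3) _ _ _ xv] v ES by simp
  then show ?thesis using B(2) ext_k[OF v] ext_k[OF y(1)] y(1) by (intro bexI[of _ y]) simp
qed

lemma Def_K: "v \<in> K \<Longrightarrow> y \<in> Def v \<Longrightarrow> y \<in> K"
  using Dfs_ex[of v "elts y"] V_ext unfolding Def_iff by blast

lemma IsD_K: assumes "IsD kk W Cd v d Q" "v \<in> K" "d \<in> K" shows "elts d = Def v"
proof -
  have "elts d = {y \<in> K. ext kk y \<in> Dfs (ext kk v) (snd kk)}"
    using k.IsD_iff[OF assms(1)] assms(2,3) ext_k by simp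
  then show ?thesis using Def_K[OF assms(2)] ext_k[OF assms(2)] by (auto simp: Def_iff ext_k)
qed

lemma DF_ex: assumes v: "v \<in> K" and SP: "SP kk W Cd v E S" "E \<in> K" "S \<in> K" shows "\<exists>d\<in>K. DF kk W Cd v E S d"
proof -
  obtain P where P: "P \<in> K" "elts P = {y \<in> K. elts y \<subseteq> elts v}" using k_power[OF v] by blast
  have "D0 {kk} (\<lambda>m s. \<exists>c\<in>ext m Cd. \<exists>e\<in>ext m E. defs m W v E S (s 0) c e)"
    by (intro D0_intros D0_rels tmk tm_intros W(1) Cd(1) SP v)
  from k_sep[where \<Phi> = "\<lambda>m y. \<exists>c\<in>ext m Cd. \<exists>e\<in>ext m E. defs m W v E S y c e", OF this P(1)]
  obtain d where d: "d \<in> K" "elts d = {y \<in> elts P. \<exists>c\<in>ext kk Cd. \<exists>e\<in>ext kk E. defs kk W v E S y c e}" by blast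
  have "\<exists>y\<in>elts d. defs kk W v E S y c e" if ce: "c \<in> ext kk Cd" "e \<in> ext kk E" for c e
  proof -
    obtain dd where c: "c = k.code dd" using ce(1) k.Cd_ext by auto
    have "ext kk E = k.sq ` lists (ext kk v)" using k.SP_E[OF SP(1)] v SP by simp
    then obtain xs where xs: "set xs \<subseteq> ext kk v" "e = k.sq xs" using ce(2) by (auto simp: lists_eq_set)
    have "{x \<in> elts v. dsat (elts v) vmem dd (xs @ [x])} \<in> Dfs (elts v) vmem"
      using xs(1) ext_k[OF v] unfolding Dfs_def by auto
    then obtain y where y: "y \<in> K" "elts y = {x \<in> elts v. dsat (elts v) vmem dd (xs @ [x])}" using Dfs_ex[OF v] by blast
    then have "defs kk W v E S y c e" unfolding c xs(2)
      using k.defs_iff[OF SP(1) _ _ _ xs(1), of y dd] v SP ext_k[OF v] ext_k[OF y(1)] by simp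
    moreover have "y \<in> elts P" using y P by auto
    ultimately show ?thesis using d(2) ce by blast
  qed
  then have "DF kk W Cd v E S d" unfolding DF_def ext_k[OF d(1)] using d(2) by blast
  then show ?thesis using d(1) by blast
qed

section \<open>Levels of the constructible hierarchy in the standard model\<close>

lemma IsD_mono: "IsD m W Cd v d Q \<Longrightarrow> ext m Q \<subseteq> ext m Q' \<Longrightarrow> IsD m W Cd v d Q'"
  unfolding IsD_def by blast

text \<open>In \<open>K\<close> the certificates mean what they should, so the package can be read in terms of \<open>Def\<close>.\<close>

lemma Hi_K: assumes "h \<in> K" "Q \<in> K" 
  shows "Hi kk W Cd h Q \<longleftrightarrow> (\<forall>v\<in>elts h. (\<exists>d\<in>elts Q. IsD kk W Cd v d Q) \<and>
     (\<forall>x\<in>elts v. \<exists>v'\<in>elts h. v' \<in> elts v \<and> x \<notin> elts v' \<and> x \<in> Def v') \<and>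
     (\<forall>v'\<in>elts h. v' \<in> elts v \<longrightarrow> Def v' \<subseteq> elts v))" (is "?L \<longleftrightarrow> ?R")
proof -
  have hK: "v \<in> K" "ext kk v = elts v" if "v \<in> elts h" for v using that K_trans[OF assms(1)] ext_k by auto
  have QD: "elts d = Def v" "ext kk d = elts d" if "v \<in> elts h" "d \<in> elts Q" "IsD kk W Cd v d Q" for v d
    using IsD_K[OF that(3)] hK(1)[OF that(1)] K_trans[OF assms(2) that(2)] ext_k by auto
  show ?thesis
  proof
    assume L: ?L
    have 1: "\<exists>d\<in>elts Q. IsD kk W Cd v d Q" if "v \<in> elts h" for v
      using L that unfolding Hi_def ext_k[OF assms(1)] ext_k[OF assms(2)] by blast
    have 2: "\<exists>v'\<in>elts h. v' \<in> elts v \<and> x \<notin> elts v' \<and> x \<in> Def v'" if v: "v \<in> elts h" "x \<in> elts v" for v x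
    proof -
      obtain v' d where *: "v' \<in> elts h" "v' \<in> ext kk v" "x \<notin> ext kk v'" "d \<in> elts Q" "IsD kk W Cd v' d Q" "x \<in> ext kk d"
        using bspec[OF L[unfolded Hi_def ext_k[OF assms(1)] ext_k[OF assms(2)]] v(1)] v(2)[folded hK(2)[OF v(1)]] by blast
      then show ?thesis using QD[OF *(1,4,5)] hK(2)[OF v(1)] hK(2)[OF *(1)] by auto
    qed
    have 3: "Def v' \<subseteq> elts v" if v: "v \<in> elts h" "v' \<in> elts h" "v' \<in> elts v" for v v'
    proof -
      obtain d where d: "d \<in> elts Q" "IsD kk W Cd v' d Q" using 1[OF v(2)] by blast
      then have "\<forall>x\<in>ext kk d. x \<in> ext kk v"
        using L v hK(2) unfolding Hi_def ext_k[OF assms(1)] ext_k[OF assms(2)] by blast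
      then show ?thesis using QD[OF v(2) d] hK(2)[OF v(1)] by auto
    qed
    show ?R using 1 2 3 by blast
  next
    assume R: ?R
    have 2: "\<exists>v'\<in>elts h. v' \<in> ext kk v \<and> x \<notin> ext kk v' \<and> (\<exists>d\<in>elts Q. IsD kk W Cd v' d Q \<and> x \<in> ext kk d)"
      if v: "v \<in> elts h" "x \<in> ext kk v" for v x
    proof -
      obtain v' where *: "v' \<in> elts h" "v' \<in> elts v" "x \<notin> elts v'" "x \<in> Def v'" using R v hK(2)[OF v(1)] by blast
      obtain d where d: "d \<in> elts Q" "IsD kk W Cd v' d Q" using R *(1) by blast
      then show ?thesis using * QD[OF *(1) d] hK(2)[OF v(1)] hK(2)[OF *(1)] by blast
    qed
    have 3: "\<forall>x\<in>ext kk d. x \<in> ext kk v" if v: "v \<in> elts h" "v' \<in> elts h" "v' \<in> ext kk v" "d \<in> elts Q" "IsD kk W Cd v' d Q" for v v' d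
      using R v QD[OF v(2,4,5)] hK(2)[OF v(1)] by blast
    show ?L unfolding Hi_def ext_k[OF assms(1)] ext_k[OF assms(2)] using R 2 3 by blast
  qed
qed

lemma Lset_mem:
  fixes a b :: "'a V"
  assumes "Lset a \<in> elts (Lset b)" shows "Def (Lset a) \<subseteq> elts (Lset b)"
proof -
  have "\<not> Def (Lset b) \<subseteq> elts (Lset a)"
  proof
    assume "Def (Lset b) \<subseteq> elts (Lset a)"
    then have "Lset a \<in> elts (Lset a)" using Lset_Def assms by blast
    then show False using V_noself by blast
  qed
  moreover have "Lset a \<noteq> Lset b" using assms V_noself by metis
  ultimately show ?thesis using Lset_linear by blast
qed

text \<open>By \<open>\<in>\<close>-induction: \<open>v\<close> is the union of \<open>Def v'\<close> over earlier levels \<open>v'\<close>, hence it is \<open>Lset\<close> of the set of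
  their indices.\<close>

lemma Hi_level:
  assumes "h \<in> K" "Q \<in> K" "Hi kk W Cd h Q" "v \<in> elts h" shows "\<exists>x. v = Lset x"
  using assms(4)
proof (induction v rule: V_induct)
  case (step v)
  note H = assms(3)[unfolded Hi_K[OF assms(1,2)], rule_format, OF step.prems]
  have "\<forall>v'\<in>elts h \<inter> elts v. \<exists>x. v' = Lset x" using step.IH by blast
  then obtain f where f: "\<And>v'. v' \<in> elts h \<Longrightarrow> v' \<in> elts v \<Longrightarrow> v' = Lset (f v')" by (metis IntI)
  have "small (f ` (elts h \<inter> elts v))" by (intro small_image small_subset[OF small_elts[of h]]) blast
  then have e: "elts (vset (f ` (elts h \<inter> elts v))) = f ` (elts h \<inter> elts v)" by (rule elts_vset)
  have "elts v = (\<Union>v'\<in>elts h \<inter> elts v. Def v')" using H by blast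
  also have "\<dots> = (\<Union>v'\<in>elts h \<inter> elts v. Def (Lset (f v')))" using f by auto
  also have "\<dots> = elts (Lset (vset (f ` (elts h \<inter> elts v))))" unfolding elts_Lset[of "vset (f ` (elts h \<inter> elts v))"] e by blast
  finally have "v = Lset (vset (f ` (elts h \<inter> elts v)))" by (rule V_ext)
  then show ?case by blast
qed

lemma level_least:
  fixes x :: "'a V"
  assumes "z \<in> elts (Lset x)"
  shows "\<exists>t. Lset t \<in> elts (Lset x) \<and> z \<in> Def (Lset t) \<and> z \<notin> elts (Lset t)"
proof -
  have "\<exists>t. Lset t \<in> elts (Lset x) \<and> z \<in> Def (Lset t) \<and> z \<notin> elts (Lset t)"
    if "Lset y \<in> elts (Lset x)" "z \<in> Def (Lset y)" for y
    using that
  proof (induction y rule: V_induct)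
    case (step y)
    show ?case
    proof (cases "z \<in> elts (Lset y)")
      case True
      then obtain t where t: "t \<in> elts y" "z \<in> Def (Lset t)" unfolding elts_Lset[of y] by blast
      have "Lset t \<in> elts (Lset x)" using Lset_in[OF t(1)] Lset_trans[OF step.prems(1)] by blast
      then show ?thesis using step.IH[OF t(1)] t(2) by blast
    qed (use step.prems in blast)
  qed
  moreover obtain y where "y \<in> elts x" "z \<in> Def (Lset y)" using assms unfolding elts_Lset[of x] by blast
  ultimately show ?thesis using Lset_in by blast
qed

text \<open>Packages for all levels below \<open>v\<close> exist by induction. Collection gathers enough of them to let every element of \<open>v\<close>
  appear, and their union, extended by a certificate for \<open>v\<close> itself, is a package for \<open>v\<close>.\<close>

lemma level_ex: "v \<in> K \<Longrightarrow> v = Lset x \<Longrightarrow> \<exists>h\<in>K. \<exists>Q\<in>K. Hi kk W Cd h Q \<and> v \<in> elts h"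
proof (induction v arbitrary: x rule: V_induct)
  case (step v)
  note v = step.prems(1)
  define \<Psi> where "\<Psi> m z y \<longleftrightarrow> (\<exists>h\<in>ext m y. \<exists>Q\<in>ext m y. Hi m W Cd h Q \<and> (\<exists>v'\<in>ext m h. v' \<in> ext m v \<and> z \<notin> ext m v' \<and> 
    (\<exists>d\<in>ext m Q. IsD m W Cd v' d Q \<and> z \<in> ext m d)))" for m :: "'a V str" and z y
  have D: "D0 {kk} (\<lambda>m s. \<Psi> m (s 0) (s 1))"
    unfolding \<Psi>_def by (intro D0_intros D0_rels tmk tm_intros W(1) Cd(1) v)
  have "\<exists>y\<in>K. \<Psi> kk z y" if z: "z \<in> elts v" for z
  proof -
    obtain t where t: "Lset t \<in> elts v" "z \<in> Def (Lset t)" "z \<notin> elts (Lset t)" using level_least z step.prems(2) by blast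
    have tK: "Lset t \<in> K" using t(1) K_trans[OF v] by blast
    obtain h Q where hQ: "h \<in> K" "Q \<in> K" "Hi kk W Cd h Q" "Lset t \<in> elts h" using step.IH[OF t(1) tK refl] by blast
    obtain d where d: "d \<in> elts Q" "IsD kk W Cd (Lset t) d Q" using hQ(3,4) unfolding Hi_K[OF hQ(1,2)] by blast
    have "d \<in> K" using d(1) K_trans[OF hQ(2)] by blast
    then have "z \<in> ext kk d" using IsD_K[OF d(2) tK] t(2) ext_k by simp
    moreover obtain y where y: "y \<in> K" "elts y = {h, Q}" using k_pairing[OF hQ(1,2)] by blast
    moreover have "h \<in> ext kk y" "Q \<in> ext kk y" "Lset t \<in> ext kk h" "Lset t \<in> ext kk v" "z \<notin> ext kk (Lset t)" "d \<in> ext kk Q"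
      using y hQ t d ext_k[OF y(1)] ext_k[OF hQ(1)] ext_k[OF hQ(2)] ext_k[OF v] ext_k[OF tK] by auto
    ultimately have "\<Psi> kk z y" unfolding \<Psi>_def using hQ(3) d(2) by blast
    then show ?thesis using y(1) by blast
  qed
  then have "\<forall>z\<in>elts v. \<exists>y\<in>K. \<Psi> kk z y" by blast
  from k_coll[where \<Psi> = \<Psi>, OF P1_D0[OF D] v this] obtain c where c: "c \<in> K" "\<forall>z\<in>elts v. \<exists>y\<in>elts c. \<Psi> kk z y" by blast
  obtain u1 where u1: "u1 \<in> K" "elts u1 = (\<Union>y\<in>elts c. elts y)" using k_union[OF c(1)] by blast
  obtain u2 where u2: "u2 \<in> K" "elts u2 = (\<Union>y\<in>elts u1. elts y)" using k_union[OF u1(1)] by blast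
  have "D0 {kk} (\<lambda>m s. s 0 \<in> ext m v \<and> (\<exists>y\<in>ext m c. \<exists>h\<in>ext m y. \<exists>Q\<in>ext m y. Hi m W Cd h Q \<and> s 0 \<in> ext m h))"
    by (intro D0_intros D0_rels tmk tm_intros W(1) Cd(1) v c(1))
  from k_sep[where \<Phi> = "\<lambda>m v'. v' \<in> ext m v \<and> (\<exists>y\<in>ext m c. \<exists>h\<in>ext m y. \<exists>Q\<in>ext m y. Hi m W Cd h Q \<and> v' \<in> ext m h)", OF this u2(1)]
  obtain H1 where H1: "H1 \<in> K" "elts H1 = {v' \<in> elts u2. v' \<in> ext kk v \<and> (\<exists>y\<in>ext kk c. \<exists>h\<in>ext kk y. \<exists>Q\<in>ext kk y. Hi kk W Cd h Q \<and> v' \<in> ext kk h)}"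
    by blast
  have cK: "y \<in> K" "ext kk y = elts y" if "y \<in> elts c" for y using that K_trans[OF c(1)] ext_k by auto
  have uK: "y \<in> K" "ext kk y = elts y" if "y \<in> elts u1" for y using that K_trans[OF u1(1)] ext_k by auto
  have H1e: "v' \<in> elts H1 \<longleftrightarrow> v' \<in> elts v \<and> (\<exists>y\<in>elts c. \<exists>h\<in>elts y. \<exists>Q\<in>elts y. Hi kk W Cd h Q \<and> v' \<in> elts h)" for v'
    unfolding H1(2) ext_k[OF v] ext_k[OF c(1)] u2(2) u1(2) using cK(2) uK(2) u1(2) by blast
  obtain E S where ES: "E \<in> K" "S \<in> K" "SP kk W Cd v E S" using SP_ex[OF v] by blast
  obtain d where d: "d \<in> K" "DF kk W Cd v E S d" using DF_ex[OF v ES(3,1,2)] by blast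
  obtain Q0 where Q0: "Q0 \<in> K" "elts Q0 = {E, S, d}"
    using k0.finite_ex[of "{E, S, d}"] ES d by (auto simp: ext_k)
  obtain Q where Q: "Q \<in> K" "elts Q = elts u2 \<union> elts Q0" using k0.un_ex[of u2 Q0] u2(1) Q0(1) by (auto simp: ext_k)
  obtain h where h: "h \<in> K" "elts h = insert v (elts H1)" using k0.ins_ex[of H1 v] H1(1) v by (auto simp: ext_k)
  have IsDv: "IsD kk W Cd v d Q" unfolding IsD_def ext_k[OF Q(1)] using ES d Q(2) Q0(2) by blast
  have old: "\<exists>h' Q'. h' \<in> K \<and> Q' \<in> K \<and> Hi kk W Cd h' Q' \<and> v' \<in> elts h' \<and> (\<forall>v''\<in>elts h'. v'' \<in> elts v \<longrightarrow> v'' \<in> elts H1) \<and> elts Q' \<subseteq> elts Q"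
    if vH: "v' \<in> elts H1" for v'
  proof -
    obtain y h' Q' where *: "y \<in> elts c" "h' \<in> elts y" "Q' \<in> elts y" "Hi kk W Cd h' Q'" "v' \<in> elts h'"
      using vH H1e[of v'] by blast
    have "h' \<in> K" "Q' \<in> K" using *(1-3) u1 K_trans[OF u1(1)] by auto
    moreover have "elts Q' \<subseteq> elts Q" using * Q(2) u2(2) u1(2) by blast
    moreover have "\<forall>v''\<in>elts h'. v'' \<in> elts v \<longrightarrow> v'' \<in> elts H1" using * H1e by blast
    ultimately show ?thesis using * by blast
  qed
  have lev: "\<exists>t. v' = Lset t" if "v' \<in> elts h" for v'
  proof (cases "v' = v")
    case False
    then show ?thesis using that h(2) old[of v'] Hi_level by blast
  qed (use step.prems in blast)
  have 1: "\<exists>d\<in>elts Q. IsD kk W Cd v' d Q" if vh: "v' \<in> elts h" for v'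
  proof (cases "v' = v")
    case True then show ?thesis using IsDv Q Q0 by blast
  next
    case False
    then obtain h' Q' where *: "h' \<in> K" "Q' \<in> K" "Hi kk W Cd h' Q'" "v' \<in> elts h'" "elts Q' \<subseteq> elts Q"
      using vh h(2) old[of v'] by blast
    obtain d' where "d' \<in> elts Q'" "IsD kk W Cd v' d' Q'" using *(3,4) unfolding Hi_K[OF *(1,2)] by blast
    moreover have "ext kk Q' \<subseteq> ext kk Q" using *(5) ext_k[OF *(2)] ext_k[OF Q(1)] by simp
    ultimately show ?thesis using IsD_mono *(5) by blast
  qed
  have 2: "\<exists>v''\<in>elts h. v'' \<in> elts v' \<and> z \<notin> elts v'' \<and> z \<in> Def v''" if v': "v' \<in> elts h" "z \<in> elts v'" for v' z
  proof (cases "v' = v")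
    case True
    then obtain y where "y \<in> elts c" "\<Psi> kk z y" using c(2) v' by blast
    then obtain h' Q' v'' d' where *: "y \<in> elts c" "h' \<in> elts y" "Q' \<in> elts y" "Hi kk W Cd h' Q'" "v'' \<in> ext kk h'" "v'' \<in> ext kk v"
      "z \<notin> ext kk v''" "d' \<in> ext kk Q'" "IsD kk W Cd v'' d' Q'" "z \<in> ext kk d'" unfolding \<Psi>_def using cK(2) by blast
    have K': "h' \<in> K" "Q' \<in> K" using *(1-3) u1 K_trans[OF u1(1)] by auto
    then have K'': "v'' \<in> K" "d' \<in> K" using *(5,8) ext_car[of _ kk] by auto
    have "v'' \<in> elts H1" using *(1-6) H1e ext_k[OF v] ext_k[OF K'(1)] by blast
    moreover have "z \<in> Def v''" using IsD_K[OF *(9) K''] *(10) ext_k[OF K''(2)] by simp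
    moreover have "z \<notin> elts v''" "v'' \<in> elts v" using *(6,7) ext_k[OF v] ext_k[OF K''(1)] by auto
    ultimately show ?thesis using True h(2) by blast
  next
    case False
    then have vH: "v' \<in> elts H1" using v' h(2) by blast
    then have vv: "v' \<in> elts v" using H1e by blast
    obtain h' Q' where *: "h' \<in> K" "Q' \<in> K" "Hi kk W Cd h' Q'" "v' \<in> elts h'" "\<forall>v''\<in>elts h'. v'' \<in> elts v \<longrightarrow> v'' \<in> elts H1"
      using old[OF vH] by blast
    then obtain v'' where "v'' \<in> elts h'" "v'' \<in> elts v'" "z \<notin> elts v''" "z \<in> Def v''" using v'(2) unfolding Hi_K[OF *(1,2)] by blast
    moreover have "v'' \<in> elts v" using Lset_trans[of v' x] vv step.prems(2) calculation(2) by blast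
    ultimately show ?thesis using * h(2) by blast
  qed
  have 3: "Def v'' \<subseteq> elts v'" if "v' \<in> elts h" "v'' \<in> elts h" "v'' \<in> elts v'" for v' v''
    using lev[OF that(1)] lev[OF that(2)] that(3) Lset_mem by blast
  have "Hi kk W Cd h Q" unfolding Hi_K[OF h(1) Q(1)] using 1 2 3 by blast
  then show ?case using h Q(1) by blast
qed

end

text \<open>From here on the model is itself a level of the constructible hierarchy, so each of its elements lies in a level that belongs to it.\<close>

locale kmodL = kmod "Lset \<alpha>" for \<alpha> :: "'a::infinite V"
begin

lemma in_level: assumes "z \<in> K" shows "\<exists>h\<in>K. \<exists>Q\<in>K. \<exists>v\<in>K. Hi kk W Cd h Q \<and> v \<in> elts h \<and> z \<in> elts v"
proof -
  obtain b where b: "b \<in> elts \<alpha>" "z \<in> Def (Lset b)" using assms unfolding elts_Lset[of \<alpha>] by blast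
  have bK: "Lset b \<in> K" using Lset_in[OF b(1)] .
  obtain E S where ES: "E \<in> K" "S \<in> K" "SP kk W Cd (Lset b) E S" using SP_ex[OF bK] by blast
  obtain d where d: "d \<in> K" "DF kk W Cd (Lset b) E S d" using DF_ex[OF bK ES(3,1,2)] by blast
  obtain Q where Q: "Q \<in> K" "elts Q = {E, S}" using k_pairing ES by blast
  have "IsD kk W Cd (Lset b) d Q" unfolding IsD_def ext_k[OF Q(1)] using ES d Q(2) by blast
  then have ed: "elts d = Def (Lset b)" using IsD_K bK d(1) by blast
  \<comment> \<open>The definable powerset of the level with index \<open>b\<close> is the level with index set \<open>{b}\<close>.\<close>
  have "small {b}" unfolding small_def by (rule exI[of _ "\<lambda>_. b"]) simp
  then have "elts (vset {b}) = {b}" by (rule elts_vset)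
  then have "elts d = elts (Lset (vset {b}))" unfolding ed elts_Lset[of "vset {b}"] by simp
  then have "d = Lset (vset {b})" by (rule V_ext)
  then show ?thesis using level_ex[OF d(1)] b(2) ed d(1) by blast
qed

end

section \<open>Duals and universal closures\<close>

lemma sat_foldr_dual:
  assumes "\<And>s. sat M E s p \<longleftrightarrow> \<not> sat M E s p'"
  shows "sat M E s (foldr Ex xs p) \<longleftrightarrow> \<not> sat M E s (foldr All xs p')"
    "sat M E s (foldr All xs p) \<longleftrightarrow> \<not> sat M E s (foldr Ex xs p')"
  by (induction xs arbitrary: s) (simp_all add: assms)

text \<open>\<open>\<Sigma>\<^sub>k\<close>-elementarity is the same as \<open>\<Pi>\<^sub>k\<close>-elementarity, although the classes are not closed under negation syntactically.\<close>

lemma levy_dual: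
  "(p \<in> levy_Sigma k \<longrightarrow> (\<exists>p'\<in>levy_Pi k. \<forall>M E (s :: nat \<Rightarrow> 'm). sat M E s p \<longleftrightarrow> \<not> sat M E s p')) \<and>
   (p \<in> levy_Pi k \<longrightarrow> (\<exists>p'\<in>levy_Sigma k. \<forall>M E (s :: nat \<Rightarrow> 'm). sat M E s p \<longleftrightarrow> \<not> sat M E s p'))"
proof (induction k arbitrary: p)
  case 0
  show ?case by (auto intro!: bexI[of _ "Neg p"] Delta0.intros)
next
  case (Suc k)
  { assume "p \<in> levy_Sigma (Suc k)"
    then obtain xs q where q: "p = foldr Ex xs q" "q \<in> levy_Pi k" by auto
    then obtain q' where q': "q' \<in> levy_Sigma k" "\<forall>M E (s :: nat \<Rightarrow> 'm). sat M E s q \<longleftrightarrow> \<not> sat M E s q'" using Suc by blast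
    have "\<forall>M E (s :: nat \<Rightarrow> 'm). sat M E s p \<longleftrightarrow> \<not> sat M E s (foldr All xs q')"
      using sat_foldr_dual(1) q'(2) unfolding q(1) by blast
    moreover have "foldr All xs q' \<in> levy_Pi (Suc k)" using q'(1) by auto
    ultimately have "\<exists>p'\<in>levy_Pi (Suc k). \<forall>M E (s :: nat \<Rightarrow> 'm). sat M E s p \<longleftrightarrow> \<not> sat M E s p'" by blast }
  moreover
  { assume "p \<in> levy_Pi (Suc k)"
    then obtain xs q where q: "p = foldr All xs q" "q \<in> levy_Sigma k" by auto
    then obtain q' where q': "q' \<in> levy_Pi k" "\<forall>M E (s :: nat \<Rightarrow> 'm). sat M E s q \<longleftrightarrow> \<not> sat M E s q'" using Suc by blast
    have "\<forall>M E (s :: nat \<Rightarrow> 'm). sat M E s p \<longleftrightarrow> \<not> sat M E s (foldr Ex xs q')"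
      using sat_foldr_dual(2) q'(2) unfolding q(1) by blast
    moreover have "foldr Ex xs q' \<in> levy_Sigma (Suc k)" using q'(1) by auto
    ultimately have "\<exists>p'\<in>levy_Sigma (Suc k). \<forall>M E (s :: nat \<Rightarrow> 'm). sat M E s p \<longleftrightarrow> \<not> sat M E s p'" by blast }
  ultimately show ?case by blast
qed

lemma sat_foldr_All:
  "sat M E s (foldr All xs p) \<longleftrightarrow> (\<forall>s'. (\<forall>i. i \<notin> set xs \<longrightarrow> s' i = s i) \<and> s' ` set xs \<subseteq> M \<longrightarrow> sat M E s' p)"
proof (induction xs arbitrary: s)
  case Nil
  have "s' = s" if "\<forall>i. s' i = s i" for s' using that by blast
  then show ?case by auto
next
  case (Cons x xs)
  show ?case
  proof
    assume L: "sat M E s (foldr All (x # xs) p)"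
    show "\<forall>s'. (\<forall>i. i \<notin> set (x # xs) \<longrightarrow> s' i = s i) \<and> s' ` set (x # xs) \<subseteq> M \<longrightarrow> sat M E s' p"
    proof (intro allI impI)
      fix s' assume s': "(\<forall>i. i \<notin> set (x # xs) \<longrightarrow> s' i = s i) \<and> s' ` set (x # xs) \<subseteq> M"
      then have "sat M E (s(x := s' x)) (foldr All xs p)" using L by simp
      then show "sat M E s' p" unfolding Cons using s' by auto
    qed
  next
    assume R: "\<forall>s'. (\<forall>i. i \<notin> set (x # xs) \<longrightarrow> s' i = s i) \<and> s' ` set (x # xs) \<subseteq> M \<longrightarrow> sat M E s' p"
    have "sat M E (s(x := a)) (foldr All xs p)" if a: "a \<in> M" for a
      unfolding Cons
    proof (intro allI impI)
      fix s' assume s': "(\<forall>i. i \<notin> set xs \<longrightarrow> s' i = (s(x := a)) i) \<and> s' ` set xs \<subseteq> M"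
      then have "s' x \<in> M" using a by (cases "x \<in> set xs") auto
      then show "sat M E s' p" using R s' by auto
    qed
    then show "sat M E s (foldr All (x # xs) p)" by simp
  qed
qed

lemma sat_closure:
  assumes "fv p \<subseteq> {..<n}" "range s \<subseteq> M"
  shows "sat M E s (foldr All [0..<n] p) \<longleftrightarrow> (\<forall>s'. range s' \<subseteq> M \<longrightarrow> sat M E s' p)"
proof
  assume L: "sat M E s (foldr All [0..<n] p)"
  show "\<forall>s'. range s' \<subseteq> M \<longrightarrow> sat M E s' p"
  proof (intro allI impI)
    fix s' :: "nat \<Rightarrow> 'a" assume s': "range s' \<subseteq> M"
    let ?t = "\<lambda>i. if i < n then s' i else s i"
    have "(\<forall>i. i \<notin> set [0..<n] \<longrightarrow> ?t i = s i) \<and> ?t ` set [0..<n] \<subseteq> M" using s' by auto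
    then have "sat M E ?t p" by (rule L[unfolded sat_foldr_All, rule_format])
    moreover have "sat M E ?t p \<longleftrightarrow> sat M E s' p" by (rule sat_cong) (use assms(1) in auto)
    ultimately show "sat M E s' p" by simp
  qed
next
  assume R: "\<forall>s'. range s' \<subseteq> M \<longrightarrow> sat M E s' p"
  show "sat M E s (foldr All [0..<n] p)" unfolding sat_foldr_All
  proof (intro allI impI)
    fix s' assume s': "(\<forall>i. i \<notin> set [0..<n] \<longrightarrow> s' i = s i) \<and> s' ` set [0..<n] \<subseteq> M"
    have "s' i \<in> M" for i using s' assms(2) by (cases "i < n") auto
    then show "sat M E s' p" using R by blast
  qed
qed

text \<open>With \<open>y\<close> fixed, an instance of \<open>\<Delta>\<^sub>0\<close>-Separation is \<open>\<Delta>\<^sub>0\<close>, so the whole instance is \<open>\<Pi>\<^sub>2\<close>.\<close>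

lemma sat_separation:
  assumes "distinct [x, y, w]"
  shows "sat M E t (All w (Ex y (All x (Iff (Mem x y) (Conj (Mem x w) p))))) \<longleftrightarrow>
    (\<forall>c\<in>M. sat M E (t(w := c)) (Ex y (Conj (BAll x y (Conj (Mem x w) p)) (BAll x w (Imp p (Mem x y))))))"
proof -
  have xy: "x \<noteq> y" "x \<noteq> w" "y \<noteq> w" using assms by auto
  have "sat M E t' (All x (Iff (Mem x y) (Conj (Mem x w) p))) \<longleftrightarrow>
      sat M E t' (Conj (BAll x y (Conj (Mem x w) p)) (BAll x w (Imp p (Mem x y))))" for t'
    unfolding sat.simps fun_upd_same fun_upd_other[OF xy(1)[symmetric]] fun_upd_other[OF xy(2)[symmetric]] by blast
  then show ?thesis unfolding sat.simps(7)[of M E t w] sat.simps(8) by blast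
qed

context kmodL
begin

lemma K_linear:
  assumes "h \<in> K" "Q \<in> K" "h' \<in> K" "Q' \<in> K" "Hi kk W Cd h Q" "Hi kk W Cd h' Q'" "v \<in> elts h" "v' \<in> elts h'"
  shows "v \<in> elts v' \<or> v = v' \<or> v' \<in> elts v"
proof -
  obtain x y where "v = Lset x" "v' = Lset y" using Hi_level[OF assms(1,2,5,7)] Hi_level[OF assms(3,4,6,8)] by blast
  then show ?thesis using Lset_linear[of x y] Def_self by blast
qed

lemma K_level_trans:
  assumes "h \<in> K" "Q \<in> K" "Hi kk W Cd h Q" "v \<in> elts h" "x \<in> elts v"
  shows "elts x \<subseteq> elts v"
  using Hi_level[OF assms(1-4)] assms(5) Lset_trans by blast

text \<open>The set \<open>h\<close> is closed downwards: a level \<open>v'\<close> in \<open>v\<close> first appears in \<open>Def w\<close> for some \<open>w\<close> in \<open>h\<close>, and linearity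
  leaves only \<open>v' = w\<close>.\<close>

lemma K_down:
  assumes "h \<in> K" "Q \<in> K" "h' \<in> K" "Q' \<in> K" "Hi kk W Cd h Q" "Hi kk W Cd h' Q'" "v \<in> elts h" "v' \<in> elts h'" "v' \<in> elts v"
  shows "v' \<in> elts h"
proof -
  obtain w where w: "w \<in> elts h" "w \<in> elts v" "v' \<notin> elts w" "v' \<in> Def w"
    using assms(5,7,9) unfolding Hi_K[OF assms(1,2)] by blast
  have "v' \<in> elts w \<or> v' = w \<or> w \<in> elts v'" by (rule K_linear[OF assms(3,4,1,2,6,5,8) w(1)])
  moreover have "w \<notin> elts v'"
  proof
    assume "w \<in> elts v'"
    then have "w \<in> elts w" using Def_subset[OF w(4)] by blast
    then show False using V_noself by blast
  qed
  ultimately show ?thesis using w by blast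
qed

end

section \<open>The end extension\<close>

locale ext2 = kmodL \<alpha> for \<alpha> :: "'a::infinite V" +
  fixes N :: "'a V set" and F :: "'a V \<Rightarrow> 'a V \<Rightarrow> bool"
  assumes ee: "end_ext 2 (elts (Lset \<alpha>)) vmem N F"
    and NC: "models N F (Collection Delta0)"
begin

abbreviation nn :: "'a V str" where "nn \<equiv> (N, F)"

lemma K_N: "x \<in> K \<Longrightarrow> x \<in> N"
  using ee unfolding end_ext_def by blast

lemma F_end: "y \<in> K \<Longrightarrow> x \<in> ext nn y \<Longrightarrow> x \<in> K"
  using ee unfolding end_ext_def by (auto simp: ext_def)

lemma ext_n: assumes "y \<in> K" shows "ext nn y = elts y"
proof -
  have "x \<in> ext nn y \<longleftrightarrow> x \<in> K \<and> vmem x y" for x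
    using ee assms unfolding end_ext_def ext_def by auto
  then show ?thesis using K_trans[OF assms] by (auto simp: vmem_def)
qed

lemma Pi2_iff: 
  assumes "p \<in> levy_Pi 2" "range s \<subseteq> K" shows "sat K vmem s p \<longleftrightarrow> sat N F s p"
proof -
  obtain p' where p': "p' \<in> levy_Sigma 2" "\<forall>M E (s :: nat \<Rightarrow> 'a V). sat M E s p \<longleftrightarrow> \<not> sat M E s p'"
    using levy_dual assms(1) by blast
  then have "sat K vmem s p' \<longleftrightarrow> sat N F s p'" using ee assms(2) unfolding end_ext_def by blast
  then show ?thesis using p'(2) by blast
qed

text \<open>Elementarity for represented properties: their constants are standard and become the parameters of a \<open>\<Pi>\<^sub>2\<close> formula.\<close>

lemma transfer: assumes "P2 {kk, nn} (\<lambda>m s. \<Phi> m)" shows "\<Phi> kk \<longleftrightarrow> \<Phi> nn"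
proof -
  obtain q cs where q: "q \<in> levy_Pi 2" "\<forall>m\<in>{kk, nn}. set cs \<subseteq> fst m"
    "\<forall>m\<in>{kk, nn}. \<forall>s. range s \<subseteq> fst m \<longrightarrow> Sat m (env cs s) q \<longleftrightarrow> \<Phi> m"
    using assms unfolding rep_def by blast
  have cs: "set cs \<subseteq> K" using q(2) by simp
  obtain x where x: "x \<in> K" using K_ne by blast
  have r: "range (env cs (\<lambda>_. x)) \<subseteq> K" by (rule range_const_env[OF cs x])
  have "\<Phi> kk \<longleftrightarrow> sat K vmem (env cs (\<lambda>_. x)) q" using q(3)[rule_format, of kk "\<lambda>_. x"] x by auto
  also have "\<dots> \<longleftrightarrow> sat N F (env cs (\<lambda>_. x)) q" by (rule Pi2_iff[OF q(1) r])
  also have "\<dots> \<longleftrightarrow> \<Phi> nn" using q(3)[rule_format, of nn "\<lambda>_. x"] x K_N by auto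
  finally show ?thesis .
qed

lemma tms: "c \<in> K \<Longrightarrow> tm {kk, nn} (\<lambda>s. c)"
  by (rule tm_const) (simp add: K_N)

lemma N_sep_mod: "models N F (Separation Delta0)"
proof -
  have ne: "N \<noteq> {}" using K_N K_ne by blast
  have "sat N F s f" if f: "f \<in> Separation Delta0" and s: "range s \<subseteq> N" for f s
  proof -
    obtain p x y w where p: "f = All w (Ex y (All x (Iff (Mem x y) (Conj (Mem x w) p))))"
      "p \<in> Delta0" "distinct [x, y, w]" using f unfolding Separation_def by blast
    let ?c = "Conj (BAll x y (Conj (Mem x w) p)) (BAll x w (Imp p (Mem x y)))"
    have c: "?c \<in> Delta0" using p by (intro Delta0.intros) auto
    have eq: "sat M E t f \<longleftrightarrow> (\<forall>c\<in>M. sat M E (t(w := c)) (Ex y ?c))" for M E and t :: "nat \<Rightarrow> 'a V"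
      unfolding p(1) by (rule sat_separation[OF p(3)])
    have mk: "models K vmem (Separation Delta0)" using mods unfolding models_def M_theory_def M_minus_def by auto
    have K: "sat K vmem t (Ex y ?c)" if t: "range t \<subseteq> K" for t
    proof -
      have "sat K vmem t f" using mk f t unfolding models_def by blast
      then have "sat K vmem (t(w := t w)) (Ex y ?c)" using t unfolding eq by blast
      then show ?thesis by simp
    qed
    define n where "n = fresh (fv (Ex y ?c))"
    have fvn: "fv (Ex y ?c) \<subseteq> {..<n}" using fresh_gt[OF finite_fv, of _ "Ex y ?c"] by (auto simp: n_def)
    have S: "Ex y ?c \<in> levy_Sigma 1"
    proof -
      have "Ex y ?c = foldr Ex [y] ?c" by simp
      then show ?thesis using c unfolding One_nat_def levy_Sigma.simps levy_Pi.simps by blast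
    qed
    then have P: "foldr All [0..<n] (Ex y ?c) \<in> levy_Pi 2" unfolding numeral_2_eq_2 levy_Pi.simps(2) One_nat_def by blast
    obtain x0 where x0: "x0 \<in> K" using K_ne by blast
    have rk: "range (\<lambda>_. x0) \<subseteq> K" using x0 by auto
    have rn: "range (\<lambda>_. x0) \<subseteq> N" using x0 K_N by auto
    have "sat K vmem (\<lambda>_. x0) (foldr All [0..<n] (Ex y ?c))" unfolding sat_closure[OF fvn rk] using K by blast
    then have "sat N F (\<lambda>_. x0) (foldr All [0..<n] (Ex y ?c))" unfolding Pi2_iff[OF P rk] .
    then have N: "\<forall>t. range t \<subseteq> N \<longrightarrow> sat N F t (Ex y ?c)" unfolding sat_closure[OF fvn rn] .
    have "range (s(w := c)) \<subseteq> N" if "c \<in> N" for c using s that by auto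
    then show ?thesis unfolding eq using N by blast
  qed
  then show ?thesis unfolding models_def using ne by blast
qed

sublocale n0: setm0 nn
proof
  have "P2 {kk, nn} (\<lambda>m s. \<forall>x\<in>fst m. \<forall>y\<in>fst m. (\<forall>u\<in>ext m x. u \<in> ext m y) \<and> (\<forall>u\<in>ext m y. u \<in> ext m x) \<longrightarrow> x = y)"
    by (rule P2_all)+ (rule P2_D0, intro D0_intros tm_intros)
  moreover have "\<forall>x\<in>fst kk. \<forall>y\<in>fst kk. (\<forall>u\<in>ext kk x. u \<in> ext kk y) \<and> (\<forall>u\<in>ext kk y. u \<in> ext kk x) \<longrightarrow> x = y"
    using k0.ext_eq by blast
  ultimately have "\<forall>x\<in>fst nn. \<forall>y\<in>fst nn. (\<forall>u\<in>ext nn x. u \<in> ext nn y) \<and> (\<forall>u\<in>ext nn y. u \<in> ext nn x) \<longrightarrow> x = y"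
    using transfer[where \<Phi> = "\<lambda>m. \<forall>x\<in>fst m. \<forall>y\<in>fst m. (\<forall>u\<in>ext m x. u \<in> ext m y) \<and> (\<forall>u\<in>ext m y. u \<in> ext m x) \<longrightarrow> x = y"] by blast
  then show "x = y" if "x \<in> fst nn" "y \<in> fst nn" "ext nn x = ext nn y" for x y using that by blast
next
  have "P2 {kk, nn} (\<lambda>m s. \<forall>x\<in>fst m. \<forall>y\<in>fst m. \<exists>z\<in>fst m. upr m z x y)"
    by (rule P2_all)+ (rule P2_S1, rule S1_ex, rule S1_D0, intro D0_rels tm_intros)
  moreover have "\<forall>x\<in>fst kk. \<forall>y\<in>fst kk. \<exists>z\<in>fst kk. upr kk z x y" using k0.pairing unfolding k0.upr_iff by blast
  ultimately have "\<forall>x\<in>fst nn. \<forall>y\<in>fst nn. \<exists>z\<in>fst nn. upr nn z x y"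
    using transfer[where \<Phi> = "\<lambda>m. \<forall>x\<in>fst m. \<forall>y\<in>fst m. \<exists>z\<in>fst m. upr m z x y"] by blast
  then show "\<exists>z\<in>fst nn. ext nn z = {x, y}" if "x \<in> fst nn" "y \<in> fst nn" for x y
    using that unfolding upr_def by fast
next
  have "P2 {kk, nn} (\<lambda>m s. \<forall>x\<in>fst m. \<exists>z\<in>fst m. (\<forall>y\<in>ext m x. \<forall>u\<in>ext m y. u \<in> ext m z) \<and> (\<forall>u\<in>ext m z. \<exists>y\<in>ext m x. u \<in> ext m y))"
    by (rule P2_all)+ (rule P2_S1, rule S1_ex, rule S1_D0, intro D0_intros tm_intros)
  moreover have "\<forall>x\<in>fst kk. \<exists>z\<in>fst kk. (\<forall>y\<in>ext kk x. \<forall>u\<in>ext kk y. u \<in> ext kk z) \<and> (\<forall>u\<in>ext kk z. \<exists>y\<in>ext kk x. u \<in> ext kk y)"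
  proof
    fix x assume "x \<in> fst kk"
    then obtain z where z: "z \<in> fst kk" "ext kk z = (\<Union>y\<in>ext kk x. ext kk y)" using k0.union[of x] by blast
    show "\<exists>z\<in>fst kk. (\<forall>y\<in>ext kk x. \<forall>u\<in>ext kk y. u \<in> ext kk z) \<and> (\<forall>u\<in>ext kk z. \<exists>y\<in>ext kk x. u \<in> ext kk y)"
      by (rule bexI[OF _ z(1)]) (unfold z(2), blast)
  qed
  ultimately have *: "\<forall>x\<in>fst nn. \<exists>z\<in>fst nn. (\<forall>y\<in>ext nn x. \<forall>u\<in>ext nn y. u \<in> ext nn z) \<and> (\<forall>u\<in>ext nn z. \<exists>y\<in>ext nn x. u \<in> ext nn y)"
    using transfer[where \<Phi> = "\<lambda>m. \<forall>x\<in>fst m. \<exists>z\<in>fst m. (\<forall>y\<in>ext m x. \<forall>u\<in>ext m y. u \<in> ext m z) \<and> (\<forall>u\<in>ext m z. \<exists>y\<in>ext m x. u \<in> ext m y)"] by blast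
  then show "\<exists>z\<in>fst nn. ext nn z = (\<Union>y\<in>ext nn x. ext nn y)" if x: "x \<in> fst nn" for x
  proof -
    obtain z where z: "z \<in> fst nn" "\<forall>y\<in>ext nn x. \<forall>u\<in>ext nn y. u \<in> ext nn z" "\<forall>u\<in>ext nn z. \<exists>y\<in>ext nn x. u \<in> ext nn y"
      using *[rule_format, OF x] by blast
    then have "ext nn z = (\<Union>y\<in>ext nn x. ext nn y)" by blast
    then show ?thesis using z(1) by blast
  qed
next
  have "P2 {kk, nn} (\<lambda>m s. \<forall>x\<in>fst m. (\<exists>u\<in>ext m x. u = u) \<longrightarrow> (\<exists>y\<in>ext m x. \<forall>u\<in>ext m y. \<not> u \<in> ext m x))"
    by (rule P2_all)+ (rule P2_D0, intro D0_intros tm_intros)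
  moreover have "\<forall>x\<in>fst kk. (\<exists>u\<in>ext kk x. u = u) \<longrightarrow> (\<exists>y\<in>ext kk x. \<forall>u\<in>ext kk y. \<not> u \<in> ext kk x)"
  proof (intro ballI impI)
    fix x assume "x \<in> fst kk" "\<exists>u\<in>ext kk x. u = u"
    then obtain y where "y \<in> ext kk x" "ext kk y \<inter> ext kk x = {}" using k0.founded[of x] by blast
    then show "\<exists>y\<in>ext kk x. \<forall>u\<in>ext kk y. \<not> u \<in> ext kk x" by blast
  qed
  ultimately have "\<forall>x\<in>fst nn. (\<exists>u\<in>ext nn x. u = u) \<longrightarrow> (\<exists>y\<in>ext nn x. \<forall>u\<in>ext nn y. \<not> u \<in> ext nn x)"
    using transfer[where \<Phi> = "\<lambda>m. \<forall>x\<in>fst m. (\<exists>u\<in>ext m x. u = u) \<longrightarrow> (\<exists>y\<in>ext m x. \<forall>u\<in>ext m y. \<not> u \<in> ext m x)"] by blast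
  then show "\<exists>y\<in>ext nn x. ext nn y \<inter> ext nn x = {}" if "x \<in> fst nn" "ext nn x \<noteq> {}" for x
    using that by blast
next
  fix \<Phi> :: "'a V str \<Rightarrow> 'a V \<Rightarrow> bool" and w
  assume "D0 {nn} (\<lambda>m s. \<Phi> m (s 0))" "w \<in> fst nn"
  then show "\<exists>y\<in>fst nn. ext nn y = {x \<in> ext nn w. \<Phi> nn x}"
    using sep_of_models[of nn \<Phi> w] N_sep_mod by simp
next
  fix \<Psi> :: "'a V str \<Rightarrow> 'a V \<Rightarrow> 'a V \<Rightarrow> bool" and w
  assume "D0 {nn} (\<lambda>m s. \<Psi> m (s 0) (s 1))" "w \<in> fst nn" "\<forall>x\<in>ext nn w. \<exists>y\<in>fst nn. \<Psi> nn x y"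
  then show "\<exists>c\<in>fst nn. \<forall>x\<in>ext nn w. \<exists>y\<in>ext nn c. \<Psi> nn x y"
    using coll_of_models[of nn Delta0 \<Psi> w] NC by simp
next
  obtain z where "z \<in> K" "elts z = {}" using k_empty by blast
  then show "\<exists>z\<in>fst nn. ext nn z = {}" using ext_n K_N by (intro bexI[of _ z]) auto
qed

sublocale n: setm nn vnum W
proof
  have v: "vnum k \<in> K" for k using k.num_car by simp
  show "vnum n \<in> fst nn" "ext nn (vnum 0) = {}" "ext nn (vnum (Suc n)) = insert (vnum n) (ext nn (vnum n))" for n
    using v K_N k.num_0 k.num_Suc ext_k[OF v] ext_n[OF v] by auto
  show "W \<in> fst nn" "ext nn W = range vnum" using W K_N ext_n by simp_all
qed

text \<open>Pairs, codes and sequences are computed alike in both structures on standard arguments.\<close>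

lemma pr_std: assumes "x \<in> K" "y \<in> K" shows "n0.pr x y = k0.pr x y"
proof -
  have p: "k0.pr x y \<in> K" "opr kk (k0.pr x y) x y" using k0.opr_pr[of x y] assms by auto
  have "P2 {kk, nn} (\<lambda>m s. opr m (k0.pr x y) x y)"
    by (rule P2_D0, intro D0_rels tms assms p(1))
  then have "opr nn (k0.pr x y) x y" using transfer[where \<Phi> = "\<lambda>m. opr m (k0.pr x y) x y"] p(2) by blast
  then show ?thesis using n0.opr_iff[of x y "k0.pr x y"] assms p(1) K_N by simp
qed

lemma code_std: "n.code d = k.code d"
proof (induction d)
  case (DMem i j) show ?case using k.num_car k0.pr_car by (simp add: pr_std)
next
  case (DEq i j) show ?case using k.num_car k0.pr_car by (simp add: pr_std)
next
  case (DNand d e) then show ?case using k.num_car k0.pr_car k.code_car by (simp add: pr_std)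
next
  case (DEx d) then show ?case using k.num_car k0.pr_car k.code_car by (simp add: pr_std)
qed

lemma sq_std: assumes "set xs \<subseteq> K" shows "n.sq xs = k.sq xs" "k.sq xs \<in> K"
proof -
  show s: "k.sq xs \<in> K" using k.sq_car[of xs] assms by simp
  have "ext nn (k.sq xs) = (\<lambda>i. k0.pr (vnum i) (xs ! i)) ` {..<length xs}"
    using k.sq_ext[of xs] assms ext_n[OF s] ext_k[OF s] by simp
  also have "\<dots> = (\<lambda>i. n0.pr (vnum i) (xs ! i)) ` {..<length xs}"
    using k.num_car nth_mem assms pr_std by (intro image_cong) (auto simp: subset_iff)
  finally show "n.sq xs = k.sq xs" unfolding n.sq_def using K_N[OF s] by (intro n.the_ext) auto
qed

sublocale n: setc nn vnum W Cd
proof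
  show "Cd \<in> fst nn" using Cd(1) K_N by simp
  show "ext nn Cd = range n.code" using Cd ext_n by (simp add: code_std)
qed

text \<open>That \<open>P\<close> contains all subsets of \<open>v\<close> is \<open>\<Pi>\<^sub>1\<close>, so the powerset of a standard set computed in \<open>K\<close> remains the
  powerset in \<open>N\<close>.\<close>

lemma subset_std: assumes "a \<in> N" "v \<in> K" "ext nn a \<subseteq> elts v" shows "a \<in> K"
proof -
  obtain P where P: "P \<in> K" "elts P = {y \<in> K. elts y \<subseteq> elts v}" using k_power[OF assms(2)] by blast
  have "P2 {kk, nn} (\<lambda>m s. \<forall>a\<in>fst m. (\<forall>u\<in>ext m a. u \<in> ext m v) \<longrightarrow> a \<in> ext m P)"
    by (rule P2_all)+ (rule P2_D0, intro D0_intros tms tm_intros assms(2) P(1))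
  moreover have "\<forall>a\<in>fst kk. (\<forall>u\<in>ext kk a. u \<in> ext kk v) \<longrightarrow> a \<in> ext kk P"
    using P assms(2) by (auto simp: ext_k)
  ultimately have "\<forall>a\<in>fst nn. (\<forall>u\<in>ext nn a. u \<in> ext nn v) \<longrightarrow> a \<in> ext nn P"
    using transfer[where \<Phi> = "\<lambda>m. \<forall>a\<in>fst m. (\<forall>u\<in>ext m a. u \<in> ext m v) \<longrightarrow> a \<in> ext m P"] by blast
  then have "a \<in> ext nn P" using assms ext_n[OF assms(2)] by auto
  then show ?thesis using F_end[OF P(1)] by blast
qed

lemma N_SP: assumes "U \<in> N" shows "\<exists>E\<in>N. \<exists>S\<in>N. SP nn W Cd U E S"
proof -
  have "P2 {kk, nn} (\<lambda>m s. \<forall>U\<in>fst m. \<exists>E\<in>fst m. \<exists>S\<in>fst m. SP m W Cd U E S)"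
    by (rule P2_all, rule P2_S1, rule S1_ex, rule S1_ex, rule S1_D0, intro D0_rels tms tm_intros W Cd)
  moreover have "\<forall>U\<in>fst kk. \<exists>E\<in>fst kk. \<exists>S\<in>fst kk. SP kk W Cd U E S" using SP_ex by simp
  ultimately have "\<forall>U\<in>fst nn. \<exists>E\<in>fst nn. \<exists>S\<in>fst nn. SP nn W Cd U E S"
    using transfer[where \<Phi> = "\<lambda>m. \<forall>U\<in>fst m. \<exists>E\<in>fst m. \<exists>S\<in>fst m. SP m W Cd U E S"] by blast
  then show ?thesis using assms by simp
qed

lemma N_level: assumes "z \<in> N" shows "\<exists>h\<in>N. \<exists>Q\<in>N. \<exists>v\<in>N. Hi nn W Cd h Q \<and> v \<in> ext nn h \<and> z \<in> ext nn v"
proof -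
  have "P2 {kk, nn} (\<lambda>m s. \<forall>z\<in>fst m. \<exists>h\<in>fst m. \<exists>Q\<in>fst m. \<exists>v\<in>fst m. Hi m W Cd h Q \<and> v \<in> ext m h \<and> z \<in> ext m v)"
    by (rule P2_all, rule P2_S1, (rule S1_ex)+, rule S1_D0, intro D0_intros D0_rels tms tm_intros W Cd)
  moreover have "\<forall>z\<in>fst kk. \<exists>h\<in>fst kk. \<exists>Q\<in>fst kk. \<exists>v\<in>fst kk. Hi kk W Cd h Q \<and> v \<in> ext kk h \<and> z \<in> ext kk v"
    using in_level ext_k by (metis fst_conv)
  ultimately have "\<forall>z\<in>fst nn. \<exists>h\<in>fst nn. \<exists>Q\<in>fst nn. \<exists>v\<in>fst nn. Hi nn W Cd h Q \<and> v \<in> ext nn h \<and> z \<in> ext nn v"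
    using transfer[where \<Phi> = "\<lambda>m. \<forall>z\<in>fst m. \<exists>h\<in>fst m. \<exists>Q\<in>fst m. \<exists>v\<in>fst m. Hi m W Cd h Q \<and> v \<in> ext m h \<and> z \<in> ext m v"] by blast
  then show ?thesis using assms by simp
qed

text \<open>The facts on levels of \<open>K\<close> are universally quantified \<open>\<Delta>\<^sub>0\<close> statements; they are transferred together.\<close>

lemma N_linear_aux: "\<forall>h\<in>fst nn. \<forall>Q\<in>fst nn. \<forall>h'\<in>fst nn. \<forall>Q'\<in>fst nn. \<forall>v\<in>ext nn h. \<forall>v'\<in>ext nn h'.
    Hi nn W Cd h Q \<and> Hi nn W Cd h' Q' \<longrightarrow> (v \<in> ext nn v' \<or> v = v' \<or> v' \<in> ext nn v) \<and> (v' \<in> ext nn v \<longrightarrow> v' \<in> ext nn h) \<and>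
      (\<forall>x\<in>ext nn v. \<forall>y\<in>ext nn x. y \<in> ext nn v)" (is "?\<Phi> nn")
proof -
  have "P2 {kk, nn} (\<lambda>m s. ?\<Phi> m)"
    by (rule P2_all)+ (rule P2_D0, intro D0_intros D0_rels tms tm_intros W Cd)
  moreover have "?\<Phi> kk"
  proof (intro ballI impI)
    fix h Q h' Q' v v' assume *: "h \<in> fst kk" "Q \<in> fst kk" "h' \<in> fst kk" "Q' \<in> fst kk" "v \<in> ext kk h" "v' \<in> ext kk h'"
      "Hi kk W Cd h Q \<and> Hi kk W Cd h' Q'"
    then have h: "h \<in> K" "Q \<in> K" "h' \<in> K" "Q' \<in> K" "v \<in> elts h" "v' \<in> elts h'" "v \<in> K" "v' \<in> K" "Hi kk W Cd h Q" "Hi kk W Cd h' Q'"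
      using ext_k K_trans by auto
    have "y \<in> elts v" if "x \<in> elts v" "y \<in> ext kk x" for x y
      using K_level_trans[OF h(1,2,9,5) that(1)] that(2) ext_k[of x] K_trans[OF h(7) that(1)] by blast
    then show "(v \<in> ext kk v' \<or> v = v' \<or> v' \<in> ext kk v) \<and> (v' \<in> ext kk v \<longrightarrow> v' \<in> ext kk h) \<and> (\<forall>x\<in>ext kk v. \<forall>y\<in>ext kk x. y \<in> ext kk v)"
      unfolding ext_k[OF h(7)] ext_k[OF h(8)] ext_k[OF h(1)]
      using K_linear[OF h(1-4,9,10,5,6)] K_down[OF h(1-4,9,10,5,6)] by blast
  qed
  ultimately show ?thesis using transfer[where \<Phi> = ?\<Phi>] by blast
qed

text \<open>\<open>v\<close> is a level of \<open>N\<close>, with \<open>(h, Q)\<close> as its package.\<close>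

definition LV :: "'a V \<Rightarrow> 'a V \<Rightarrow> 'a V \<Rightarrow> bool" where
  "LV v h Q \<longleftrightarrow> h \<in> N \<and> Q \<in> N \<and> Hi nn W Cd h Q \<and> v \<in> ext nn h"

lemma LV_N: "LV v h Q \<Longrightarrow> v \<in> N"
  unfolding LV_def using ext_car[of v nn h] by simp

lemma LV_linear: "LV v h Q \<Longrightarrow> LV v' h' Q' \<Longrightarrow> v \<in> ext nn v' \<or> v = v' \<or> v' \<in> ext nn v"
  using N_linear_aux unfolding LV_def by (metis fst_conv)

lemma LV_down: "LV v h Q \<Longrightarrow> LV v' h' Q' \<Longrightarrow> v' \<in> ext nn v \<Longrightarrow> v' \<in> ext nn h"
  using N_linear_aux unfolding LV_def by (metis fst_conv)

lemma LV_trans: "LV v h Q \<Longrightarrow> x \<in> ext nn v \<Longrightarrow> y \<in> ext nn x \<Longrightarrow> y \<in> ext nn v"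
  using N_linear_aux unfolding LV_def by (metis fst_conv)

end

section \<open>Closed elements of the standard model are models\<close>

lemma sat_agree:
  assumes "\<And>x y. x \<in> M \<Longrightarrow> y \<in> M \<Longrightarrow> E x y \<longleftrightarrow> F x y"
  shows "range s \<subseteq> M \<Longrightarrow> sat M E s p \<longleftrightarrow> sat M F s p"
proof (induction p arbitrary: s)
  case (All x p)
  have "sat M E (s(x := a)) p \<longleftrightarrow> sat M F (s(x := a)) p" if "a \<in> M" for a
    by (rule All.IH) (use All.prems that in auto)
  then show ?case by auto
next
  case (Ex x p)
  have "sat M E (s(x := a)) p \<longleftrightarrow> sat M F (s(x := a)) p" if "a \<in> M" for a
    by (rule Ex.IH) (use Ex.prems that in auto)
  then show ?case by auto
qed (use assms in \<open>auto simp: image_subset_iff\<close>)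

lemma fv_foldr_All: "fv (foldr All xs p) = fv p - set xs"
  by (induction xs) auto

lemma Delta0_abs_fv:
  assumes "q \<in> Delta0" "A \<subseteq> fst m" "\<And>x. x \<in> A \<Longrightarrow> ext m x \<subseteq> A" "a \<in> A" "\<forall>i\<in>fv q. s i \<in> A"
  shows "sat A (snd m) s q \<longleftrightarrow> Sat m s q"
proof -
  let ?t = "\<lambda>i. if i \<in> fv q then s i else a"
  have "sat A (snd m) ?t q \<longleftrightarrow> Sat m ?t q"
    by (rule Delta0_abs[OF assms(1-3)]) (use assms(4,5) in auto)
  moreover have "sat A (snd m) ?t q \<longleftrightarrow> sat A (snd m) s q" "Sat m ?t q \<longleftrightarrow> Sat m s q"
    by (rule sat_cong, simp)+
  ultimately show ?thesis by blast
qed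

abbreviation BAlls :: "nat list \<Rightarrow> nat \<Rightarrow> fm \<Rightarrow> fm" where
  "BAlls xs d q \<equiv> foldr (\<lambda>z. BAll z d) xs q"

lemma BAlls_Delta0: "q \<in> Delta0 \<Longrightarrow> d \<notin> set xs \<Longrightarrow> BAlls xs d q \<in> Delta0"
  by (induction xs) (auto intro: Delta0.intros)

lemma fv_BAlls: "fv (BAlls xs d q) \<subseteq> insert d (fv q - set xs)"
  by (induction xs) auto

lemma sat_BAlls:
  assumes "d \<notin> set xs"
  shows "sat M E t (BAlls xs d q) \<longleftrightarrow>
    (\<forall>s'. (\<forall>i. i \<notin> set xs \<longrightarrow> s' i = t i) \<and> s' ` set xs \<subseteq> {a \<in> M. E a (t d)} \<longrightarrow> sat M E s' q)"
  using assms
proof (induction xs arbitrary: t)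
  case Nil
  have "s' = t" if "\<forall>i. s' i = t i" for s' using that by blast
  then show ?case by auto
next
  case (Cons x xs)
  have d: "d \<noteq> x" "d \<notin> set xs" using Cons.prems by auto
  have td: "(t(x := a)) d = t d" for a using d by simp
  note IH = Cons.IH[OF d(2)]
  show ?case
  proof
    assume L: "sat M E t (BAlls (x # xs) d q)"
    show "\<forall>s'. (\<forall>i. i \<notin> set (x # xs) \<longrightarrow> s' i = t i) \<and> s' ` set (x # xs) \<subseteq> {a \<in> M. E a (t d)} \<longrightarrow> sat M E s' q"
    proof (intro allI impI)
      fix s' assume s': "(\<forall>i. i \<notin> set (x # xs) \<longrightarrow> s' i = t i) \<and> s' ` set (x # xs) \<subseteq> {a \<in> M. E a (t d)}"
      then have "sat M E (t(x := s' x)) (BAlls xs d q)" using L d by simp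
      then show "sat M E s' q" unfolding IH td using s' by auto
    qed
  next
    assume R: "\<forall>s'. (\<forall>i. i \<notin> set (x # xs) \<longrightarrow> s' i = t i) \<and> s' ` set (x # xs) \<subseteq> {a \<in> M. E a (t d)} \<longrightarrow> sat M E s' q"
    have "sat M E (t(x := a)) (BAlls xs d q)" if a: "a \<in> M" "E a (t d)" for a
      unfolding IH td
    proof (intro allI impI)
      fix s' assume s': "(\<forall>i. i \<notin> set xs \<longrightarrow> s' i = (t(x := a)) i) \<and> s' ` set xs \<subseteq> {a \<in> M. E a (t d)}"
      then have "s' x \<in> {a \<in> M. E a (t d)}" using a by (cases "x \<in> set xs") auto
      then show "sat M E s' q" using R s' by auto
    qed
    then show "sat M E t (BAlls (x # xs) d q)" using d by simp
  qed
qed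

context kmodL
begin

text \<open>\<open>U\<close> contains witnesses for the true statements \<open>\<exists>y. \<forall>z. q\<close> with \<open>q\<close> in \<open>\<Delta>\<^sub>0\<close>. Single quantifiers suffice,
  because blocks can be bounded by one set.\<close>

definition S2cl :: "'a V set \<Rightarrow> bool" where
  "S2cl U \<longleftrightarrow> (\<forall>q\<in>Delta0. \<forall>i j s. i \<noteq> j \<and> range s \<subseteq> U \<and> (\<exists>y\<in>K. \<forall>z\<in>K. sat K vmem (s(i := y, j := z)) q) \<longrightarrow>
     (\<exists>y\<in>U. \<forall>z\<in>K. sat K vmem (s(i := y, j := z)) q))"

lemma S2cl_D:
  assumes "S2cl U" "q \<in> Delta0" "i \<noteq> j" "range s \<subseteq> U" "y \<in> K" "\<And>z. z \<in> K \<Longrightarrow> sat K vmem (s(i := y, j := z)) q"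
  shows "\<exists>y\<in>U. \<forall>z\<in>K. sat K vmem (s(i := y, j := z)) q"
  using assms unfolding S2cl_def by blast

context
  fixes U x0
  assumes U: "U \<in> K" and tr: "\<And>x. x \<in> elts U \<Longrightarrow> elts x \<subseteq> elts U" and x0: "x0 \<in> elts U"
    and cl: "S2cl (elts U)"
begin

abbreviation uu :: "'a V str" where "uu \<equiv> (elts U, vmem)"

lemma U_K: "x \<in> elts U \<Longrightarrow> x \<in> K"
  using K_trans[OF U] .

lemma U_abs:
  assumes "q \<in> Delta0" "\<forall>i\<in>fv q. s i \<in> elts U" shows "sat (elts U) vmem s q \<longleftrightarrow> sat K vmem s q"
proof -
  have "sat (elts U) (snd kk) s q \<longleftrightarrow> Sat kk s q"
    by (rule Delta0_abs_fv[OF assms(1) _ _ x0 assms(2)]) (use U_K tr ext_k in auto)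
  then show ?thesis by simp
qed

text \<open>Including the structure on \<open>U\<close> among the represented structures forces the constants of the formula into \<open>U\<close>,
  where they may serve as parameters.\<close>

lemma closed_rel:
  assumes D: "D0 {kk, uu} (\<lambda>m s. R m (s 0) (s 1) (s 2) (s 3))" and ab: "a \<in> elts U" "b \<in> elts U"
    and y: "y \<in> K" "\<And>z. z \<in> K \<Longrightarrow> R kk z y a b"
  shows "\<exists>y\<in>elts U. \<forall>z\<in>K. R kk z y a b"
proof -
  obtain q cs where q: "q \<in> Delta0" "\<forall>m\<in>{kk, uu}. set cs \<subseteq> fst m"
    "\<forall>m\<in>{kk, uu}. \<forall>s. range s \<subseteq> fst m \<longrightarrow> Sat m (env cs s) q \<longleftrightarrow> R m (s 0) (s 1) (s 2) (s 3)"
    using D unfolding rep_def by blast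
  let ?l = "length cs" and ?s = "\<lambda>k::nat. if k = 2 then a else b"
  have eq: "(env cs ?s)(Suc ?l := y, ?l := z) = env cs (?s(1 := y, 0 := z))" for y z
  proof
    fix i consider "i < ?l" | "i = ?l" | "i = Suc ?l" | "i > Suc ?l" by linarith
    then show "((env cs ?s)(Suc ?l := y, ?l := z)) i = env cs (?s(1 := y, 0 := z)) i" by cases (auto simp: env_def)
  qed
  have R: "sat K vmem ((env cs ?s)(Suc ?l := y, ?l := z)) q \<longleftrightarrow> R kk z y a b" if "y \<in> K" "z \<in> K" for y z
  proof -
    have "range (?s(1 := y, 0 := z)) \<subseteq> fst kk" using that ab U_K by auto
    then show ?thesis unfolding eq using q(3)[rule_format, of kk "?s(1 := y, 0 := z)"] by simp
  qed
  have r: "range (env cs ?s) \<subseteq> elts U" using q(2) ab nth_mem by (fastforce simp: env_def)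
  have ne: "Suc ?l \<noteq> ?l" by simp
  have "\<exists>y\<in>elts U. \<forall>z\<in>K. sat K vmem ((env cs ?s)(Suc ?l := y, ?l := z)) q"
    by (rule S2cl_D[OF cl q(1) ne r y(1)]) (use R y in blast)
  then show ?thesis using R U_K by blast
qed

lemma closed_rel1:
  assumes D: "D0 {kk, uu} (\<lambda>m s. R m (s 1) (s 2) (s 3))" and ab: "a \<in> elts U" "b \<in> elts U"
    and y: "y \<in> K" "R kk y a b"
  shows "\<exists>y\<in>elts U. R kk y a b"
proof -
  have "\<exists>y\<in>elts U. \<forall>z\<in>K. R kk y a b"
    by (rule closed_rel[where R = "\<lambda>m z y a b. R m y a b", OF D ab y(1)]) (rule y(2))
  then show ?thesis using U by blast
qed

lemma closed_pairing: assumes "a \<in> elts U" "b \<in> elts U" shows "\<exists>z\<in>elts U. elts z = {a, b}"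
proof -
  obtain y where y: "y \<in> K" "elts y = {a, b}" using k_pairing U_K assms by blast
  have "D0 {kk, uu} (\<lambda>m s. upr m (s 1) (s 2) (s 3))" by (intro D0_rels tm_intros)
  then have "\<exists>y\<in>elts U. upr kk y a b"
    by (rule closed_rel1[of "\<lambda>m y a b. upr m y a b", OF _ assms y(1)]) (simp add: k0.upr_iff y ext_k)
  then obtain z where z: "z \<in> elts U" "ext kk z = {a, b}" unfolding k0.upr_iff by blast
  show ?thesis by (rule bexI[OF _ z(1)]) (use z(2) ext_k[OF U_K[OF z(1)]] in simp)
qed

lemma closed_union: assumes "a \<in> elts U" shows "\<exists>z\<in>elts U. elts z = (\<Union>y\<in>elts a. elts y)"
proof -
  let ?R = "\<lambda>m y a. (\<forall>x\<in>ext m a. \<forall>u\<in>ext m x. u \<in> ext m y) \<and> (\<forall>u\<in>ext m y. \<exists>x\<in>ext m a. u \<in> ext m x)"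
  have a: "a \<in> K" using assms U_K by blast
  have R: "?R kk y a \<longleftrightarrow> elts y = (\<Union>y\<in>elts a. elts y)" if "y \<in> K" for y
  proof -
    have "ext kk x = elts x" if "x \<in> elts a" for x using ext_k K_trans[OF a that] by blast
    then show ?thesis unfolding ext_k[OF a] ext_k[OF that] by auto
  qed
  obtain y where y: "y \<in> K" "elts y = (\<Union>y\<in>elts a. elts y)" using k_union a by blast
  have "D0 {kk, uu} (\<lambda>m s. ?R m (s 1) (s 2))" by (intro D0_intros tm_intros)
  then have "\<exists>y\<in>elts U. ?R kk y a"
    by (rule closed_rel1[of "\<lambda>m y a b. ?R m y a", OF _ assms assms y(1)]) (use y R in blast)
  then obtain y' where y': "y' \<in> elts U" "?R kk y' a" by (rule bexE)
  show ?thesis by (rule bexI[OF _ y'(1)]) (rule iffD1[OF R[OF U_K[OF y'(1)]] y'(2)])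
qed

lemma closed_infinity: "\<exists>I\<in>elts U. (\<exists>e\<in>elts I. elts e = {}) \<and> (\<forall>y\<in>elts I. \<exists>y'\<in>elts I. elts y' = insert y (elts y))"
proof -
  let ?R = "\<lambda>m y. (\<exists>e\<in>ext m y. emp m e) \<and> (\<forall>v\<in>ext m y. \<exists>w\<in>ext m y. suc m w v)"
  have R: "?R kk I \<longleftrightarrow> (\<exists>e\<in>elts I. elts e = {}) \<and> (\<forall>y\<in>elts I. \<exists>y'\<in>elts I. elts y' = insert y (elts y))" if I: "I \<in> K" for I
  proof -
    have "ext kk x = elts x" if "x \<in> elts I" for x using ext_k K_trans[OF I that] by blast
    then show ?thesis unfolding ext_k[OF I] k0.suc_iff k0.emp_iff by auto
  qed
  obtain I where I: "I \<in> K" "(\<exists>e\<in>elts I. elts e = {}) \<and> (\<forall>y\<in>elts I. \<exists>y'\<in>elts I. elts y' = insert y (elts y))"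
    using k_infinity by blast
  have "D0 {kk, uu} (\<lambda>m s. ?R m (s 1))" by (intro D0_intros D0_rels tm_intros)
  then have "\<exists>y\<in>elts U. ?R kk y"
    by (rule closed_rel1[of "\<lambda>m y a b. ?R m y", OF _ x0 x0 I(1)]) (use I R in blast)
  then obtain y' where y': "y' \<in> elts U" "?R kk y'" by (rule bexE)
  show ?thesis by (rule bexI[OF _ y'(1)]) (rule iffD1[OF R[OF U_K[OF y'(1)]] y'(2)])
qed

lemma closed_TC: assumes "a \<in> elts U" shows "\<exists>y\<in>elts U. (\<forall>x\<in>elts y. elts x \<subseteq> elts y) \<and> elts a \<subseteq> elts y"
proof -
  let ?R = "\<lambda>m y a. (\<forall>x\<in>ext m y. \<forall>u\<in>ext m x. u \<in> ext m y) \<and> (\<forall>u\<in>ext m a. u \<in> ext m y)"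
  have a: "a \<in> K" using assms U_K by blast
  have R: "?R kk y a \<longleftrightarrow> (\<forall>x\<in>elts y. elts x \<subseteq> elts y) \<and> elts a \<subseteq> elts y" if y: "y \<in> K" for y
  proof -
    have "ext kk x = elts x" if "x \<in> elts y" for x using ext_k K_trans[OF y that] by blast
    then show ?thesis unfolding ext_k[OF a] ext_k[OF y] by auto
  qed
  obtain h Q v where v: "h \<in> K" "Q \<in> K" "v \<in> K" "Hi kk W Cd h Q" "v \<in> elts h" "a \<in> elts v" using in_level[OF a] by blast
  have y: "?R kk v a" unfolding R[OF v(3)] using K_level_trans[OF v(1,2,4,5)] v(6) by blast
  have "D0 {kk, uu} (\<lambda>m s. ?R m (s 1) (s 2))" by (intro D0_intros tm_intros)
  then have "\<exists>y\<in>elts U. ?R kk y a"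
    by (rule closed_rel1[of "\<lambda>m y a b. ?R m y a", OF _ assms assms v(3)]) (rule y)
  then obtain y' where y': "y' \<in> elts U" "?R kk y' a" by (rule bexE)
  show ?thesis by (rule bexI[OF _ y'(1)]) (rule iffD1[OF R[OF U_K[OF y'(1)]] y'(2)])
qed

lemma closed_power: assumes "a \<in> elts U" shows "\<exists>y\<in>elts U. \<forall>z\<in>elts U. z \<in> elts y \<longleftrightarrow> elts z \<subseteq> elts a"
proof -
  let ?R = "\<lambda>m z y a. z \<in> ext m y \<longleftrightarrow> (\<forall>u\<in>ext m z. u \<in> ext m a)"
  have a: "a \<in> K" using assms U_K by blast
  have R: "?R kk z y a \<longleftrightarrow> (z \<in> elts y \<longleftrightarrow> elts z \<subseteq> elts a)" if "y \<in> K" "z \<in> K" for y z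
    unfolding ext_k[OF a] ext_k[OF that(1)] ext_k[OF that(2)] by blast
  obtain y where y: "y \<in> K" "elts y = {z \<in> K. elts z \<subseteq> elts a}" using k_power[OF a] by blast
  have Ry: "?R kk z y a" if "z \<in> K" for z unfolding R[OF y(1) that] using y(2) that by blast
  have "D0 {kk, uu} (\<lambda>m s. ?R m (s 0) (s 1) (s 2))" by (intro D0_intros tm_intros)
  then have "\<exists>y\<in>elts U. \<forall>z\<in>K. ?R kk z y a"
    by (rule closed_rel[of "\<lambda>m z y a b. ?R m z y a", OF _ assms assms y(1)]) (rule Ry)
  then obtain y' where y': "y' \<in> elts U" "\<forall>z\<in>K. ?R kk z y' a" by (rule bexE)
  have "z \<in> elts y' \<longleftrightarrow> elts z \<subseteq> elts a" if z: "z \<in> elts U" for z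
    by (rule iffD1[OF R[OF U_K[OF y'(1)] U_K[OF z]] bspec[OF y'(2) U_K[OF z]]])
  then show ?thesis using y'(1) by blast
qed

text \<open>The set required by the instance exists in \<open>K\<close>, and being that set is a \<open>\<Delta>\<^sub>0\<close> property, so \<open>U\<close> contains it too.\<close>

lemma closed_separation:
  assumes f: "f \<in> Separation Delta0" and s: "range s \<subseteq> elts U" shows "sat (elts U) vmem s f"
proof -
  obtain p x y w where p: "f = All w (Ex y (All x (Iff (Mem x y) (Conj (Mem x w) p))))"
    "p \<in> Delta0" "distinct [x, y, w]" using f unfolding Separation_def by blast
  let ?c = "Conj (BAll x y (Conj (Mem x w) p)) (BAll x w (Imp p (Mem x y)))"
  have c: "?c \<in> Delta0" using p by (intro Delta0.intros) auto
  have "sat (elts U) vmem (s(w := a)) (Ex y ?c)" if a: "a \<in> elts U" for a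
  proof -
    let ?j = "fresh (insert y (fv ?c))"
    have j: "?j \<notin> fv ?c" "y \<noteq> ?j" 
      using fresh_gt[of "insert y (fv ?c)" ?j] fresh_gt[of "insert y (fv ?c)" y] finite_fv[of ?c] by (auto simp del: fv.simps)
    have r: "range (s(w := a)) \<subseteq> elts U" using s a by auto
    have rK: "range s \<subseteq> K" using s U_K by blast
    have "sat K vmem s f" using mods f rK unfolding models_def M_theory_def M_minus_def by blast
    then have "sat K vmem (s(w := a)) (Ex y ?c)" unfolding p(1) sat_separation[OF p(3)] using U_K[OF a] by blast
    then obtain b where b: "b \<in> K" "sat K vmem (s(w := a, y := b)) ?c" by (simp only: sat.simps) blast
    have J: "sat K vmem (s(w := a, y := b, ?j := z)) ?c \<longleftrightarrow> sat K vmem (s(w := a, y := b)) ?c" for b z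
      by (rule sat_cong) (use j in auto)
    have "\<exists>b\<in>elts U. \<forall>z\<in>K. sat K vmem (s(w := a, y := b, ?j := z)) ?c"
      by (rule S2cl_D[OF cl c j(2) r b(1)]) (unfold J, rule b(2))
    then obtain b' where b': "b' \<in> elts U" "sat K vmem (s(w := a, y := b')) ?c" unfolding J using K_ne by blast
    have "sat (elts U) vmem (s(w := a, y := b')) ?c \<longleftrightarrow> sat K vmem (s(w := a, y := b')) ?c"
      by (rule U_abs[OF c]) (use r b'(1) in auto)
    then show ?thesis unfolding sat.simps(8) using b' by blast
  qed
  then show ?thesis unfolding p(1) sat_separation[OF p(3)] by blast
qed

text \<open>Let \<open>p = \<forall>z. q\<close>. If every \<open>x\<close> in \<open>w\<close> has some \<open>y\<close> in \<open>U\<close> with \<open>p\<close> true in \<open>U\<close>, then \<open>p\<close> is true in \<open>K\<close> as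
  well, since \<open>U\<close> would contain a bound for a counterexample. Hence \<open>K\<close> satisfies
  \<open>\<exists>u. \<forall>d. \<forall>x \<in> w. \<exists>y \<in> u. \<forall>z \<in> d. q\<close>, with \<open>U\<close> in the role of \<open>u\<close>. By closure some \<open>u\<close> in \<open>U\<close> does it, and
  for \<open>d = U\<close> it bounds the witnesses in the sense of \<open>U\<close>.\<close>

lemma closed_collection:
  assumes f: "f \<in> Collection (levy_Pi 1)" and s: "range s \<subseteq> elts U" shows "sat (elts U) vmem s f"
proof -
  obtain p x y w c where p: "f = All w (Imp (BAll x w (Ex y p)) (Ex c (BAll x w (BEx y c p))))"
    "p \<in> levy_Pi 1" "distinct [x, y, w, c]" "w \<notin> fv p" "c \<notin> fv p" using f unfolding Collection_def by blast
  obtain xs q where q: "p = foldr All xs q" "q \<in> Delta0" using p(2) unfolding One_nat_def by auto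
  have fvp: "fv p = fv q - set xs" unfolding q(1) by (rule fv_foldr_All)
  let ?V = "fv q \<union> set xs \<union> {x, y, w, c}"
  define u where "u = fresh ?V"
  define d where "d = fresh (insert u ?V)"
  have u: "u \<notin> ?V" using fresh_gt[of ?V u] finite_fv[of q] unfolding u_def by blast
  have d: "d \<notin> insert u ?V" using fresh_gt[of "insert u ?V" d] finite_fv[of q] unfolding d_def by blast
  let ?b = "BAlls xs d q"
  let ?g = "BAll x w (BEx y u ?b)"
  have b: "?b \<in> Delta0" using BAlls_Delta0[OF q(2)] d by blast
  have g: "?g \<in> Delta0" by (intro Delta0.intros b) (use p(3) u in auto)
  have dxs: "d \<notin> set xs" using d by blast
  have fvb: "fv ?b \<subseteq> insert d (fv p)" using fv_BAlls[where xs = xs and d = d and q = q] fvp by blast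
  have abs: "sat (elts U) vmem s' q \<longleftrightarrow> sat K vmem s' q"
    if "\<forall>i\<in>fv p. t i \<in> elts U" "\<forall>i. i \<notin> set xs \<longrightarrow> s' i = t i" "s' ` set xs \<subseteq> elts U" for t s'
  proof (rule U_abs[OF q(2)], rule ballI)
    fix i assume "i \<in> fv q"
    then show "s' i \<in> elts U" using that unfolding fvp by (cases "i \<in> set xs") auto
  qed
  have P: "sat K vmem t ?b \<longleftrightarrow> sat (elts U) vmem t p" if t: "\<forall>i\<in>fv p. t i \<in> elts U" "t d = U" for t
  proof -
    have "{a \<in> K. vmem a (t d)} = elts U" unfolding t(2) vmem_def using U_K by blast
    then show ?thesis unfolding q(1) sat_BAlls[OF dxs] sat_foldr_All using abs[OF t(1)] by metis
  qed
  have Q: "sat K vmem (t(d := d0)) ?b" if t: "\<forall>i\<in>fv p. t i \<in> elts U" "sat (elts U) vmem t p" and d0: "d0 \<in> K" for t d0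
  proof (rule ccontr)
    assume *: "\<not> sat K vmem (t(d := d0)) ?b"
    let ?t = "\<lambda>i. if i \<in> fv p then t i else x0"
    have cong: "sat K vmem (?t(d := e, u := z)) ?b \<longleftrightarrow> sat K vmem (t(d := e)) ?b" for e z
      by (rule sat_cong) (use u d fvb fvp in auto)
    have r: "range ?t \<subseteq> elts U" using t x0 by auto
    have nb: "Neg ?b \<in> Delta0" using b by (rule Delta0.intros)
    have du: "d \<noteq> u" using d by blast
    have "\<exists>e\<in>elts U. \<forall>z\<in>K. sat K vmem (?t(d := e, u := z)) (Neg ?b)"
      by (rule S2cl_D[OF cl nb du r d0]) (unfold sat.simps(3) cong, rule *)
    then obtain e where e: "e \<in> elts U" "\<not> sat K vmem (t(d := e)) ?b" unfolding sat.simps(3) cong using K_ne by blast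
    have "\<exists>s'. (\<forall>i. i \<notin> set xs \<longrightarrow> s' i = (t(d := e)) i) \<and> s' ` set xs \<subseteq> {a \<in> K. vmem a e} \<and> \<not> sat K vmem s' q"
      using e(2) unfolding sat_BAlls[OF dxs] fun_upd_same not_all not_imp conj_assoc .
    then obtain s' where s': "\<forall>i. i \<notin> set xs \<longrightarrow> s' i = (t(d := e)) i" "s' ` set xs \<subseteq> {a \<in> K. vmem a e}" "\<not> sat K vmem s' q"
      by (elim exE conjE)
    let ?s = "\<lambda>i. if i \<in> set xs then s' i else t i"
    have s1: "\<forall>i. i \<notin> set xs \<longrightarrow> ?s i = t i" by simp
    have s2: "?s ` set xs \<subseteq> elts U" using s'(2) tr[OF e(1)] unfolding vmem_def by auto
    have "sat K vmem ?s q \<longleftrightarrow> sat K vmem s' q" by (rule sat_cong) (use s'(1) d in auto)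
    then have "\<not> sat (elts U) vmem ?s q" using s'(3) abs[OF t(1) s1 s2] by blast
    moreover have "(\<forall>i. i \<notin> set xs \<longrightarrow> ?s i = t i) \<and> ?s ` set xs \<subseteq> elts U" using s1 s2 by blast
    then have "sat (elts U) vmem ?s q" by (rule t(2)[unfolded q(1) sat_foldr_All, rule_format])
    ultimately show False by blast
  qed
  have xy: "x \<noteq> y" "x \<noteq> w" "x \<noteq> c" "y \<noteq> w" "y \<noteq> c" "w \<noteq> c" "u \<noteq> x" "u \<noteq> y" "u \<noteq> w" "u \<noteq> c" "d \<noteq> x" "d \<noteq> y" "d \<noteq> w" "d \<noteq> c" "u \<noteq> d"
    using p(3) u d by auto
  have ufv: "u \<notin> fv p" "d \<notin> fv p" using u d unfolding fvp by auto
  have "sat (elts U) vmem (s(w := w0)) (Ex c (BAll x w (BEx y c p)))"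
    if w0: "w0 \<in> elts U" and H: "sat (elts U) vmem (s(w := w0)) (BAll x w (Ex y p))" for w0
  proof -
    let ?t = "s(w := w0)"
    have r: "range ?t \<subseteq> elts U" using s w0 by auto
    have H': "\<exists>b\<in>elts U. sat (elts U) vmem (?t(x := a, y := b)) p" if a: "a \<in> elts w0" for a
    proof -
      have "a \<in> elts U" using tr[OF w0] a by blast
      then show ?thesis using H a xy by (simp add: vmem_def)
    qed
    have W: "sat K vmem (?t(u := U, d := z)) ?g" if z: "z \<in> K" for z
    proof -
      have "\<exists>b\<in>K. vmem b U \<and> sat K vmem (?t(u := U, d := z, x := a, y := b)) ?b" if a: "a \<in> elts w0" for a
      proof -
        obtain b where b: "b \<in> elts U" "sat (elts U) vmem (?t(x := a, y := b)) p" using H'[OF a] by blast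
        have au: "a \<in> elts U" using tr[OF w0] a by blast
        have "sat K vmem (?t(x := a, y := b, d := z)) ?b" by (rule Q[OF _ b(2) z]) (use r au b(1) in auto)
        moreover have "sat K vmem (?t(x := a, y := b, d := z)) ?b \<longleftrightarrow> sat K vmem (?t(u := U, d := z, x := a, y := b)) ?b"
          by (rule sat_cong) (use fvb ufv xy in auto)
        ultimately show ?thesis using b(1) U_K unfolding vmem_def by blast
      qed
      then show ?thesis using xy by (simp add: vmem_def)
    qed
    obtain u0 where u0: "u0 \<in> elts U" "\<forall>z\<in>K. sat K vmem (?t(u := u0, d := z)) ?g"
      using S2cl_D[OF cl g xy(15) r U W] by blast
    \<comment> \<open>This is the instance in which the block of universal quantifiers ranges over exactly \<open>U\<close>.\<close>
    have g0: "sat K vmem (?t(u := u0, d := U)) ?g" using u0(2) U by blast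
    have fin: "\<exists>b\<in>elts U. vmem b u0 \<and> sat (elts U) vmem (?t(c := u0, x := a, y := b)) p" if a: "a \<in> elts w0" for a
    proof -
      have au: "a \<in> elts U" using tr[OF w0] a by blast
      obtain b where b: "vmem b u0" "sat K vmem (?t(u := u0, d := U, x := a, y := b)) ?b"
        using g0 a au U_K[OF au] xy by (auto simp: vmem_def)
      have bu: "b \<in> elts U" using b(1) tr[OF u0(1)] unfolding vmem_def by blast
      have "sat (elts U) vmem (?t(u := u0, d := U, x := a, y := b)) p"
        by (rule iffD1[OF P b(2)]) (use r au bu ufv xy in auto)
      moreover have "sat (elts U) vmem (?t(u := u0, d := U, x := a, y := b)) p \<longleftrightarrow> sat (elts U) vmem (?t(c := u0, x := a, y := b)) p"
        by (rule sat_cong) (use ufv p(5) in auto)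
      ultimately show ?thesis using bu b(1) by blast
    qed
    have "sat (elts U) vmem (?t(c := u0)) (BAll x w (BEx y c p))" using fin xy by (simp add: vmem_def)
    then show ?thesis using u0(1) by (simp only: sat.simps) blast
  qed
  then show ?thesis unfolding p(1) sat.simps(7)[of _ _ s w] sat.simps(6) by blast
qed

lemma closed_models: "models (elts U) vmem (M_theory \<union> Collection (levy_Pi 1))"
proof -
  let ?u = "elts U"
  have "sat ?u vmem s p" if p: "p \<in> M_theory \<union> Collection (levy_Pi 1)" and s: "range s \<subseteq> ?u" for s p
  proof -
    have 1: "sat ?u vmem s ax_Extensionality"
    proof -
      have "\<forall>a\<in>?u. \<forall>b\<in>?u. (\<forall>x\<in>?u. (x \<in> elts a \<longrightarrow> x \<in> elts b) \<and> (x \<in> elts b \<longrightarrow> x \<in> elts a)) \<longrightarrow> a = b"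
      proof (intro ballI impI V_ext)
        fix a b assume "a \<in> ?u" "b \<in> ?u" "\<forall>x\<in>?u. (x \<in> elts a \<longrightarrow> x \<in> elts b) \<and> (x \<in> elts b \<longrightarrow> x \<in> elts a)"
        then show "elts a = elts b" using tr[of a] tr[of b] by blast
      qed
      then show ?thesis unfolding ax_Extensionality_def by (simp add: vmem_def)
    qed
    have 2: "sat ?u vmem s ax_Pair"
    proof -
      have "\<forall>a\<in>?u. \<forall>b\<in>?u. \<exists>z\<in>?u. \<forall>x\<in>?u. (x \<in> elts z \<longrightarrow> x = a \<or> x = b) \<and> (x = a \<or> x = b \<longrightarrow> x \<in> elts z)"
      proof (intro ballI)
        fix a b assume "a \<in> ?u" "b \<in> ?u"
        then obtain z where z: "z \<in> ?u" "elts z = {a, b}" using closed_pairing by blast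
        show "\<exists>z\<in>?u. \<forall>x\<in>?u. (x \<in> elts z \<longrightarrow> x = a \<or> x = b) \<and> (x = a \<or> x = b \<longrightarrow> x \<in> elts z)"
          by (rule bexI[OF _ z(1)]) (simp add: z(2))
      qed
      then show ?thesis unfolding ax_Pair_def by (simp add: vmem_def)
    qed
    have 3: "sat ?u vmem s ax_Union"
    proof -
      have "\<forall>a\<in>?u. \<exists>z\<in>?u. \<forall>x\<in>?u. (x \<in> elts z \<longrightarrow> (\<exists>y\<in>?u. y \<in> elts a \<and> x \<in> elts y)) \<and> ((\<exists>y\<in>?u. y \<in> elts a \<and> x \<in> elts y) \<longrightarrow> x \<in> elts z)"
      proof
        fix a assume a: "a \<in> ?u"
        then obtain z where z: "z \<in> ?u" "elts z = (\<Union>y\<in>elts a. elts y)" using closed_union by blast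
        have "(x \<in> elts z \<longrightarrow> (\<exists>y\<in>?u. y \<in> elts a \<and> x \<in> elts y)) \<and> ((\<exists>y\<in>?u. y \<in> elts a \<and> x \<in> elts y) \<longrightarrow> x \<in> elts z)" for x
          unfolding z(2) using tr[OF a] by blast
        then show "\<exists>z\<in>?u. \<forall>x\<in>?u. (x \<in> elts z \<longrightarrow> (\<exists>y\<in>?u. y \<in> elts a \<and> x \<in> elts y)) \<and> ((\<exists>y\<in>?u. y \<in> elts a \<and> x \<in> elts y) \<longrightarrow> x \<in> elts z)"
          using z(1) by blast
      qed
      then show ?thesis unfolding ax_Union_def by (simp add: vmem_def)
    qed
    obtain I where I: "I \<in> ?u" "\<exists>e\<in>elts I. elts e = {}" "\<forall>y\<in>elts I. \<exists>y'\<in>elts I. elts y' = insert y (elts y)"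
      using closed_infinity by blast
    have 4: "sat ?u vmem s ax_Emptyset"
    proof -
      have "\<exists>e\<in>?u. \<forall>x\<in>?u. x \<notin> elts e" using I(2) tr[OF I(1)] by blast
      then show ?thesis unfolding ax_Emptyset_def by (simp add: vmem_def)
    qed
    have 5: "sat ?u vmem s ax_Infinity"
    proof -
      have "(\<exists>e\<in>?u. e \<in> elts I \<and> (\<forall>x\<in>?u. x \<notin> elts e)) \<and> (\<forall>y\<in>?u. y \<in> elts I \<longrightarrow> (\<exists>y'\<in>?u. y' \<in> elts I \<and>
          (\<forall>x\<in>?u. (x \<in> elts y' \<longrightarrow> x \<in> elts y \<or> x = y) \<and> (x \<in> elts y \<or> x = y \<longrightarrow> x \<in> elts y'))))"
      proof (intro conjI ballI impI)
        show "\<exists>e\<in>?u. e \<in> elts I \<and> (\<forall>x\<in>?u. x \<notin> elts e)" using I(2) tr[OF I(1)] by blast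
        fix y assume "y \<in> elts I"
        then obtain y' where y': "y' \<in> elts I" "elts y' = insert y (elts y)" using I(3) by blast
        show "\<exists>y'\<in>?u. y' \<in> elts I \<and> (\<forall>x\<in>?u. (x \<in> elts y' \<longrightarrow> x \<in> elts y \<or> x = y) \<and> (x \<in> elts y \<or> x = y \<longrightarrow> x \<in> elts y'))"
          by (rule bexI[of _ y']) (use y' tr[OF I(1)] in auto)
      qed
      then show ?thesis unfolding ax_Infinity_def using I(1) by (simp add: vmem_def) blast
    qed
    have 6: "sat ?u vmem s ax_TCo"
    proof -
      have "\<forall>a\<in>?u. \<exists>y\<in>?u. (\<forall>x\<in>?u. x \<in> elts y \<longrightarrow> (\<forall>v\<in>?u. v \<in> elts x \<longrightarrow> v \<in> elts y)) \<and> (\<forall>x\<in>?u. x \<in> elts a \<longrightarrow> x \<in> elts y)"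
      proof
        fix a assume "a \<in> ?u"
        then obtain y where y: "y \<in> ?u" "\<forall>x\<in>elts y. elts x \<subseteq> elts y" "elts a \<subseteq> elts y" using closed_TC by blast
        show "\<exists>y\<in>?u. (\<forall>x\<in>?u. x \<in> elts y \<longrightarrow> (\<forall>v\<in>?u. v \<in> elts x \<longrightarrow> v \<in> elts y)) \<and> (\<forall>x\<in>?u. x \<in> elts a \<longrightarrow> x \<in> elts y)"
          by (rule bexI[OF _ y(1)]) (use y(2,3) in blast)
      qed
      then show ?thesis unfolding ax_TCo_def by (simp add: vmem_def)
    qed
    have 7: "sat ?u vmem s ax_Set_Foundation"
    proof -
      have "\<forall>a\<in>?u. (\<exists>y\<in>?u. y \<in> elts a) \<longrightarrow> (\<exists>y\<in>?u. y \<in> elts a \<and> (\<forall>z\<in>?u. z \<in> elts a \<longrightarrow> z \<notin> elts y))"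
      proof (intro ballI impI)
        fix a assume a: "a \<in> ?u" "\<exists>y\<in>?u. y \<in> elts a"
        obtain y where y: "y \<in> ext kk a" "ext kk y \<inter> ext kk a = {}"
          using k0.founded[of a] a ext_k[OF U_K[OF a(1)]] U_K by auto
        have ya: "y \<in> elts a" "y \<in> K" "y \<in> ?u" using y(1) ext_k[OF U_K[OF a(1)]] tr[OF a(1)] U_K by auto
        then show "\<exists>y\<in>?u. y \<in> elts a \<and> (\<forall>z\<in>?u. z \<in> elts a \<longrightarrow> z \<notin> elts y)"
          using y(2) unfolding ext_k[OF U_K[OF a(1)]] ext_k[OF ya(2)] by blast
      qed
      then show ?thesis unfolding ax_Set_Foundation_def by (simp add: vmem_def)
    qed
    have 8: "sat ?u vmem s ax_Powerset"
    proof -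
      have "\<forall>a\<in>?u. \<exists>y\<in>?u. \<forall>z\<in>?u. (z \<in> elts y \<longrightarrow> (\<forall>v\<in>?u. v \<in> elts z \<longrightarrow> v \<in> elts a)) \<and> ((\<forall>v\<in>?u. v \<in> elts z \<longrightarrow> v \<in> elts a) \<longrightarrow> z \<in> elts y)"
      proof
        fix a assume "a \<in> ?u"
        then obtain y where y: "y \<in> ?u" "\<forall>z\<in>?u. z \<in> elts y \<longleftrightarrow> elts z \<subseteq> elts a" using closed_power by blast
        have "(\<forall>v\<in>?u. v \<in> elts z \<longrightarrow> v \<in> elts a) \<longleftrightarrow> elts z \<subseteq> elts a" if "z \<in> ?u" for z using tr[OF that] by blast
        then show "\<exists>y\<in>?u. \<forall>z\<in>?u. (z \<in> elts y \<longrightarrow> (\<forall>v\<in>?u. v \<in> elts z \<longrightarrow> v \<in> elts a)) \<and> ((\<forall>v\<in>?u. v \<in> elts z \<longrightarrow> v \<in> elts a) \<longrightarrow> z \<in> elts y)"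
          by (intro bexI[OF _ y(1)]) (use y(2) in simp)
      qed
      then show ?thesis unfolding ax_Powerset_def by (simp add: vmem_def)
    qed
    show ?thesis using p 1 2 3 4 5 6 7 8 closed_separation[OF _ s] closed_collection[OF _ s]
      unfolding M_theory_def M_minus_def by blast
  qed
  then show ?thesis unfolding models_def using x0 by blast
qed

end

end

section \<open>Contradictions with minimality\<close>

locale ext_min = ext2 +
  assumes minim: "\<And>K'. transitive K' \<Longrightarrow> models (elts K') vmem (M_theory \<union> Collection (levy_Pi 1)) \<Longrightarrow> K \<subseteq> elts K'"
begin

lemma no_small_model:
  assumes "U \<in> K" "\<And>x. x \<in> elts U \<Longrightarrow> elts x \<subseteq> elts U" "models (elts U) vmem (M_theory \<union> Collection (levy_Pi 1))"
  shows False
proof -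
  have "K \<subseteq> elts U" by (rule minim[OF _ assms(3)]) (use assms(2) in \<open>auto simp: transitive_def\<close>)
  then show False using assms(1) V_noself by blast
qed

lemma no_closed:
  assumes "U \<in> K" "\<And>x. x \<in> elts U \<Longrightarrow> elts x \<subseteq> elts U" "x0 \<in> elts U" "S2cl (elts U)"
  shows False
  by (rule no_small_model[OF assms(1,2) closed_models[OF assms]])

text \<open>The theory of \<open>K\<close> would be coded by a standard set \<open>\<theta>\<close> and be realised by a transitive element of \<open>K\<close>.
  Sentences are coded as formulae evaluated at the empty list.\<close>

lemma not_internal: assumes "u \<in> N" shows "ext nn u \<noteq> K"
proof
  assume u: "ext nn u = K"
  obtain E S where ES: "E \<in> N" "S \<in> N" "SP nn W Cd u E S" using N_SP[OF assms] by blast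
  let ?e = "k.sq []"
  have e: "?e \<in> K" "n.sq [] = ?e" using sq_std[of "[]"] by auto
  have "D0 {nn} (\<lambda>m s. inP m S (s 0) ?e)"
    by (intro D0_rels tm_single tm_intros) (use ES e K_N in simp_all)
  then have "\<exists>\<theta>\<in>fst nn. ext nn \<theta> = {c \<in> ext nn Cd. inP nn S c ?e}"
    by (rule n0.sep[where \<Phi> = "\<lambda>m c. inP m S c ?e"]) (use Cd K_N in simp)
  then obtain \<theta> where \<theta>: "\<theta> \<in> N" "ext nn \<theta> = {c \<in> ext nn Cd. inP nn S c ?e}" by auto
  have \<theta>K: "\<theta> \<in> K" by (rule subset_std[OF \<theta>(1) Cd(1)]) (use \<theta>(2) ext_n[OF Cd(1)] in blast)
  let ?\<Phi> = "\<lambda>m :: 'a V str. \<exists>u\<in>fst m. \<exists>E\<in>fst m. \<exists>S\<in>fst m. (\<forall>x\<in>ext m u. \<forall>y\<in>ext m x. y \<in> ext m u) \<and> (\<exists>x\<in>ext m u. x = x) \<and>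
     SP m W Cd u E S \<and> (\<forall>c\<in>ext m Cd. c \<in> ext m \<theta> \<longleftrightarrow> inP m S c ?e)"
  have "P2 {kk, nn} (\<lambda>m s. ?\<Phi> m)"
    by (rule P2_S1, (rule S1_ex)+, rule S1_D0, intro D0_intros D0_rels tms tm_intros W Cd \<theta>K e)
  moreover have "?\<Phi> nn"
  proof (rule bexI[of _ u], rule bexI[of _ E], rule bexI[of _ S], intro conjI)
    show "\<forall>x\<in>ext nn u. \<forall>y\<in>ext nn x. y \<in> ext nn u" unfolding u using F_end by blast
    show "\<exists>x\<in>ext nn u. x = x" unfolding u using K_ne by blast
    show "\<forall>c\<in>ext nn Cd. c \<in> ext nn \<theta> \<longleftrightarrow> inP nn S c ?e" unfolding \<theta>(2) by blast
  qed (use ES assms in simp_all)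
  ultimately have "?\<Phi> kk" using transfer[where \<Phi> = ?\<Phi>] by blast
  then obtain u' E' S' where u': "u' \<in> K" "E' \<in> K" "S' \<in> K" "\<forall>x\<in>ext kk u'. \<forall>y\<in>ext kk x. y \<in> ext kk u'"
     "\<exists>x\<in>ext kk u'. x = x" "SP kk W Cd u' E' S'" "\<forall>c\<in>ext kk Cd. c \<in> ext kk \<theta> \<longleftrightarrow> inP kk S' c ?e" by auto
  have eu: "ext kk u' = elts u'" using ext_k u'(1) by blast
  have tr: "elts x \<subseteq> elts u'" if "x \<in> elts u'" for x
    using u'(4) that ext_k[OF K_trans[OF u'(1) that]] unfolding eu by blast
  have d: "dsat (elts u') vmem d [] \<longleftrightarrow> dsat K F d []" for d
  proof -
    have c: "k.code d \<in> elts Cd" using Cd by simp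
    have "dsat (elts u') vmem d [] \<longleftrightarrow> inP kk S' (k.code d) ?e"
      using k.SP_S[OF u'(6), of "[]" d] u'(1-3) eu by simp
    also have "\<dots> \<longleftrightarrow> k.code d \<in> elts \<theta>" using u'(7) c ext_k[OF Cd(1)] ext_k[OF \<theta>K] by blast
    also have "\<dots> \<longleftrightarrow> inP nn S (k.code d) ?e" using \<theta>(2) c ext_n[OF Cd(1)] ext_n[OF \<theta>K] by blast
    also have "\<dots> \<longleftrightarrow> dsat K F d []"
      using n.SP_S[OF ES(3), of "[]" d] ES assms u e(2) by (simp add: code_std)
    finally show ?thesis .
  qed
  obtain x0 where x0: "x0 \<in> K" using K_ne by blast
  have KF: "vmem x y \<longleftrightarrow> F x y" if "x \<in> K" "y \<in> K" for x y using ee that unfolding end_ext_def by blast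
  have "sat (elts u') vmem s p" if p: "p \<in> M_theory \<union> Collection (levy_Pi 1)" and s: "range s \<subseteq> elts u'" for p s
  proof -
    define n where "n = fresh (fv p)"
    have fvn: "fv p \<subseteq> {..<n}" using fresh_gt[OF finite_fv, of _ p] by (auto simp: n_def)
    let ?p = "foldr All [0..<n] p"
    have fv: "fv ?p = {}" using fvn unfolding fv_foldr_All by auto
    let ?d = "enc ?p id (length ([] :: 'a V list))"
    have r0: "range (\<lambda>_::nat. x0) \<subseteq> K" using x0 by auto
    \<comment> \<open>An axiom with free variables is read as its closure, which is a sentence and thus has a code in \<open>\<theta>\<close> or not.\<close>
    have "sat K vmem (\<lambda>_. x0) ?p" unfolding sat_closure[OF fvn r0] using mods p unfolding models_def by blast
    then have "sat K F (\<lambda>_. x0) ?p" using sat_agree[of K vmem F, OF KF r0] by blast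
    then have "dsat K F ?d []" using dsat_enc[of ?p id "[]" "\<lambda>_. x0" K F] fv by simp
    then have "dsat (elts u') vmem ?d []" using d by blast
    then have "sat (elts u') vmem s ?p" using dsat_enc[of ?p id "[]" s "elts u'" vmem] fv by simp
    then show ?thesis unfolding sat_closure[OF fvn s] using s by blast
  qed
  then have "models (elts u') vmem (M_theory \<union> Collection (levy_Pi 1))" unfolding models_def using u'(5) eu by auto
  then show False using no_small_model[OF u'(1) tr] by blast
qed

end

section \<open>Levels of the end extension\<close>

definition APP where
  "APP m W e e' y V \<longleftrightarrow> (\<exists>n\<in>ext m W. fn m e n V \<and> appn m e' e n y)"

lemma D0_APP: "tm \<M> W \<Longrightarrow> tm \<M> e \<Longrightarrow> tm \<M> e' \<Longrightarrow> tm \<M> y \<Longrightarrow> tm \<M> V \<Longrightarrow> D0 \<M> (\<lambda>m s. APP m (W s) (e s) (e' s) (y s) (V s))"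
  unfolding APP_def by (intro D0_intros D0_rels tm_intros)

text \<open>The formula \<open>c\<close> holds of the sequence \<open>e\<close> extended by \<open>y\<close> in some level. This is a \<open>\<Sigma>\<^sub>1\<close> property without any bound on
  the level.\<close>

definition true_at_level where
  "true_at_level m W Cd c e y \<longleftrightarrow> (\<exists>h\<in>fst m. \<exists>Q\<in>fst m. \<exists>v\<in>fst m. \<exists>e'\<in>fst m.
     Hi m W Cd h Q \<and> v \<in> ext m h \<and> APP m W e e' y v \<and> TQ m W Cd h Q v c e')"

context setc
begin

text \<open>The length of a sequence and a set containing its entries can be read off the sequence.\<close>

lemma fn_sq_sub:
  assumes "V \<in> fst m" "set xs \<subseteq> fst m" "fn m (sq xs) n V" "n \<in> ext m W" shows "set xs \<subseteq> ext m V" "n = num (length xs)"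
proof -
  obtain k where k: "n = num k" using assms(4) W_ext by auto
  obtain ys where ys: "set ys \<subseteq> ext m V" "length ys = k" "sq xs = sq ys"
    using fn_list[of "sq xs" V k] assms k sq_car[OF assms(2)] by blast
  have "set ys \<subseteq> fst m" using ys(1) ext_car[of _ m V] by blast
  then have "xs = ys" using sq_inj[OF assms(2)] ys(3) by blast
  then show "set xs \<subseteq> ext m V" "n = num (length xs)" using ys k by simp_all
qed

lemma APP_iff:
  assumes "V \<in> fst m" "set xs \<subseteq> fst m" "e' \<in> fst m" "y \<in> fst m"
  shows "APP m W (sq xs) e' y V \<longleftrightarrow> set xs \<subseteq> ext m V \<and> e' = sq (xs @ [y])"
proof
  assume "APP m W (sq xs) e' y V"
  then obtain n where n: "n \<in> ext m W" "fn m (sq xs) n V" "appn m e' (sq xs) n y" unfolding APP_def by blast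
  note f = fn_sq_sub[OF assms(1,2) n(2,1)]
  show "set xs \<subseteq> ext m V \<and> e' = sq (xs @ [y])"
    using f(1) n(3) appn_iff[OF assms(2,4,3)] unfolding f(2) by blast
next
  assume *: "set xs \<subseteq> ext m V \<and> e' = sq (xs @ [y])"
  have "num (length xs) \<in> ext m W" using W_ext by simp
  moreover have "fn m (sq xs) (num (length xs)) V" using fn_sq * by blast
  moreover have "appn m e' (sq xs) (num (length xs)) y" using appn_iff[OF assms(2,4,3)] * by blast
  ultimately show "APP m W (sq xs) e' y V" unfolding APP_def by blast
qed

lemma true_at_level_iff:
  assumes xs: "set xs \<subseteq> fst m" and y: "y \<in> fst m"
  shows "true_at_level m W Cd (code d) (sq xs) y \<longleftrightarrow> (\<exists>h\<in>fst m. \<exists>Q\<in>fst m. \<exists>v. Hi m W Cd h Q \<and> v \<in> ext m h \<and>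
    set (xs @ [y]) \<subseteq> ext m v \<and> dsat (ext m v) (snd m) d (xs @ [y]))"
proof -
  have sy: "set (xs @ [y]) \<subseteq> fst m" using xs y by simp
  show ?thesis
  proof
    assume "true_at_level m W Cd (code d) (sq xs) y"
    then obtain h Q v e' where *: "h \<in> fst m" "Q \<in> fst m" "v \<in> fst m" "e' \<in> fst m" "Hi m W Cd h Q" "v \<in> ext m h"
      "APP m W (sq xs) e' y v" "TQ m W Cd h Q v (code d) e'" unfolding true_at_level_def by blast
    have e': "e' = sq (xs @ [y])" using APP_iff[OF *(3) xs *(4) y] *(7) by blast
    show "\<exists>h\<in>fst m. \<exists>Q\<in>fst m. \<exists>v. Hi m W Cd h Q \<and> v \<in> ext m h \<and>
        set (xs @ [y]) \<subseteq> ext m v \<and> dsat (ext m v) (snd m) d (xs @ [y])"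
      using *(1,2,5,6) *(8)[unfolded e' TQ_iff[OF *(5,6) sy]] by blast
  next
    assume "\<exists>h\<in>fst m. \<exists>Q\<in>fst m. \<exists>v. Hi m W Cd h Q \<and> v \<in> ext m h \<and>
        set (xs @ [y]) \<subseteq> ext m v \<and> dsat (ext m v) (snd m) d (xs @ [y])"
    then obtain h Q v where *: "h \<in> fst m" "Q \<in> fst m" "Hi m W Cd h Q" "v \<in> ext m h"
      "set (xs @ [y]) \<subseteq> ext m v" "dsat (ext m v) (snd m) d (xs @ [y])" by blast
    have v: "v \<in> fst m" using ext_car[of v m h] *(4) by blast
    have e: "sq (xs @ [y]) \<in> fst m" using sq_car[OF sy] .
    have "APP m W (sq xs) (sq (xs @ [y])) y v" using APP_iff[OF v xs e y] *(5) by simp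
    moreover have "TQ m W Cd h Q v (code d) (sq (xs @ [y]))" using TQ_iff[OF *(3,4) sy] *(5,6) by blast
    ultimately show "true_at_level m W Cd (code d) (sq xs) y" unfolding true_at_level_def using *(1-4) v e by blast
  qed
qed

end

context ext2
begin

lemma tmn: "c \<in> N \<Longrightarrow> tm {nn} (\<lambda>s. c)"
  by (rule tm_single) simp

lemma Hi_std: assumes "h \<in> K" "Q \<in> K" "Hi kk W Cd h Q" shows "Hi nn W Cd h Q"
proof -
  have "P2 {kk, nn} (\<lambda>m s. Hi m W Cd h Q)" by (rule P2_D0, intro D0_rels tms W Cd assms)
  then show ?thesis using transfer[where \<Phi> = "\<lambda>m. Hi m W Cd h Q"] assms(3) by blast
qed

lemma LV_std: assumes "h \<in> K" "Q \<in> K" "Hi kk W Cd h Q" "v \<in> ext kk h" shows "LV v h Q"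
  using assms Hi_std[OF assms(1-3)] ext_n[OF assms(1)] ext_k[OF assms(1)] K_N unfolding LV_def by simp

lemma std_level: assumes "z \<in> K" shows "\<exists>v h Q. v \<in> K \<and> z \<in> elts v \<and> LV v h Q"
proof -
  obtain h Q v where v: "h \<in> K" "Q \<in> K" "v \<in> K" "Hi kk W Cd h Q" "v \<in> elts h" "z \<in> elts v" using in_level[OF assms] by blast
  have "LV v h Q" by (rule LV_std[OF v(1,2,4)]) (use v(5) ext_k[OF v(1)] in simp)
  then show ?thesis using v by blast
qed

lemma nonstd_contains: assumes "LV v h Q" "v \<notin> K" "z \<in> K" shows "z \<in> ext nn v"
proof -
  obtain v' h' Q' where v': "v' \<in> K" "z \<in> elts v'" "LV v' h' Q'" using std_level[OF assms(3)] by blast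
  have "v \<notin> ext nn v'" using F_end[OF v'(1)] assms(2) by blast
  then have "v' \<in> ext nn v" using LV_linear[OF v'(3) assms(1)] v'(1) assms(2) by blast
  then show ?thesis using LV_trans[OF assms(1), of v' z] v'(2) ext_n[OF v'(1)] by blast
qed

lemma std_in_h: assumes "LV v h Q" "v \<notin> K" "LV v' h' Q'" "v' \<in> K" shows "LV v' h Q"
  using LV_down[OF assms(1,3) nonstd_contains[OF assms(1,2,4)]] assms(1) unfolding LV_def by blast

definition holds_at :: "'a V \<Rightarrow> dfm \<Rightarrow> 'a V list \<Rightarrow> bool" where
  "holds_at b d xs \<longleftrightarrow> set xs \<subseteq> ext nn b \<and> dsat (ext nn b) F d xs"

lemma TQ_LV: assumes "LV b h Q" "set xs \<subseteq> N" shows "TQ nn W Cd h Q b (n.code d) (n.sq xs) \<longleftrightarrow> holds_at b d xs"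
  using n.TQ_iff[of h Q b xs d] assms unfolding LV_def holds_at_def by simp

lemma true_at_level_N: assumes "set xs \<subseteq> N" "y \<in> N" 
  shows "true_at_level nn W Cd (n.code d) (n.sq xs) y \<longleftrightarrow> (\<exists>b h Q. LV b h Q \<and> holds_at b d (xs @ [y]))"
  using n.true_at_level_iff[of xs y d] assms unfolding LV_def holds_at_def by auto

end

context ext_min
begin

text \<open>A level all of whose earlier levels are standard has only standard elements, as each of its elements is a subset of an earlier
  level. It would then be \<open>K\<close> itself.\<close>

lemma nonstd_below: assumes "LV v h Q" "v \<notin> K" shows "\<exists>v'. v' \<in> ext nn h \<and> v' \<in> ext nn v \<and> v' \<notin> K"
proof (rule ccontr)
  assume *: "\<not> ?thesis"
  have "x \<in> K" if x: "x \<in> ext nn v" for x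
  proof -
    have "\<exists>v'\<in>ext nn h. v' \<in> ext nn v \<and> x \<notin> ext nn v' \<and> (\<exists>d\<in>ext nn Q. IsD nn W Cd v' d Q \<and> x \<in> ext nn d)"
      using assms(1) x unfolding LV_def Hi_def by blast
    then obtain v' d where v': "v' \<in> ext nn h" "v' \<in> ext nn v" "IsD nn W Cd v' d Q" "x \<in> ext nn d" by blast
    have vK: "v' \<in> K" using * v' by blast
    have "ext nn x \<in> Dfs (ext nn v') F" using n.IsD_iff[OF v'(3)] v'(4) K_N[OF vK] by simp
    then have "ext nn x \<subseteq> ext nn v'" unfolding Dfs_def by blast
    then show ?thesis using subset_std[of x v'] ext_car[OF x] vK ext_n[OF vK] by simp
  qed
  then have "ext nn v = K" using nonstd_contains[OF assms] by blast
  then show False using not_internal[OF LV_N[OF assms(1)]] by blast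
qed

end

text \<open>A nonstandard level \<open>A\<close>, with its package and with the finite sequences \<open>EA\<close> over it. All bounded quantifiers over levels and
  sequences refer to these.\<close>

locale nonstd_top = ext_min +
  fixes A hA QA EA SA
  assumes A: "LV A hA QA" "A \<notin> K" and EA: "EA \<in> N" "SA \<in> N" "SP nn W Cd A EA SA"
begin

lemma A_N: "A \<in> N" "hA \<in> N" "QA \<in> N"
  using A(1) LV_N unfolding LV_def by blast+

lemma W_Cd_N: "W \<in> N" "Cd \<in> N"
  using W Cd K_N by blast+

lemma hA_LV: "v \<in> ext nn hA \<Longrightarrow> LV v hA QA"
  using A(1) unfolding LV_def by blast

lemma A_trans: "x \<in> ext nn A \<Longrightarrow> ext nn x \<subseteq> ext nn A"
  using LV_trans[OF A(1)] by blast

lemma EA_ext: "ext nn EA = n.sq ` lists (ext nn A)"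
  using n.SP_E[OF EA(3)] A_N EA by simp

text \<open>The formula \<open>d\<close> holds of \<open>xs\<close> in some level that belongs to \<open>A\<close>; for fixed \<open>A\<close> this is \<open>\<Delta>\<^sub>0\<close>.\<close>

definition holds_in_top :: "dfm \<Rightarrow> 'a V list \<Rightarrow> bool" where
  "holds_in_top d xs \<longleftrightarrow> (\<exists>b\<in>ext nn A. b \<in> ext nn hA \<and> holds_at b d xs)"

lemma holds_in_top_iff: assumes "set xs \<subseteq> N"
  shows "(\<exists>b\<in>ext nn A. TQ nn W Cd hA QA b (n.code d) (n.sq xs)) \<longleftrightarrow> holds_in_top d xs"
proof -
  have "TQ nn W Cd hA QA b (n.code d) (n.sq xs) \<longleftrightarrow> b \<in> ext nn hA \<and> holds_at b d xs" for b
  proof (cases "b \<in> ext nn hA")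
    case True then show ?thesis using TQ_LV[OF hA_LV assms] by blast
  next
    case False then show ?thesis unfolding TQ_def by blast
  qed
  then show ?thesis unfolding holds_in_top_def by blast
qed

text \<open>At the level \<open>b\<close> something holds of parameters from \<open>\<eta>\<close> that holds at no level in \<open>A\<close>.\<close>

definition unreflected :: "'a V \<Rightarrow> 'a V \<Rightarrow> bool" where
  "unreflected \<eta> b \<longleftrightarrow> (\<exists>d xs. set xs \<subseteq> ext nn \<eta> \<and> holds_at b d xs \<and> \<not> holds_in_top d xs)"

text \<open>The same property as a \<open>\<Delta>\<^sub>0\<close> relation, with the package of \<open>b\<close> as additional arguments.\<close>

definition unreflectedQ where
  "unreflectedQ m \<eta> h Q b \<longleftrightarrow> (\<exists>c\<in>ext m Cd. \<exists>e\<in>ext m EA. (\<exists>n\<in>ext m W. fn m e n \<eta>) \<and> TQ m W Cd h Q b c e \<and>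
     \<not> (\<exists>b'\<in>ext m A. TQ m W Cd hA QA b' c e))"

lemma D0_unreflectedQ: "tm {nn} \<eta> \<Longrightarrow> tm {nn} h \<Longrightarrow> tm {nn} Q \<Longrightarrow> tm {nn} b \<Longrightarrow> D0 {nn} (\<lambda>m s. unreflectedQ m (\<eta> s) (h s) (Q s) (b s))"
  unfolding unreflectedQ_def by (intro D0_intros D0_rels tmn tm_intros A_N EA W_Cd_N)

lemma list_below:
  assumes "\<eta> \<in> N" "ext nn \<eta> \<subseteq> ext nn A"
  shows "(\<exists>e\<in>ext nn EA. (\<exists>n\<in>ext nn W. fn nn e n \<eta>) \<and> P e) \<longleftrightarrow> (\<exists>xs. set xs \<subseteq> ext nn \<eta> \<and> P (n.sq xs))"
proof
  assume "\<exists>e\<in>ext nn EA. (\<exists>n\<in>ext nn W. fn nn e n \<eta>) \<and> P e"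
  then obtain e n' where e: "e \<in> ext nn EA" "n' \<in> ext nn W" "fn nn e n' \<eta>" "P e" by blast
  obtain xs where xs: "e = n.sq xs" "set xs \<subseteq> ext nn A" using e(1) unfolding EA_ext by auto
  have "set xs \<subseteq> fst nn" using xs(2) ext_car[of _ nn A] by blast
  then have "set xs \<subseteq> ext nn \<eta>" using n.fn_sq_sub(1)[of \<eta> xs n'] e(2,3) xs(1) assms(1) by simp
  then show "\<exists>xs. set xs \<subseteq> ext nn \<eta> \<and> P (n.sq xs)" using xs(1) e(4) by blast
next
  assume "\<exists>xs. set xs \<subseteq> ext nn \<eta> \<and> P (n.sq xs)"
  then obtain xs where xs: "set xs \<subseteq> ext nn \<eta>" "P (n.sq xs)" by blast
  have "n.sq xs \<in> ext nn EA" unfolding EA_ext using xs(1) assms(2) by (auto simp: lists_eq_set)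
  moreover have "fn nn (n.sq xs) (vnum (length xs)) \<eta>" using n.fn_sq[OF xs(1)] .
  moreover have "vnum (length xs) \<in> ext nn W" using n.W_ext by simp
  ultimately show "\<exists>e\<in>ext nn EA. (\<exists>n\<in>ext nn W. fn nn e n \<eta>) \<and> P e" using xs(2) by blast
qed

lemma unreflectedQ_iff:
  assumes b: "LV b h Q" and \<eta>: "\<eta> \<in> ext nn A"
  shows "unreflectedQ nn \<eta> h Q b \<longleftrightarrow> unreflected \<eta> b"
proof -
  have eN: "\<eta> \<in> N" using ext_car[of \<eta> nn A] \<eta> by simp
  have sub: "set xs \<subseteq> N" if "set xs \<subseteq> ext nn \<eta>" for xs using that ext_car[of _ nn \<eta>] by auto
  have "unreflectedQ nn \<eta> h Q b \<longleftrightarrow> (\<exists>c\<in>ext nn Cd. \<exists>xs. set xs \<subseteq> ext nn \<eta> \<and> TQ nn W Cd h Q b c (n.sq xs) \<and>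
     \<not> (\<exists>b'\<in>ext nn A. TQ nn W Cd hA QA b' c (n.sq xs)))"
    unfolding unreflectedQ_def list_below[OF eN A_trans[OF \<eta>]] ..
  also have "\<dots> \<longleftrightarrow> (\<exists>d xs. set xs \<subseteq> ext nn \<eta> \<and> TQ nn W Cd h Q b (n.code d) (n.sq xs) \<and>
     \<not> (\<exists>b'\<in>ext nn A. TQ nn W Cd hA QA b' (n.code d) (n.sq xs)))" unfolding n.Cd_ext by blast
  also have "\<dots> \<longleftrightarrow> unreflected \<eta> b" unfolding unreflected_def using TQ_LV[OF b sub] holds_in_top_iff[OF sub] by blast
  finally show ?thesis .
qed

text \<open>Standard parameters: by \<open>\<Sigma>\<^sub>1\<close>-elementarity a standard level witnesses the same truth, and it belongs to \<open>A\<close>.\<close>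

lemma std_not_unreflected: assumes \<eta>: "\<eta> \<in> K" and b: "LV b h Q" shows "\<not> unreflected \<eta> b"
proof
  assume "unreflected \<eta> b"
  then obtain d xs where xs: "set xs \<subseteq> ext nn \<eta>" "holds_at b d xs" "\<not> holds_in_top d xs" unfolding unreflected_def by blast
  have xK: "set xs \<subseteq> K" using xs(1) F_end[OF \<eta>] by blast
  have xN: "set xs \<subseteq> N" using xK K_N by blast
  note sK = sq_std[OF xK]
  have cK: "k.code d \<in> K" using k.code_car by simp
  let ?\<Phi> = "\<lambda>m :: 'a V str. \<exists>h\<in>fst m. \<exists>Q\<in>fst m. \<exists>v\<in>fst m. Hi m W Cd h Q \<and> v \<in> ext m h \<and> TQ m W Cd h Q v (k.code d) (k.sq xs)"
  have "P2 {kk, nn} (\<lambda>m s. ?\<Phi> m)"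
    by (rule P2_S1, (rule S1_ex)+, rule S1_D0, intro D0_intros D0_rels tms tm_intros W Cd sK(2) cK)
  moreover have "?\<Phi> nn"
    using TQ_LV[OF b xN, of d] xs(2) b LV_N[OF b] unfolding LV_def code_std sK(1) by auto
  ultimately have "?\<Phi> kk" using transfer[where \<Phi> = ?\<Phi>] by blast
  then obtain h' Q' v where v: "h' \<in> K" "Q' \<in> K" "v \<in> K" "Hi kk W Cd h' Q'" "v \<in> ext kk h'" "TQ kk W Cd h' Q' v (k.code d) (k.sq xs)" by auto
  have "P2 {kk, nn} (\<lambda>m s. TQ m W Cd h' Q' v (k.code d) (k.sq xs))"
    by (rule P2_D0, intro D0_rels tms W Cd v(1-3) sK(2) cK)
  then have "TQ nn W Cd h' Q' v (k.code d) (k.sq xs)"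
    using transfer[where \<Phi> = "\<lambda>m. TQ m W Cd h' Q' v (k.code d) (k.sq xs)"] v(6) by blast
  moreover have LVv: "LV v h' Q'" by (rule LV_std[OF v(1,2,4,5)])
  ultimately have "holds_at v d xs" using TQ_LV[OF LVv xN, of d] unfolding code_std sK(1) by blast
  moreover have "v \<in> ext nn A" by (rule nonstd_contains[OF A v(3)])
  moreover have "v \<in> ext nn hA" using std_in_h[OF A LVv v(3)] unfolding LV_def by blast
  ultimately show False using xs(3) unfolding holds_in_top_def by blast
qed

text \<open>The canonical step from \<open>x\<close> to \<open>y\<close>: \<open>b\<close> is the least level at which something new holds of parameters from a level
  below \<open>x\<close>, and \<open>y\<close> is the least such level below \<open>x\<close> for this \<open>b\<close>. Minimality makes \<open>y\<close> unique, which
  \<open>omega_rec\<close> requires.\<close>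

definition Step :: "'a V \<Rightarrow> 'a V \<Rightarrow> 'a V \<Rightarrow> bool" where
  "Step x y b \<longleftrightarrow> y \<in> ext nn hA \<and> y \<in> ext nn x \<and> unreflected y b \<and>
     (\<forall>b' h Q. LV b' h Q \<longrightarrow> b' \<in> ext nn b \<longrightarrow> (\<forall>\<eta>\<in>ext nn hA. \<eta> \<in> ext nn x \<longrightarrow> \<not> unreflected \<eta> b')) \<and>
     (\<forall>\<eta>\<in>ext nn hA. \<eta> \<in> ext nn y \<longrightarrow> \<not> unreflected \<eta> b)"

text \<open>\<open>w\<close> supplies the package of \<open>b\<close>, which has no bound in \<open>A\<close>; the step is \<open>\<Delta>\<^sub>0\<close> with \<open>w\<close> and \<open>\<Sigma>\<^sub>1\<close> without.\<close>

definition StepQ where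
  "StepQ m x y w \<longleftrightarrow> (\<exists>h\<in>ext m w. \<exists>Q\<in>ext m w. Hi m W Cd h Q \<and> (\<exists>b\<in>ext m h. y \<in> ext m hA \<and> y \<in> ext m x \<and> unreflectedQ m y h Q b \<and>
     (\<forall>b'\<in>ext m h. b' \<in> ext m b \<longrightarrow> (\<forall>\<eta>\<in>ext m hA. \<eta> \<in> ext m x \<longrightarrow> \<not> unreflectedQ m \<eta> h Q b')) \<and>
     (\<forall>\<eta>\<in>ext m hA. \<eta> \<in> ext m y \<longrightarrow> \<not> unreflectedQ m \<eta> h Q b)))"

lemma D0_StepQ: "D0 {nn} (\<lambda>m s. StepQ m (s 0) (s 1) (s 2))"
  unfolding StepQ_def by (intro D0_intros D0_rels D0_unreflectedQ tmn tm_intros A_N W_Cd_N)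

lemma StepQ_iff:
  assumes x: "x \<in> ext nn A" and b: "LV b h Q"
  shows "(y \<in> ext nn hA \<and> y \<in> ext nn x \<and> unreflectedQ nn y h Q b \<and>
     (\<forall>b'\<in>ext nn h. b' \<in> ext nn b \<longrightarrow> (\<forall>\<eta>\<in>ext nn hA. \<eta> \<in> ext nn x \<longrightarrow> \<not> unreflectedQ nn \<eta> h Q b')) \<and>
     (\<forall>\<eta>\<in>ext nn hA. \<eta> \<in> ext nn y \<longrightarrow> \<not> unreflectedQ nn \<eta> h Q b)) \<longleftrightarrow> Step x y b"
proof (cases "y \<in> ext nn x")
  case True
  have sub: "\<eta> \<in> ext nn A" if "\<eta> \<in> ext nn x" for \<eta> using A_trans[OF x] that by blast
  have sub': "\<eta> \<in> ext nn A" if "\<eta> \<in> ext nn y" for \<eta> using A_trans[OF sub[OF True]] that by blast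
  have 1: "unreflectedQ nn y h Q b \<longleftrightarrow> unreflected y b" by (rule unreflectedQ_iff[OF b sub[OF True]])
  have 2: "unreflectedQ nn \<eta> h Q b \<longleftrightarrow> unreflected \<eta> b" if "\<eta> \<in> ext nn y" for \<eta> by (rule unreflectedQ_iff[OF b sub'[OF that]])
  have LVb: "LV b' h Q" if "b' \<in> ext nn h" for b' using b that unfolding LV_def by blast
  have 3: "unreflectedQ nn \<eta> h Q b' \<longleftrightarrow> unreflected \<eta> b'" if "\<eta> \<in> ext nn x" "b' \<in> ext nn h" for \<eta> b' by (rule unreflectedQ_iff[OF LVb[OF that(2)] sub[OF that(1)]])
  have 4: "b' \<in> ext nn h" if "LV b' h' Q'" "b' \<in> ext nn b" for b' h' Q' using LV_down[OF b that] .
  have 5: "(\<forall>b'\<in>ext nn h. b' \<in> ext nn b \<longrightarrow> (\<forall>\<eta>\<in>ext nn hA. \<eta> \<in> ext nn x \<longrightarrow> \<not> unreflectedQ nn \<eta> h Q b')) \<longleftrightarrow>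
    (\<forall>b' h Q. LV b' h Q \<longrightarrow> b' \<in> ext nn b \<longrightarrow> (\<forall>\<eta>\<in>ext nn hA. \<eta> \<in> ext nn x \<longrightarrow> \<not> unreflected \<eta> b'))"
    using 3 4 LVb by blast
  have 6: "(\<forall>\<eta>\<in>ext nn hA. \<eta> \<in> ext nn y \<longrightarrow> \<not> unreflectedQ nn \<eta> h Q b) \<longleftrightarrow> (\<forall>\<eta>\<in>ext nn hA. \<eta> \<in> ext nn y \<longrightarrow> \<not> unreflected \<eta> b)"
    using 2 by blast
  show ?thesis unfolding Step_def 1 5 6 ..
next
  case False
  then show ?thesis unfolding Step_def by blast
qed

lemma StepQ_Step:
  assumes "x \<in> ext nn A" "StepQ nn x y w" shows "\<exists>b h Q. LV b h Q \<and> Step x y b"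
proof -
  obtain h Q b where *: "h \<in> ext nn w" "Q \<in> ext nn w" "Hi nn W Cd h Q" "b \<in> ext nn h" "y \<in> ext nn hA \<and> y \<in> ext nn x \<and> unreflectedQ nn y h Q b \<and>
     (\<forall>b'\<in>ext nn h. b' \<in> ext nn b \<longrightarrow> (\<forall>\<eta>\<in>ext nn hA. \<eta> \<in> ext nn x \<longrightarrow> \<not> unreflectedQ nn \<eta> h Q b')) \<and>
     (\<forall>\<eta>\<in>ext nn hA. \<eta> \<in> ext nn y \<longrightarrow> \<not> unreflectedQ nn \<eta> h Q b)" using assms(2) unfolding StepQ_def by blast
  have b: "LV b h Q" using * ext_car[of h nn w] ext_car[of Q nn w] unfolding LV_def by simp
  then show ?thesis using StepQ_iff[OF assms(1) b] *(5) by blast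
qed

lemma Step_StepQ:
  assumes "x \<in> ext nn A" "LV b h Q" "Step x y b" shows "\<exists>w\<in>N. StepQ nn x y w"
proof -
  have hQ: "h \<in> N" "Q \<in> N" "Hi nn W Cd h Q" "b \<in> ext nn h" using assms(2) unfolding LV_def by blast+
  obtain w where w: "w \<in> N" "ext nn w = {h, Q}" using n0.pairing[of h Q] hQ(1,2) by auto
  have "StepQ nn x y w" unfolding StepQ_def w(2)
    using hQ(3,4) iffD2[OF StepQ_iff[OF assms(1,2)] assms(3)] by blast
  then show ?thesis using w(1) by blast
qed

lemma Step_unique:
  assumes "LV b h Q" "LV b' h' Q'" "Step x y b" "Step x y' b'" shows "y = y'"
proof -
  have "b \<notin> ext nn b'" "b' \<notin> ext nn b" using assms unfolding Step_def by blast+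
  then have b: "b = b'" using LV_linear[OF assms(1,2)] by blast
  have y: "LV y hA QA" "LV y' hA QA" using assms(3,4) hA_LV unfolding Step_def by blast+
  have "y \<notin> ext nn y'" "y' \<notin> ext nn y" using assms(3,4) unfolding Step_def b by blast+
  then show ?thesis using LV_linear[OF y] by blast
qed

text \<open>Set foundation together with \<open>\<Delta>\<^sub>0\<close>-Separation gives \<open>\<in>\<close>-minimal elements of bounded \<open>\<Delta>\<^sub>0\<close> classes.\<close>

lemma least_level:
  assumes D: "D0 {nn} (\<lambda>m s. \<Phi> m (s 0))" and w: "w \<in> N" and y: "y \<in> ext nn w" "\<Phi> nn y"
  shows "\<exists>y\<in>ext nn w. \<Phi> nn y \<and> (\<forall>z\<in>ext nn w. z \<in> ext nn y \<longrightarrow> \<not> \<Phi> nn z)"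
proof -
  obtain Y where Y: "Y \<in> N" "ext nn Y = {x \<in> ext nn w. \<Phi> nn x}" using n0.sep[OF D, of w] w by auto
  obtain z where "z \<in> ext nn Y" "ext nn z \<inter> ext nn Y = {}" using n0.founded[of Y] Y y by auto
  then show ?thesis unfolding Y(2) by blast
qed

lemma Step_ex:
  assumes x: "x \<in> ext nn A" and xh: "x \<in> ext nn hA" and y: "y \<in> ext nn hA" "y \<in> ext nn x" and b: "LV b h Q" "unreflected y b"
  shows "\<exists>y b. LV b h Q \<and> Step x y b"
proof -
  have sub: "\<eta> \<in> ext nn A" if "\<eta> \<in> ext nn x" for \<eta> using A_trans[OF x] that by blast
  have hQ: "h \<in> N" "Q \<in> N" "b \<in> ext nn h" using b unfolding LV_def by blast+
  have xN: "x \<in> N" using ext_car[of x nn A] x by simp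
  let ?B = "\<lambda>m b. \<exists>\<eta>\<in>ext m hA. \<eta> \<in> ext m x \<and> unreflectedQ m \<eta> h Q b"
  have D: "D0 {nn} (\<lambda>m s. ?B m (s 0))"
    by (intro D0_intros D0_unreflectedQ tmn tm_intros A_N hQ xN)
  have "?B nn b" using y unreflectedQ_iff[OF b(1) sub[OF y(2)]] b(2) by blast
  then obtain c where c: "c \<in> ext nn h" "?B nn c" "\<forall>z\<in>ext nn h. z \<in> ext nn c \<longrightarrow> \<not> ?B nn z"
    using least_level[of ?B, OF D hQ(1,3)] by blast
  have LVc: "LV c h Q" using b(1) c(1) unfolding LV_def by blast
  have cN: "c \<in> N" by (rule LV_N[OF LVc])
  let ?Y = "\<lambda>m y. y \<in> ext m x \<and> unreflectedQ m y h Q c"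
  have D: "D0 {nn} (\<lambda>m s. ?Y m (s 0))"
    by (intro D0_intros D0_unreflectedQ tmn tm_intros A_N hQ xN cN)
  obtain y1 where y1: "y1 \<in> ext nn hA" "?Y nn y1" using c(2) by blast
  obtain z where z: "z \<in> ext nn hA" "?Y nn z" "\<forall>u\<in>ext nn hA. u \<in> ext nn z \<longrightarrow> \<not> ?Y nn u"
    using least_level[of ?Y, OF D A_N(2) y1] by blast
  have x_trans: "u \<in> ext nn x" if "u \<in> ext nn z" "u \<in> ext nn hA" for u
    using LV_trans[OF hA_LV[OF xh] conjunct1[OF z(2)] that(1)] .
  have "Step x z c" unfolding StepQ_iff[OF x LVc, symmetric] using z c x_trans by blast
  then show ?thesis using LVc by blast
qed

end

section \<open>A reflecting nonstandard level\<close>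

lemma finite_sub_chain:
  fixes X :: "nat \<Rightarrow> 'b set"
  assumes "finite B" "B \<subseteq> (\<Union>i. X i)" "\<And>i. X i \<subseteq> X (Suc i)" shows "\<exists>k. B \<subseteq> X k"
  using assms(1,2)
proof (induction rule: finite_induct)
  case (insert x B)
  then obtain k j where kj: "B \<subseteq> X k" "x \<in> X j" by auto
  have "X i \<subseteq> X (max j k)" if "i \<le> max j k" for i by (rule lift_Suc_mono_le[of X, OF assms(3) that])
  then have "X k \<subseteq> X (max j k)" "X j \<subseteq> X (max j k)" by simp_all
  then show ?case using kj by blast
qed simp

context nonstd_top
begin

text \<open>Otherwise \<open>Step\<close> can be iterated through the nonstandard levels in \<open>A\<close>. By \<open>omega_rec\<close> the descending
  sequence so obtained has a range in \<open>N\<close>, against foundation.\<close>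

lemma reflecting_level: "\<exists>\<eta>. \<eta> \<in> ext nn hA \<and> \<eta> \<in> ext nn A \<and> \<eta> \<notin> K \<and> (\<forall>b h Q. LV b h Q \<longrightarrow> \<not> unreflected \<eta> b)"
proof (rule ccontr)
  assume *: "\<not> ?thesis"
  have allbad: "\<exists>b h Q. LV b h Q \<and> unreflected \<eta> b" if "\<eta> \<in> ext nn hA" "\<eta> \<in> ext nn A" "\<eta> \<notin> K" for \<eta>
    using * that by blast
  let ?P = "\<lambda>x. x \<in> ext nn hA \<and> x \<in> ext nn A \<and> x \<notin> K"
  have "\<exists>f. \<forall>n. ?P (f n) \<and> (\<exists>w\<in>N. StepQ nn (f n) (f (Suc n)) w)"
  proof (rule dependent_nat_choice[of "\<lambda>n. ?P" "\<lambda>n x y. \<exists>w\<in>N. StepQ nn x y w"])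
    show "\<exists>x. ?P x" using nonstd_below[OF A] by blast
    fix x and n :: nat assume x: "?P x"
    obtain y where y: "y \<in> ext nn hA" "y \<in> ext nn x" "y \<notin> K" using nonstd_below[OF hA_LV] x by blast
    have "y \<in> ext nn A" using A_trans x y(2) by blast
    then obtain b h Q where b: "LV b h Q" "unreflected y b" using allbad y by blast
    obtain z c where z: "LV c h Q" "Step x z c" using Step_ex[OF _ _ y(1,2) b] x by blast
    \<comment> \<open>The step does not choose nonstandard levels explicitly, since standardness is not definable in \<open>N\<close>; they are nonstandard because they are unreflected.\<close>
    have "z \<notin> K" using std_not_unreflected[OF _ z(1)] z(2) unfolding Step_def by blast
    moreover have "z \<in> ext nn A" using A_trans x z(2) unfolding Step_def by blast
    ultimately have "?P z" using z(2) unfolding Step_def by blast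
    moreover have "\<exists>w\<in>N. StepQ nn x z w" using Step_StepQ[OF _ z] x by blast
    ultimately show "\<exists>y. ?P y \<and> (\<exists>w\<in>N. StepQ nn x y w)" by blast
  qed
  then obtain f where f: "\<And>n. ?P (f n)" "\<And>n. \<exists>w\<in>N. StepQ nn (f n) (f (Suc n)) w" by blast
  have fA: "f n \<in> ext nn A" for n using f(1)[of n] by blast
  have "\<exists>Z\<in>fst nn. ext nn Z = range f"
  proof (rule n.omega_rec[where \<psi> = StepQ and x = f])
    show "D0 {nn} (\<lambda>m s. StepQ m (s 0) (s 1) (s 2))" by (rule D0_StepQ)
    show "f i \<in> fst nn" for i using ext_car[OF fA] .
    show "\<exists>w\<in>fst nn. StepQ nn (f i) (f (Suc i)) w" for i using f(2)[of i] by simp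
    fix i y w assume "StepQ nn (f i) y w"
    then obtain b h Q where b: "LV b h Q" "Step (f i) y b" using StepQ_Step[OF fA] by blast
    obtain w' where "StepQ nn (f i) (f (Suc i)) w'" using f(2) by blast
    then obtain b' h' Q' where b': "LV b' h' Q'" "Step (f i) (f (Suc i)) b'" using StepQ_Step[OF fA] by blast
    show "y = f (Suc i)" by (rule Step_unique[OF b(1) b'(1) b(2) b'(2)])
  qed
  then obtain Z where Z: "Z \<in> fst nn" "ext nn Z = range f" by blast
  obtain y where y: "y \<in> ext nn Z" "ext nn y \<inter> ext nn Z = {}" using n0.founded[OF Z(1)] Z(2) by blast
  obtain i where i: "y = f i" using y(1) unfolding Z(2) by blast
  have "f (Suc i) \<in> ext nn (f i)" using f(2)[of i] unfolding StepQ_def by blast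
  then show False using y(2) unfolding i Z(2) by blast
qed

end

section \<open>The closing sequence of standard levels\<close>

locale reflecting_top = nonstd_top +
  fixes \<eta>
  assumes eta: "\<eta> \<in> ext nn hA" "\<eta> \<in> ext nn A" "\<eta> \<notin> K" and reflects: "\<And>b h Q. LV b h Q \<Longrightarrow> \<not> unreflected \<eta> b"
begin

lemma eta_N: "\<eta> \<in> N"
  using ext_car[OF eta(1)] by simp

lemma K_eta: "x \<in> K \<Longrightarrow> x \<in> ext nn \<eta>"
  by (rule nonstd_contains[OF hA_LV[OF eta(1)] eta(3)])

lemma eta_A: "ext nn \<eta> \<subseteq> ext nn A"
  by (rule A_trans[OF eta(2)])

lemma holds_in_top_reflects: assumes "set xs \<subseteq> ext nn \<eta>" shows "holds_in_top d xs \<longleftrightarrow> (\<exists>b h Q. LV b h Q \<and> holds_at b d xs)"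
proof
  assume "holds_in_top d xs" then show "\<exists>b h Q. LV b h Q \<and> holds_at b d xs" unfolding holds_in_top_def using hA_LV by blast
next
  assume "\<exists>b h Q. LV b h Q \<and> holds_at b d xs"
  then show "holds_in_top d xs" using reflects assms unfolding unreflected_def by blast
qed

lemma holds_in_top_true_at_level: assumes "set xs \<subseteq> ext nn \<eta>" "y \<in> ext nn \<eta>"
  shows "holds_in_top d (xs @ [y]) \<longleftrightarrow> true_at_level nn W Cd (n.code d) (n.sq xs) y"
proof -
  have "set xs \<subseteq> N" "y \<in> N" using assms ext_car[of _ nn \<eta>] by auto
  then show ?thesis using holds_in_top_reflects[of "xs @ [y]" d] true_at_level_N[of xs y d] assms by simp
qed

text \<open>The formula \<open>c\<close> fails of \<open>e\<close> extended by \<open>y\<close> at all levels in \<open>A\<close>; for parameters from \<open>\<eta>\<close> it then fails at all levels.\<close>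

definition fails_in_top where
  "fails_in_top m c e y \<longleftrightarrow> (\<exists>e'\<in>ext m EA. APP m W e e' y A \<and> \<not> (\<exists>b\<in>ext m A. TQ m W Cd hA QA b c e'))"

lemma D0_fails_in_top: "tm {nn} c \<Longrightarrow> tm {nn} e \<Longrightarrow> tm {nn} y \<Longrightarrow> D0 {nn} (\<lambda>m s. fails_in_top m (c s) (e s) (y s))"
  unfolding fails_in_top_def by (intro D0_intros D0_rels D0_APP tmn tm_intros A_N EA W_Cd_N)

lemma fails_in_top_iff: assumes "set xs \<subseteq> ext nn A" "y \<in> N"
  shows "fails_in_top nn (n.code d) (n.sq xs) y \<longleftrightarrow> y \<in> ext nn A \<and> \<not> holds_in_top d (xs @ [y])"
proof -
  have xN: "set xs \<subseteq> N" using assms(1) ext_car[of _ nn A] by auto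
  have sN: "set (xs @ [y]) \<subseteq> fst nn" using xN assms(2) by simp
  have e: "n.sq (xs @ [y]) \<in> ext nn EA \<longleftrightarrow> y \<in> ext nn A"
    using n.SP_mem[OF EA(3) _ _ sN] A_N EA assms(1) by simp
  have App: "APP nn W (n.sq xs) e' y A \<longleftrightarrow> e' = n.sq (xs @ [y])" if "e' \<in> ext nn EA" for e'
    using n.APP_iff[of A xs e' y] A_N xN assms ext_car[OF that] by simp
  have "fails_in_top nn (n.code d) (n.sq xs) y \<longleftrightarrow> n.sq (xs @ [y]) \<in> ext nn EA \<and> \<not> (\<exists>b\<in>ext nn A. TQ nn W Cd hA QA b (n.code d) (n.sq (xs @ [y])))"
    unfolding fails_in_top_def using App by blast
  moreover have "(\<exists>b\<in>ext nn A. TQ nn W Cd hA QA b (n.code d) (n.sq (xs @ [y]))) \<longleftrightarrow> holds_in_top d (xs @ [y])"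
    by (rule holds_in_top_iff) (use sN in simp)
  ultimately show ?thesis unfolding e by blast
qed

text \<open>If some \<open>y\<close> in \<open>\<eta>\<close> makes a formula with parameters from \<open>t\<close> fail at every level in \<open>A\<close>, then some such \<open>y\<close> belongs to \<open>t'\<close>.
  The nested negations only serve to give the bounded quantifier over sequences its existential form.\<close>

definition closing where
  "closing m t t' \<longleftrightarrow> (\<forall>c\<in>ext m Cd. \<not> (\<exists>e\<in>ext m EA. (\<exists>n\<in>ext m W. fn m e n t) \<and>
     (\<exists>y\<in>ext m \<eta>. fails_in_top m c e y) \<and> \<not> (\<exists>y\<in>ext m t'. fails_in_top m c e y)))"

lemma D0_closing: "tm {nn} t \<Longrightarrow> tm {nn} t' \<Longrightarrow> D0 {nn} (\<lambda>m s. closing m (t s) (t' s))"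
  unfolding closing_def by (intro D0_intros D0_rels D0_fails_in_top tmn tm_intros A_N EA W_Cd_N eta_N)

lemma closing_iff: assumes "t \<in> K" "t' \<in> K"
  shows "closing nn t t' \<longleftrightarrow> (\<forall>d xs. set xs \<subseteq> elts t \<longrightarrow> (\<exists>y\<in>ext nn \<eta>. \<not> holds_in_top d (xs @ [y])) \<longrightarrow> (\<exists>y\<in>elts t'. \<not> holds_in_top d (xs @ [y])))"
proof -
  have e: "ext nn t = elts t" "ext nn t' = elts t'" using ext_n assms by blast+
  have tA: "ext nn t \<subseteq> ext nn A" using F_end[OF assms(1)] nonstd_contains[OF A] by blast
  have NT: "fails_in_top nn (n.code d) (n.sq xs) y \<longleftrightarrow> \<not> holds_in_top d (xs @ [y])" if "set xs \<subseteq> elts t" "y \<in> ext nn A" for d xs y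
  proof -
    have "set xs \<subseteq> ext nn A" using that(1) tA unfolding e by blast
    moreover have "y \<in> N" using ext_car[OF that(2)] by simp
    ultimately show ?thesis using fails_in_top_iff that(2) by blast
  qed
  have yA: "y \<in> ext nn A" if "y \<in> elts t'" for y using that K_trans[OF assms(2)] nonstd_contains[OF A] by blast
  have 1: "(\<exists>y\<in>ext nn \<eta>. fails_in_top nn (n.code d) (n.sq xs) y) \<longleftrightarrow> (\<exists>y\<in>ext nn \<eta>. \<not> holds_in_top d (xs @ [y]))"
    "(\<exists>y\<in>elts t'. fails_in_top nn (n.code d) (n.sq xs) y) \<longleftrightarrow> (\<exists>y\<in>elts t'. \<not> holds_in_top d (xs @ [y]))" if "set xs \<subseteq> elts t" for d xs
    using NT[OF that] yA eta_A by blast+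
  have "closing nn t t' \<longleftrightarrow> (\<forall>d. \<not> (\<exists>xs. set xs \<subseteq> elts t \<and> (\<exists>y\<in>ext nn \<eta>. fails_in_top nn (n.code d) (n.sq xs) y) \<and> \<not> (\<exists>y\<in>elts t'. fails_in_top nn (n.code d) (n.sq xs) y)))"
    unfolding closing_def list_below[OF K_N[OF assms(1)] tA] e n.Cd_ext by blast
  also have "\<dots> \<longleftrightarrow> (\<forall>d xs. set xs \<subseteq> elts t \<longrightarrow> (\<exists>y\<in>ext nn \<eta>. fails_in_top nn (n.code d) (n.sq xs) y) \<longrightarrow> (\<exists>y\<in>elts t'. fails_in_top nn (n.code d) (n.sq xs) y))"
    by blast
  also have "\<dots> \<longleftrightarrow> (\<forall>d xs. set xs \<subseteq> elts t \<longrightarrow> (\<exists>y\<in>ext nn \<eta>. \<not> holds_in_top d (xs @ [y])) \<longrightarrow> (\<exists>y\<in>elts t'. \<not> holds_in_top d (xs @ [y])))"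
    by (intro all_cong1 imp_cong refl 1)
  finally show ?thesis .
qed

text \<open>The negation of \<open>true_at_level\<close> for the components of the pair \<open>p\<close>, written in \<open>\<Pi>\<^sub>1\<close> form, to which \<open>\<Pi>\<^sub>1\<close>-Collection
  in \<open>K\<close> applies.\<close>

definition fails_at_levels where
  "fails_at_levels m E p y \<longleftrightarrow> (\<forall>h\<in>fst m. \<forall>Q\<in>fst m. \<forall>v\<in>fst m. \<forall>e'\<in>fst m. \<forall>c\<in>ext m Cd. \<forall>e\<in>ext m E. opr m p c e \<longrightarrow>
     \<not> (Hi m W Cd h Q \<and> v \<in> ext m h \<and> APP m W e e' y v \<and> TQ m W Cd h Q v c e'))"

lemma fails_at_levels_iff:
  assumes "c \<in> elts Cd" "e \<in> elts E" "E \<in> K" shows "fails_at_levels kk E (k0.pr c e) y \<longleftrightarrow> \<not> true_at_level kk W Cd c e y"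
proof -
  have ce: "c \<in> K" "e \<in> K" "k0.pr c e \<in> K" using assms K_trans[OF Cd(1)] K_trans[OF assms(3)] k0.pr_car by simp_all
  have "opr kk (k0.pr c e) c' e' \<longleftrightarrow> c' = c \<and> e' = e" if "c' \<in> elts Cd" "e' \<in> elts E" for c' e'
  proof -
    have "c' \<in> K" "e' \<in> K" using that K_trans[OF Cd(1)] K_trans[OF assms(3)] by blast+
    then show ?thesis using k0.opr_iff[of c' e' "k0.pr c e"] k0.pr_inj[of c e c' e'] ce by auto
  qed
  then show ?thesis unfolding fails_at_levels_def true_at_level_def ext_k[OF Cd(1)] ext_k[OF assms(3)] using assms(1,2) by blast
qed

lemma true_at_level_std: assumes "c \<in> K" "e \<in> K" "y \<in> K" shows "true_at_level kk W Cd c e y \<longleftrightarrow> true_at_level nn W Cd c e y"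
proof (rule transfer)
  show "P2 {kk, nn} (\<lambda>m s. true_at_level m W Cd c e y)" unfolding true_at_level_def
    by (rule P2_S1, (rule S1_ex)+, rule S1_D0, intro D0_intros D0_rels D0_APP tms tm_intros W Cd assms)
qed

text \<open>\<open>\<Sigma>\<^sub>2\<close>-elementarity replaces a possibly nonstandard witness by a standard one.\<close>

lemma witness_std:
  assumes "c \<in> K" "e \<in> K" "y \<in> N" "\<not> true_at_level nn W Cd c e y" shows "\<exists>y\<in>K. \<not> true_at_level kk W Cd c e y"
proof (rule ccontr)
  assume *: "\<not> ?thesis"
  let ?\<Phi> = "\<lambda>m :: 'a V str. \<forall>y\<in>fst m. true_at_level m W Cd c e y"
  have "P2 {kk, nn} (\<lambda>m s. ?\<Phi> m)" unfolding true_at_level_def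
    by (rule P2_all, rule P2_S1, (rule S1_ex)+, rule S1_D0, intro D0_intros D0_rels D0_APP tms tm_intros W Cd assms)
  moreover have "?\<Phi> kk" using * by simp
  ultimately have "?\<Phi> nn" using transfer[where \<Phi> = ?\<Phi>] by blast
  then show False using assms by simp
qed

text \<open>The set \<open>D\<close> of relevant pairs is defined in \<open>N\<close> by a formula bounded by \<open>A\<close>, yet it is a subset of a standard set and
  hence standard. For each pair in \<open>D\<close> there is a standard witness, \<open>\<Pi>\<^sub>1\<close>-Collection in \<open>K\<close> bounds these
  witnesses by \<open>c0\<close>, and any standard level \<open>v\<close> above \<open>c0\<close> and \<open>t\<close> closes \<open>t\<close>.\<close>

lemma step_std: assumes t: "t \<in> K" shows "\<exists>t'. t' \<in> K \<and> t' \<in> ext nn hA \<and> t \<in> ext nn t' \<and> closing nn t t'"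
proof -
  obtain E where E: "E \<in> K" "ext kk E = k.sq ` lists (elts t)" using E_ex[OF t] by blast
  have Ee: "elts E = k.sq ` lists (elts t)" using E ext_k by blast
  have xK: "set xs \<subseteq> K" if "set xs \<subseteq> elts t" for xs using that K_trans[OF t] by blast
  have xeta: "set xs \<subseteq> ext nn \<eta>" if "set xs \<subseteq> elts t" for xs using xK[OF that] K_eta by blast
  obtain P where P: "P \<in> K" "elts P = {k0.pr a b | a b. a \<in> elts Cd \<and> b \<in> elts E}" using prod_ex[OF Cd(1) E(1)] by blast
  let ?\<Phi> = "\<lambda>m p. \<exists>c\<in>ext m Cd. \<exists>e\<in>ext m E. opr m p c e \<and> (\<exists>y\<in>ext m \<eta>. fails_in_top m c e y)"
  have "D0 {nn} (\<lambda>m s. ?\<Phi> m (s 0))"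
    by (intro D0_intros D0_rels D0_fails_in_top tmn tm_intros W_Cd_N K_N[OF E(1)] eta_N)
  then obtain D where D: "D \<in> N" "ext nn D = {p \<in> ext nn P. ?\<Phi> nn p}" using n0.sep[of ?\<Phi> P] K_N[OF P(1)] by auto
  have DK: "D \<in> K" by (rule subset_std[OF D(1) P(1)]) (use D(2) ext_n[OF P(1)] in blast)
  have De: "elts D = {p \<in> elts P. ?\<Phi> nn p}" using D(2) ext_n[OF DK] ext_n[OF P(1)] by blast
  have NT: "fails_in_top nn (k.code d) (k.sq xs) y \<longleftrightarrow> \<not> true_at_level nn W Cd (k.code d) (k.sq xs) y" if "set xs \<subseteq> elts t" "y \<in> ext nn \<eta>" for d xs y
  proof -
    have "set xs \<subseteq> ext nn A" "y \<in> ext nn A" "y \<in> N" using xeta[OF that(1)] that(2) eta_A ext_car[OF that(2)] by auto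
    then have "fails_in_top nn (n.code d) (n.sq xs) y \<longleftrightarrow> \<not> holds_in_top d (xs @ [y])" using fails_in_top_iff by blast
    then show ?thesis unfolding holds_in_top_true_at_level[OF xeta[OF that(1)] that(2)] code_std sq_std(1)[OF xK[OF that(1)]] .
  qed
  have "\<exists>y\<in>K. fails_at_levels kk E p y" if p: "p \<in> elts D" for p
  proof -
    have "?\<Phi> nn p" using p unfolding De by blast
    then obtain c e y where ce: "c \<in> elts Cd" "e \<in> elts E" "opr nn p c e" "y \<in> ext nn \<eta>" "fails_in_top nn c e y"
      unfolding ext_n[OF Cd(1)] ext_n[OF E(1)] by blast
    have cK: "c \<in> K" "e \<in> K" "p \<in> K" using ce K_trans[OF Cd(1)] K_trans[OF E(1)] K_trans[OF DK p] by blast+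
    have p': "p = k0.pr c e" using ce(3) n0.opr_iff[of c e p] cK K_N pr_std[OF cK(1,2)] by simp
    obtain d xs where d: "c = k.code d" "e = k.sq xs" "set xs \<subseteq> elts t" using ce(1,2) unfolding Cd(2) Ee by auto
    have "\<not> true_at_level nn W Cd c e y" using NT[OF d(3) ce(4)] ce(5) unfolding d by blast
    then obtain y where "y \<in> K" "\<not> true_at_level kk W Cd c e y" using witness_std[OF cK(1,2)] ext_car[OF ce(4)] by auto
    then show ?thesis unfolding p' fails_at_levels_iff[OF ce(1,2) E(1)] by blast
  qed
  moreover have "P1 {kk} (\<lambda>m s. fails_at_levels m E (s 0) (s 1))"
    unfolding fails_at_levels_def by (rule P1_all)+ (rule P1_D0, intro D0_intros D0_rels D0_APP tmk tm_intros W Cd E(1))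
  ultimately obtain c0 where c0: "c0 \<in> K" "\<forall>p\<in>elts D. \<exists>y\<in>elts c0. fails_at_levels kk E p y"
    using k_coll[where \<Psi> = "\<lambda>m p y. fails_at_levels m E p y", OF _ DK] by blast
  obtain z where z: "z \<in> K" "elts z = {c0, t}" using k_pairing[OF c0(1) t] by blast
  obtain v h Q where v: "v \<in> K" "z \<in> elts v" "LV v h Q" using std_level[OF z(1)] by blast
  have tr: "elts x \<subseteq> elts v" if "x \<in> elts v" for x
    using LV_trans[OF v(3), of x] that ext_n[OF v(1)] ext_n[OF K_trans[OF v(1) that]] by blast
  have cv: "c0 \<in> elts v" "t \<in> elts v" using tr[OF v(2)] z(2) by blast+
  have "closing nn t v" unfolding closing_iff[OF t v(1)]
  proof (intro allI impI)
    fix d xs assume xs: "set xs \<subseteq> elts t" and "\<exists>y\<in>ext nn \<eta>. \<not> holds_in_top d (xs @ [y])"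
    then obtain y where y: "y \<in> ext nn \<eta>" "\<not> holds_in_top d (xs @ [y])" by blast
    have holds_in_top: "holds_in_top d (xs @ [y]) \<longleftrightarrow> true_at_level nn W Cd (k.code d) (k.sq xs) y" if "y \<in> ext nn \<eta>" for y
      using holds_in_top_true_at_level[OF xeta[OF xs] that] unfolding code_std sq_std(1)[OF xK[OF xs]] .
    have ce: "k.code d \<in> elts Cd" "k.sq xs \<in> elts E" using xs unfolding Cd(2) Ee by (auto simp: lists_eq_set)
    have cK: "k.code d \<in> K" "k.sq xs \<in> K" using ce K_trans[OF Cd(1)] K_trans[OF E(1)] by blast+
    let ?p = "k0.pr (k.code d) (k.sq xs)"
    have pK: "?p \<in> K" using cK k0.pr_car by simp
    have "opr nn ?p (k.code d) (k.sq xs)" using n0.opr_iff[of "k.code d" "k.sq xs" ?p] cK pK K_N pr_std[OF cK] by simp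
    moreover have "fails_in_top nn (k.code d) (k.sq xs) y" using NT[OF xs y(1)] holds_in_top[OF y(1)] y(2) by blast
    ultimately have "?\<Phi> nn ?p" unfolding ext_n[OF Cd(1)] ext_n[OF E(1)] using ce y(1) by blast
    moreover have "?p \<in> elts P" unfolding P(2) using ce by blast
    ultimately have "?p \<in> elts D" unfolding De by blast
    then obtain y' where y': "y' \<in> elts c0" "fails_at_levels kk E ?p y'" using c0(2) by blast
    have yK: "y' \<in> K" using K_trans[OF c0(1) y'(1)] .
    have "\<not> true_at_level nn W Cd (k.code d) (k.sq xs) y'" using y'(2) fails_at_levels_iff[OF ce E(1)] true_at_level_std[OF cK yK] by blast
    then have "\<not> holds_in_top d (xs @ [y'])" using holds_in_top[OF K_eta[OF yK]] by blast
    then show "\<exists>y\<in>elts v. \<not> holds_in_top d (xs @ [y])" using y'(1) tr[OF cv(1)] by blast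
  qed
  moreover have "v \<in> ext nn hA" using std_in_h[OF A v(3,1)] unfolding LV_def by blast
  ultimately show ?thesis using v(1) cv(2) ext_n[OF v(1)] by blast
qed

text \<open>The least closing level, so that the sequence of levels is determined and lies in \<open>N\<close>.\<close>

definition Nxt where
  "Nxt m t t' \<longleftrightarrow> t' \<in> ext m hA \<and> t \<in> ext m t' \<and> closing m t t' \<and> (\<forall>u\<in>ext m hA. u \<in> ext m t' \<longrightarrow> t \<in> ext m u \<longrightarrow> \<not> closing m t u)"

lemma D0_Nxt: "D0 {nn} (\<lambda>m s. Nxt m (s 0) (s 1))"
  unfolding Nxt_def by (intro D0_intros D0_closing tmn tm_intros A_N)

lemma Nxt_ex: assumes t: "t \<in> K" shows "\<exists>t'\<in>K. Nxt nn t t'"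
proof -
  obtain s where s: "s \<in> K" "s \<in> ext nn hA" "t \<in> ext nn s" "closing nn t s" using step_std[OF t] by blast
  let ?Y = "\<lambda>m s. t \<in> ext m s \<and> closing m t s"
  have D: "D0 {nn} (\<lambda>m s. ?Y m (s 0))" by (intro D0_intros D0_closing tmn tm_intros K_N[OF t])
  obtain z where z: "z \<in> ext nn hA" "?Y nn z" "\<forall>u\<in>ext nn hA. u \<in> ext nn z \<longrightarrow> \<not> ?Y nn u"
    using least_level[of ?Y, OF D A_N(2) s(2)] s(3,4) by blast
  have "s \<notin> ext nn z" using z(3) s by blast
  then have "z \<in> ext nn s \<or> z = s" using LV_linear[OF hA_LV[OF s(2)] hA_LV[OF z(1)]] by blast
  then have "z \<in> K" using F_end[OF s(1)] s(1) by blast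
  moreover have "Nxt nn t z" unfolding Nxt_def using z by blast
  ultimately show ?thesis by blast
qed

lemma Nxt_unique: assumes "Nxt nn t y" "Nxt nn t y'" shows "y = y'"
proof -
  have "LV y hA QA" "LV y' hA QA" using assms hA_LV unfolding Nxt_def by blast+
  moreover have "y \<notin> ext nn y'" "y' \<notin> ext nn y" using assms unfolding Nxt_def by blast+
  ultimately show ?thesis using LV_linear by blast
qed

lemma sat_std: assumes "q \<in> Delta0" "range s \<subseteq> K" shows "sat K vmem s q \<longleftrightarrow> sat N F s q"
proof (rule Pi2_iff[OF _ assms(2)])
  have "foldr Ex [] q \<in> levy_Sigma 1" using assms(1) unfolding One_nat_def levy_Sigma.simps levy_Pi.simps by blast
  then have "foldr All [] (foldr Ex [] q) \<in> levy_Pi 2" unfolding numeral_2_eq_2 levy_Pi.simps(2) One_nat_def by blast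
  then show "q \<in> levy_Pi 2" by simp
qed

lemma sat_all_std: assumes "q \<in> Delta0" "range s \<subseteq> K" shows "sat K vmem s (All j q) \<longleftrightarrow> sat N F s (All j q)"
proof (rule Pi2_iff[OF _ assms(2)])
  have "foldr Ex [] q \<in> levy_Sigma 1" using assms(1) unfolding One_nat_def levy_Sigma.simps levy_Pi.simps by blast
  then have "foldr All [j] (foldr Ex [] q) \<in> levy_Pi 2" unfolding numeral_2_eq_2 levy_Pi.simps(2) One_nat_def by blast
  then show "All j q \<in> levy_Pi 2" by simp
qed

lemma level_abs: assumes "LV b h Q" "q \<in> Delta0" "x \<in> ext nn b" "\<forall>i\<in>fv q. s i \<in> ext nn b"
  shows "sat (ext nn b) F s q \<longleftrightarrow> sat N F s q"
proof -
  have "sat (ext nn b) (snd nn) s q \<longleftrightarrow> Sat nn s q"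
  proof (rule Delta0_abs_fv[OF assms(2) _ _ assms(3,4)])
    show "ext nn b \<subseteq> fst nn" using ext_car[of _ nn b] by blast
    show "ext nn x \<subseteq> ext nn b" if "x \<in> ext nn b" for x using LV_trans[OF assms(1) that] by blast
  qed
  then show ?thesis by simp
qed

text \<open>The union \<open>U\<close> of the closing sequence is not all of \<open>K\<close> by \<open>not_internal\<close>, so it is contained in a standard level and
  is standard. To see that \<open>U\<close> is closed, a statement \<open>\<forall>z. q\<close> about \<open>y\<close> is expressed as the failure of
  \<open>\<exists>z. \<not> q\<close> at every level: levels are transitive and contain any given standard sets, so for \<open>\<Delta>\<^sub>0\<close> formulae \<open>q\<close> this is the same.\<close>

lemma reflecting_top_False: False
proof -
  let ?P = "\<lambda>x. x \<in> K \<and> x \<in> ext nn hA"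
  have "\<exists>f. \<forall>n. ?P (f n) \<and> Nxt nn (f n) (f (Suc n))"
  proof (rule dependent_nat_choice[of "\<lambda>n. ?P" "\<lambda>n. Nxt nn"])
    obtain x where "x \<in> K" using K_ne by blast
    then obtain v h Q where v: "v \<in> K" "LV v h Q" using std_level by blast
    then show "\<exists>x. ?P x" using std_in_h[OF A v(2,1)] unfolding LV_def by blast
    fix x and n :: nat assume "?P x"
    then show "\<exists>y. ?P y \<and> Nxt nn x y" using Nxt_ex[of x] unfolding Nxt_def by blast
  qed
  then obtain f where f: "\<And>n. f n \<in> K" "\<And>n. f n \<in> ext nn hA" "\<And>n. Nxt nn (f n) (f (Suc n))" by blast
  have "\<exists>Z\<in>fst nn. ext nn Z = range f"
  proof (rule n.omega_rec[where \<psi> = "\<lambda>m x y w. Nxt m x y" and x = f])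
    show "D0 {nn} (\<lambda>m s. Nxt m (s 0) (s 1))" by (rule D0_Nxt)
    show "f i \<in> fst nn" for i using K_N[OF f(1)] by simp
    show "\<exists>w\<in>fst nn. Nxt nn (f i) (f (Suc i))" for i using f(3) K_N[OF f(1)] by auto
    show "y = f (Suc i)" if "Nxt nn (f i) y" for i y by (rule Nxt_unique[OF that f(3)])
  qed
  then obtain Z where Z: "Z \<in> fst nn" "ext nn Z = range f" by blast
  obtain U where U: "U \<in> N" "ext nn U = (\<Union>i. ext nn (f i))" using n0.union[OF Z(1)] unfolding Z(2) by auto
  have ef: "ext nn (f i) = elts (f i)" for i by (rule ext_n[OF f(1)])
  have Ue: "ext nn U = (\<Union>i. elts (f i))" using U(2) unfolding ef .
  have f_tr: "elts x \<subseteq> elts (f i)" if "x \<in> elts (f i)" for x i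
    using LV_trans[OF hA_LV[OF f(2)[of i]], of x] that ext_n[OF K_trans[OF f(1) that]] unfolding ef by blast
  have f_Suc: "f i \<in> elts (f (Suc i))" for i using f(3)[of i] unfolding Nxt_def ef by blast
  have UK: "ext nn U \<subseteq> K" unfolding Ue using K_trans[OF f(1)] by blast
  have "ext nn U \<noteq> K" by (rule not_internal[OF U(1)])
  then obtain x where x: "x \<in> K" "x \<notin> ext nn U" using UK by blast
  obtain v h Q where v: "v \<in> K" "x \<in> elts v" "LV v h Q" using std_level[OF x(1)] by blast
  have "elts (f i) \<subseteq> elts v" for i
  proof -
    have x': "x \<notin> elts (f i)" using x(2) unfolding Ue by blast
    have "v \<notin> ext nn (f i)" using f_tr[of v i] v(2) x' unfolding ef by blast
    then have "f i \<in> ext nn v" using LV_linear[OF v(3) hA_LV[OF f(2)[of i]]] x' v(2) by blast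
    then show ?thesis using LV_trans[OF v(3), of "f i"] ef[of i] ext_n[OF v(1)] by blast
  qed
  then have UK: "U \<in> K" using subset_std[OF U(1) v(1)] unfolding Ue by blast
  have Uelts: "elts U = (\<Union>i. elts (f i))" using Ue ext_n[OF UK] by blast
  have tr: "elts y \<subseteq> elts U" if "y \<in> elts U" for y using that f_tr unfolding Uelts by blast
  have "S2cl (elts U)" unfolding S2cl_def
  proof (intro ballI allI impI, elim conjE bexE)
    fix q i j s y0 assume q: "q \<in> Delta0" and ij: "(i::nat) \<noteq> j" and s: "range s \<subseteq> elts U"
      and y0: "y0 \<in> K" "\<forall>z\<in>K. sat K vmem (s(i := y0, j := z)) q"
    define n where "n = fresh (insert i (insert j (fv q)))"
    have nb: "l < n" if "l \<in> insert i (insert j (fv q))" for l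
      using fresh_gt[OF _ that] finite_fv[of q] unfolding n_def by simp
    \<comment> \<open>The list holds the values of all relevant variables, and the value of variable \<open>i\<close> is appended at position \<open>n\<close>.\<close>
    let ?xs = "map s [0..<n]"
    let ?r = "\<lambda>l. if l = i then n else l"
    let ?d = "enc (Ex j (Neg q)) ?r (Suc n)"
    have xsU: "set ?xs \<subseteq> elts U" using s by auto
    have sK: "range s \<subseteq> K" using s K_trans[OF UK] by blast
    have enc: "dsat B E ?d (?xs @ [y]) \<longleftrightarrow> (\<exists>z\<in>B. \<not> sat B E (s(i := y, j := z)) q)" for B E y
    proof -
      have "dsat B E (enc (Ex j (Neg q)) ?r (length (?xs @ [y]))) (?xs @ [y]) \<longleftrightarrow> sat B E (s(i := y)) (Ex j (Neg q))"
        by (rule dsat_enc) (use nb in \<open>auto simp: nth_append intro: less_SucI\<close>)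
      then show ?thesis by simp
    qed
    have abs: "sat (ext nn b) F (s(i := y, j := z)) q \<longleftrightarrow> sat N F (s(i := y, j := z)) q"
      if b: "LV b h Q" and xs: "set (?xs @ [y]) \<subseteq> ext nn b" and z: "z \<in> ext nn b" for b h Q y z
    proof (rule level_abs[OF b q z])
      show "\<forall>l\<in>fv q. (s(i := y, j := z)) l \<in> ext nn b" using xs z nb by auto
    qed
    have "\<not> holds_in_top ?d (?xs @ [y0])"
    proof
      assume "holds_in_top ?d (?xs @ [y0])"
      then obtain b where b: "b \<in> ext nn hA" "set (?xs @ [y0]) \<subseteq> ext nn b" "dsat (ext nn b) F ?d (?xs @ [y0])"
        unfolding holds_in_top_def holds_at_def by blast
      then obtain z where z: "z \<in> ext nn b" "\<not> sat (ext nn b) F (s(i := y0, j := z)) q" unfolding enc by blast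
      have "\<not> sat N F (s(i := y0, j := z)) q" using abs[OF hA_LV[OF b(1)] b(2) z(1)] z(2) by blast
      moreover have "sat N F (s(i := y0)) (All j q)"
      proof -
        have "range (s(i := y0)) \<subseteq> K" using sK y0(1) by auto
        moreover have "sat K vmem (s(i := y0)) (All j q)" using y0(2) by simp
        ultimately show ?thesis using sat_all_std[OF q] by blast
      qed
      ultimately show False using ext_car[OF z(1)] by simp
    qed
    then have ex: "\<exists>y\<in>ext nn \<eta>. \<not> holds_in_top ?d (?xs @ [y])" using K_eta[OF y0(1)] by blast
    obtain k where k: "set ?xs \<subseteq> elts (f k)"
      using finite_sub_chain[of "set ?xs" "\<lambda>i. elts (f i)"] xsU f_tr[OF f_Suc] unfolding Uelts by blast
    have "closing nn (f k) (f (Suc k))" using f(3) unfolding Nxt_def by blast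
    then obtain y where y: "y \<in> elts (f (Suc k))" "\<not> holds_in_top ?d (?xs @ [y])"
      using k ex unfolding closing_iff[OF f(1) f(1)] by blast
    have yU: "y \<in> elts U" using y(1) unfolding Uelts by blast
    have "sat K vmem (s(i := y, j := z)) q" if z: "z \<in> K" for z
    proof (rule ccontr)
      assume *: "\<not> sat K vmem (s(i := y, j := z)) q"
      have r: "range (s(i := y, j := z)) \<subseteq> K" using sK z K_trans[OF UK yU] by auto
      have *: "\<not> sat N F (s(i := y, j := z)) q" using * sat_std[OF q r] by blast
      obtain w where w: "w \<in> K" "elts w = {U, z}" using k_pairing[OF UK z] by blast
      obtain v h Q where v: "v \<in> K" "w \<in> elts v" "LV v h Q" using std_level[OF w(1)] by blast
      have vh: "v \<in> ext nn hA" "v \<in> ext nn A" using std_in_h[OF A v(3,1)] nonstd_contains[OF A v(1)] unfolding LV_def by blast+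
      have vtr: "elts x \<subseteq> elts v" if "x \<in> elts v" for x
        using LV_trans[OF v(3), of x] that ext_n[OF v(1)] ext_n[OF K_trans[OF v(1) that]] by blast
      have "U \<in> elts v" "z \<in> elts v" using vtr[OF v(2)] w(2) by blast+
      then have Uv: "set (?xs @ [y]) \<subseteq> ext nn v" "z \<in> ext nn v" using vtr[of U] xsU yU ext_n[OF v(1)] by auto
      have "\<not> sat (ext nn v) F (s(i := y, j := z)) q" using abs[OF v(3) Uv] * by blast
      then have "holds_at v ?d (?xs @ [y])" unfolding holds_at_def enc using Uv by blast
      then show False using y(2) vh unfolding holds_in_top_def by blast
    qed
    then show "\<exists>y\<in>elts U. \<forall>z\<in>K. sat K vmem (s(i := y, j := z)) q" using yU by blast
  qed
  moreover have "f 0 \<in> elts U" using f_Suc[of 0] unfolding Uelts by blast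
  ultimately show False using no_closed[OF UK tr] by blast
qed

end

context ext_min
begin

lemma no_proper: assumes "K \<noteq> N" shows False
proof -
  obtain e where e: "e \<in> N" "e \<notin> K" using assms K_N by blast
  obtain hA QA A where A: "LV A hA QA" "e \<in> ext nn A" using N_level[OF e(1)] unfolding LV_def by blast
  have AK: "A \<notin> K" using F_end[of A e] A(2) e(2) by blast
  obtain EA SA where E: "EA \<in> N" "SA \<in> N" "SP nn W Cd A EA SA" using N_SP[OF LV_N[OF A(1)]] by blast
  interpret nonstd_top \<alpha> N F A hA QA EA SA by unfold_locales (use A AK E in blast)+
  obtain \<eta> where \<eta>: "\<eta> \<in> ext nn hA" "\<eta> \<in> ext nn A" "\<eta> \<notin> K" "\<forall>b h Q. LV b h Q \<longrightarrow> \<not> unreflected \<eta> b"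
    using reflecting_level by blast
  interpret reflecting_top \<alpha> N F A hA QA EA SA \<eta> by unfold_locales (use \<eta> in blast)+
  show False by (rule reflecting_top_False)
qed

end

theorem theorem4p9:
  fixes \<alpha> :: "('a::infinite) V"
  assumes "ordinal \<alpha>" and "countable (elts \<alpha>)"
    and "minimum_model (M_theory \<union> Collection (levy_Pi 1)) (Lset \<alpha>)"
  shows "\<not> (\<exists>(N :: 'a V set) (F :: 'a V \<Rightarrow> 'a V \<Rightarrow> bool).
           end_ext 2 (elts (Lset \<alpha>)) vmem N F \<and> elts (Lset \<alpha>) \<noteq> N \<and>
           models N F (Collection Delta0))"
proof
  assume "\<exists>(N :: 'a V set) F. end_ext 2 (elts (Lset \<alpha>)) vmem N F \<and> elts (Lset \<alpha>) \<noteq> N \<and> models N F (Collection Delta0)"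
  then obtain N F where NF: "end_ext 2 (elts (Lset \<alpha>)) vmem N F" "elts (Lset \<alpha>) \<noteq> N" "models N F (Collection Delta0)"
    by blast
  interpret ext_min \<alpha> N F
    by unfold_locales (use assms(3) NF in \<open>auto simp: minimum_model_def\<close>)
  show False by (rule no_proper[OF NF(2)])
qed

end
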